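(* Let $s,t>0$ satisfy $s+t>1$ and let $u\in(\Sigma_t^s)'(\mathbf R^d)$. Then: (i) $\mathrm{WF}^{s,t}(\widehat u)=\mathcal J\,\mathrm{WF}^{t,s}(u)$; (ii) if $A\in\mathrm{GL}(d,\mathbf R)$ and $u_A(x)=|A|^{1/2}u(Ax)$, then $$\mathrm{WF}^{t,s}(u_A)=\begin{pmatrix}A^{-1}&0\\0&A^T\end{pmatrix}\mathrm{WF}^{t,s}(u).$$
   Context: Notation: $\mathbf N=\{0,1,2,\dots\}$, $D^\beta=(-i)^{|\beta|}\partial^\beta$; $|A|$ is the determinant and $A^T$ the transpose of $A$ (the factor $|A|^{1/2}$ is a nonzero scalar), and $$\mathcal J=\begin{pmatrix}0&I_d\\-I_d&0\end{pmatrix}\in\mathbf R^{2d\times2d}.$$ For $s,t>0$ with $s+t>1$, the (Beurling type) Gelfand--Shilov space $\Sigma_t^s(\mathbf R^d)$ consists of all $f\in C^\infty(\mathbf R^d)$ such that for every $h>0$ $$\|f\|_{\mathcal S_{t,h}^s}=\sup_{\alpha,\beta\in\mathbf N^d,\,x\in\mathbf R^d}\frac{|x^\alpha D^\beta f(x)|}{h^{|\alpha+\beta|}\alpha!^t\beta!^s}<\infty,$$ with the Fréchet topology given by these seminorms. $(\Sigma_t^s)'(\mathbf R^d)$ is its topological dual; the action $(u,\varphi)$ is conjugate linear in $\varphi$ and consistent with the $L^2$ inner product. Fourier transform: $\widehat f(\xi)=(2\pi)^{-d/2}\int_{\mathbf R^d}f(x)e^{-i\langle x,\xi\rangle}dx$;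 it is a homeomorphism $\Sigma_t^s(\mathbf R^d)\to\Sigma_s^t(\mathbf R^d)$ and extends to $(\Sigma_t^s)'(\mathbf R^d)\to(\Sigma_s^t)'(\mathbf R^d)$ by $(\widehat u,\widehat\varphi)=(u,\varphi)$. The composition $u(A\cdot)$ with a linear invertible map is defined for ultradistributions in the usual way by duality. Short-time Fourier transform: with $T_xf(y)=f(y-x)$, $M_\xi f(y)=e^{i\langle y,\xi\rangle}f(y)$, set $V_\psi u(x,\xi)=(2\pi)^{-d/2}(u,M_\xi T_x\psi)$. Wave front set: write $T^*\mathbf R^d\simeq\mathbf R^{2d}$. For $u\in(\Sigma_t^s)'(\mathbf R^d)$ and a fixed $\psi\in\Sigma_t^s(\mathbf R^d)\setminus\{0\}$, $\mathrm{WF}^{t,s}(u)\subseteq T^*\mathbf R^d\setminus 0$ is defined by: $(x_0,\xi_0)\in T^*\mathbf R^d\setminus0$ satisfies $(x_0,\xi_0)\notin\mathrm{WF}^{t,s}(u)$ if there is an open set $U\subseteq T^*\mathbf R^d\setminus0$ containing $(x_0,\xi_0)$ such that $$\sup_{\lambda>0,\,(x,\xi)\in U}e^{r\lambda}|V_\psi u(\lambda^tx,\lambda^s\xi)|<\infty\quad\forall r>0.$$ The definition does not depend on the choice of $\psi$. $\mathrm{WF}^{s,t}$ (for elements of $(\Sigma_s^t)'(\mathbf R^d)$) is obtained by exchanging the roles of $s$ and $t$. *)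

theory Defs
  imports "HOL-Analysis.Analysis"
begin

text \<open>The dimension d is \<open>CARD('n)\<close>; a multi-index is a function \<open>'n \<Rightarrow> nat\<close>.\<close>

definition mi_abs :: "('n::finite \<Rightarrow> nat) \<Rightarrow> nat" where
  "mi_abs \<alpha> = (\<Sum>i\<in>UNIV. \<alpha> i)"

definition mi_fact :: "('n::finite \<Rightarrow> nat) \<Rightarrow> nat" where
  "mi_fact \<alpha> = (\<Prod>i\<in>UNIV. fact (\<alpha> i))"

definition mi_pow :: "real ^ 'n::finite \<Rightarrow> ('n \<Rightarrow> nat) \<Rightarrow> real" where
  "mi_pow x \<alpha> = (\<Prod>i\<in>UNIV. (x $ i) ^ \<alpha> i)"

definition partial :: "'n::finite \<Rightarrow> (real ^ 'n \<Rightarrow> complex) \<Rightarrow> real ^ 'n \<Rightarrow> complex" where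
  "partial i f x = frechet_derivative f (at x) (axis i 1)"

definition smooth :: "(real ^ 'n::finite \<Rightarrow> complex) \<Rightarrow> bool" where
  "smooth f \<longleftrightarrow> (\<forall>is x. foldr partial is f differentiable (at x))"

text \<open>An index type of class \<open>finite\<close> carries no order, so the order in which the partial
  derivatives are applied is an arbitrary fixed enumeration of the coordinates. For smooth
  functions the order is immaterial.\<close>

definition coords :: "'n::finite list" where
  "coords = (SOME is. distinct is \<and> set is = UNIV)"

definition mi_deriv :: "('n::finite \<Rightarrow> nat) \<Rightarrow> (real ^ 'n \<Rightarrow> complex) \<Rightarrow> real ^ 'n \<Rightarrow> complex" where
  "mi_deriv \<beta> f = foldr (\<lambda>i. partial i ^^ \<beta> i) coords f"

definition D :: "('n::finite \<Rightarrow> nat) \<Rightarrow> (real ^ 'n \<Rightarrow> complex) \<Rightarrow> real ^ 'n \<Rightarrow> complex" where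
  "D \<beta> f x = (- \<i>) ^ mi_abs \<beta> * mi_deriv \<beta> f x"

definition gs_norm :: "real \<Rightarrow> real \<Rightarrow> real \<Rightarrow> (real ^ 'n::finite \<Rightarrow> complex) \<Rightarrow> ennreal" where
  "gs_norm t s h f =
     (SUP \<alpha>. SUP \<beta>. SUP x. ennreal (norm (complex_of_real (mi_pow x \<alpha>) * D \<beta> f x) /
        (h ^ (mi_abs \<alpha> + mi_abs \<beta>) * real (mi_fact \<alpha>) powr t * real (mi_fact \<beta>) powr s)))"

text \<open>\<open>gs_space t s\<close> has decay index t and regularity index s, i.e. it is the space
  with lower index t and upper index s.\<close>

definition gs_space :: "real \<Rightarrow> real \<Rightarrow> (real ^ 'n::finite \<Rightarrow> complex) set" where
  "gs_space t s = {f. smooth f \<and> (\<forall>h>0. gs_norm t s h f < \<infinity>)}"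

definition gs_topology :: "real \<Rightarrow> real \<Rightarrow> (real ^ 'n::finite \<Rightarrow> complex) topology" where
  "gs_topology t s = topology_generated_by
     {{g \<in> gs_space t s. gs_norm t s h (\<lambda>x. g x - f x) < ennreal e} | f h e.
        f \<in> gs_space t s \<and> h > 0 \<and> e > 0}"

text \<open>Elements of the dual act conjugate linearly. Only their values on \<open>gs_space t s\<close> matter;
  the values elsewhere are unconstrained.\<close>

definition gs_dual :: "real \<Rightarrow> real \<Rightarrow> ((real ^ 'n::finite \<Rightarrow> complex) \<Rightarrow> complex) set" where
  "gs_dual t s = {u.
     (\<forall>\<phi>\<in>gs_space t s. \<forall>\<psi>\<in>gs_space t s. u (\<lambda>x. \<phi> x + \<psi> x) = u \<phi> + u \<psi>) \<and>
     (\<forall>c. \<forall>\<phi>\<in>gs_space t s. u (\<lambda>x. c * \<phi> x) = cnj c * u \<phi>) \<and>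
     continuous_map (gs_topology t s) euclidean u}"

definition fourier :: "(real ^ 'n::finite \<Rightarrow> complex) \<Rightarrow> real ^ 'n \<Rightarrow> complex" where
  "fourier f \<xi> = complex_of_real ((2 * pi) powr (- real CARD('n) / 2)) *
     (LINT x|lborel. f x * exp (- \<i> * complex_of_real (x \<bullet> \<xi>)))"

text \<open>The Fourier transform of u is determined by its value at the Fourier transform of \<open>\<phi>\<close>
  being \<open>u \<phi>\<close>, since \<open>fourier\<close> maps \<open>gs_space t s\<close> bijectively onto \<open>gs_space s t\<close>.\<close>

definition fourier_dual :: "real \<Rightarrow> real \<Rightarrow> ((real ^ 'n::finite \<Rightarrow> complex) \<Rightarrow> complex)
    \<Rightarrow> (real ^ 'n \<Rightarrow> complex) \<Rightarrow> complex" where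
  "fourier_dual t s u \<phi> = u (inv_into (gs_space t s) fourier \<phi>)"

text \<open>The composition \<open>u (A \<cdot>)\<close>, from substituting \<open>y = A x\<close> in the integral of
  \<open>u (A x) * cnj (\<phi> x)\<close>.\<close>

definition compose_dual :: "real ^ 'n ^ 'n \<Rightarrow> ((real ^ 'n::finite \<Rightarrow> complex) \<Rightarrow> complex)
    \<Rightarrow> (real ^ 'n \<Rightarrow> complex) \<Rightarrow> complex" where
  "compose_dual A u \<phi> = complex_of_real (1 / \<bar>det A\<bar>) * u (\<lambda>y. \<phi> (matrix_inv A *v y))"

text \<open>The determinant may be negative, so its square root is the principal complex one.\<close>

definition metaplectic_dual :: "real ^ 'n ^ 'n \<Rightarrow> ((real ^ 'n::finite \<Rightarrow> complex) \<Rightarrow> complex)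
    \<Rightarrow> (real ^ 'n \<Rightarrow> complex) \<Rightarrow> complex" where
  "metaplectic_dual A u \<phi> = csqrt (complex_of_real (det A)) * compose_dual A u \<phi>"

definition translate :: "real ^ 'n::finite \<Rightarrow> (real ^ 'n \<Rightarrow> complex) \<Rightarrow> real ^ 'n \<Rightarrow> complex" where
  "translate x f y = f (y - x)"

definition modulate :: "real ^ 'n::finite \<Rightarrow> (real ^ 'n \<Rightarrow> complex) \<Rightarrow> real ^ 'n \<Rightarrow> complex" where
  "modulate \<xi> f y = exp (\<i> * complex_of_real (y \<bullet> \<xi>)) * f y"

definition stft :: "(real ^ 'n::finite \<Rightarrow> complex) \<Rightarrow> ((real ^ 'n \<Rightarrow> complex) \<Rightarrow> complex)
    \<Rightarrow> real ^ 'n \<Rightarrow> real ^ 'n \<Rightarrow> complex" where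
  "stft \<psi> u x \<xi> = complex_of_real ((2 * pi) powr (- real CARD('n) / 2)) *
     u (modulate \<xi> (translate x \<psi>))"

text \<open>\<open>WF t s \<psi> u\<close> is the wave front set with exponents t, s computed with the window \<open>\<psi>\<close>.\<close>

definition WF :: "real \<Rightarrow> real \<Rightarrow> (real ^ 'n::finite \<Rightarrow> complex)
    \<Rightarrow> ((real ^ 'n \<Rightarrow> complex) \<Rightarrow> complex) \<Rightarrow> ((real ^ 'n) \<times> (real ^ 'n)) set" where
  "WF t s \<psi> u = {p. p \<noteq> 0 \<and>
     \<not> (\<exists>U. open U \<and> U \<subseteq> - {0} \<and> p \<in> U \<and>
          (\<forall>r>0. bdd_above {exp (r * l) * norm (stft \<psi> u (l powr t *\<^sub>R x) (l powr s *\<^sub>R \<xi>))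
             | l x \<xi>. l > 0 \<and> (x, \<xi>) \<in> U}))}"

text \<open>Action of the block matrix with rows (P, Q) and (R, S) on phase space.\<close>

definition block_apply :: "real ^ 'n ^ 'n \<Rightarrow> real ^ 'n ^ 'n \<Rightarrow> real ^ 'n ^ 'n \<Rightarrow> real ^ 'n ^ 'n
    \<Rightarrow> (real ^ 'n::finite) \<times> (real ^ 'n) \<Rightarrow> (real ^ 'n) \<times> (real ^ 'n)" where
  "block_apply P Q R S = (\<lambda>(x, \<xi>). (P *v x + Q *v \<xi>, R *v x + S *v \<xi>))"

definition J_map :: "(real ^ 'n::finite) \<times> (real ^ 'n) \<Rightarrow> (real ^ 'n) \<times> (real ^ 'n)" where
  "J_map = block_apply 0 (mat 1) (- mat 1) 0"

end

theory Submission
  imports Defs "HOL-Probability.Characteristic_Functions" "HOL-Probability.Sinc_Integral"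
begin

text \<open>Both statements are exact identities for the short-time Fourier transform once the window may
  change: with \<open>\<eta>\<close> the Fourier transform of \<open>\<phi>\<close>, the transform of \<open>u\<close> hat with window \<open>\<eta>\<close> at \<open>(x, \<xi>)\<close> has the
  same modulus as that of \<open>u\<close> with window \<open>\<phi>\<close> at \<open>(-\<xi>, x)\<close>, and composing \<open>u\<close> with \<open>A\<close> amounts to replacing
  the window \<open>\<psi>\<close> by \<open>\<psi> \<circ> A\<^sup>-\<^sup>1\<close> and \<open>(x, \<xi>)\<close> by the linear image of it. Hence everything rests on the
  independence of the wave front set from the window. For this, the new window is written as a
  superposition of time-frequency shifts of the old one; applying \<open>u\<close> under the integral bounds the new
  transform by a convolution of the old one with a function that decays faster than every
  \<open>exp (- r * (norm x powr (1 / t) + norm \<xi> powr (1 / s)))\<close>.\<close>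

section \<open>Iterated partial derivatives\<close>

text \<open>Two quantifiers over h balance each other. Continuity of \<open>u\<close> singles out
  one h, so its short-time transform grows at most like exp (r0 * wt) for one rate r0
  (\<open>u_tfs_growth\<close>). Test functions obey their bounds for every h, so the transform of
  one against another decays like exp (- r * wt) for every r (\<open>sv_decay\<close>), and this
  beats any fixed r0. The obstacle is that \<open>u\<close> acts on a space of functions known only
  through seminorms: a superposition must converge in the seminorm that bounds \<open>u\<close>,
  that is with one constant for all derivatives and all polynomial weights. Hence every estimate
  records how much h it loses and how its constant depends on the shift, and shifts of a window are
  shown to be locally Lipschitz in these seminorms. The superposition formula is Fourier inversion
  in the frequency variable. Inversion also shows that every window for the Fourier transform of
  \<open>u\<close> is itself the Fourier transform of a test function.\<close>

text \<open>Iterated derivatives are indexed by words in the coordinates instead of multi-indices, which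
  makes inductive arguments order-free. Schwarz's theorem links the two in \<open>derivs_mset_eq\<close>.\<close>

abbreviation derivs :: "'n::finite list \<Rightarrow> (real ^ 'n \<Rightarrow> complex) \<Rightarrow> real ^ 'n \<Rightarrow> complex" where
  "derivs w f \<equiv> foldr partial w f"

lemma partial_eqI:
  "(f has_derivative F) (at x) \<Longrightarrow> partial i f x = F (axis i 1)"
  unfolding partial_def using frechet_derivative_at by metis

lemma has_derivative_partial:
  fixes f :: "real ^ 'n::finite \<Rightarrow> complex"
  assumes "f differentiable (at x)"
  shows "(f has_derivative (\<lambda>h. \<Sum>i\<in>UNIV. h $ i *\<^sub>R partial i f x)) (at x)"
proof -
  let ?F = "frechet_derivative f (at x)"
  have F: "(f has_derivative ?F) (at x)"
    using assms frechet_derivative_works by blast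
  have lin: "linear ?F" using assms by (rule linear_frechet_derivative)
  have "?F h = (\<Sum>i\<in>UNIV. h $ i *\<^sub>R partial i f x)" for h
  proof -
    have "?F h = ?F (\<Sum>i\<in>UNIV. h $ i *\<^sub>R axis i 1)"
      by (simp add: basis_expansion flip: scalar_mult_eq_scaleR)
    also have "\<dots> = (\<Sum>i\<in>UNIV. h $ i *\<^sub>R ?F (axis i 1))"
      by (simp add: linear_sum[OF lin] linear_scale[OF lin])
    finally show ?thesis by (simp add: partial_def)
  qed
  then show ?thesis using F by (metis (no_types, lifting) ext)
qed

text \<open>Graded by order because smoothness alone supports no induction: closure under sums,
  products and linear substitutions is proved order by order, for all functions at once.\<close>

definition ndiff :: "nat \<Rightarrow> (real ^ 'n::finite \<Rightarrow> complex) \<Rightarrow> bool" where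
  "ndiff n f \<longleftrightarrow> (\<forall>w x. length w \<le> n \<longrightarrow> derivs w f differentiable (at x))"

lemma smooth_iff_ndiff: "smooth f \<longleftrightarrow> (\<forall>n. ndiff n f)"
  unfolding smooth_def ndiff_def by auto

lemma ndiff_0: "ndiff 0 f \<longleftrightarrow> (\<forall>x. f differentiable (at x))"
  by (auto simp: ndiff_def)

text \<open>\<open>foldr\<close> applies the last letter of a word first, so that letter is the one
  split off; what remains concerns \<open>partial i f\<close>, as inductions on n require.\<close>

lemma ndiff_Suc: "ndiff (Suc n) f \<longleftrightarrow> (\<forall>x. f differentiable (at x)) \<and> (\<forall>i. ndiff n (partial i f))"
proof
  assume L: "ndiff (Suc n) f"
  have "derivs w (partial i f) differentiable (at x)" if "length w \<le> n" for w i x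
    using L[unfolded ndiff_def, rule_format, of "w @ [i]" x] that by simp
  moreover have "f differentiable (at x)" for x
    using L[unfolded ndiff_def, rule_format, of "[]" x] by simp
  ultimately show "(\<forall>x. f differentiable (at x)) \<and> (\<forall>i. ndiff n (partial i f))"
    by (auto simp: ndiff_def)
next
  assume R: "(\<forall>x. f differentiable (at x)) \<and> (\<forall>i. ndiff n (partial i f))"
  show "ndiff (Suc n) f"
    unfolding ndiff_def
  proof (intro allI impI)
    fix w :: "'a list" and x assume w: "length w \<le> Suc n"
    show "derivs w f differentiable (at x)"
    proof (cases w rule: rev_cases)
      case Nil then show ?thesis using R by simp
    next
      case (snoc v i)
      then show ?thesis using R w by (simp add: ndiff_def)
    qed
  qed
qed

lemma ndiff_differentiable: "ndiff n f \<Longrightarrow> f differentiable (at x)"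
  by (cases n) (auto simp: ndiff_0 ndiff_Suc)

lemma ndiff_SucD: "ndiff (Suc n) f \<Longrightarrow> ndiff n f"
  by (auto simp: ndiff_def)

lemma smooth_differentiable: "smooth f \<Longrightarrow> f differentiable (at x)"
  using ndiff_differentiable smooth_iff_ndiff by blast

lemma smooth_partial: "smooth f \<Longrightarrow> smooth (partial i f)"
  using ndiff_Suc smooth_iff_ndiff by blast

lemma smooth_derivs: "smooth f \<Longrightarrow> smooth (derivs w f)"
  by (induction w) (auto intro: smooth_partial)

lemma smooth_continuous_on: "smooth f \<Longrightarrow> continuous_on S f"
  using smooth_differentiable
  by (metis continuous_at_imp_continuous_on differentiable_imp_continuous_within)

lemma smooth_measurable [measurable_dest]: "smooth f \<Longrightarrow> f \<in> borel_measurable borel"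
  by (intro borel_measurable_continuous_onI smooth_continuous_on)

lemma partial_const: "partial i (\<lambda>x. c) = (\<lambda>x. 0)"
  by (intro ext partial_eqI[where F = "\<lambda>_. 0", simplified]) simp

lemma partial_add:
  assumes "\<And>x. f differentiable (at x)" "\<And>x. g differentiable (at x)"
  shows "partial i (\<lambda>x. f x + g x) = (\<lambda>x. partial i f x + partial i g x)"
  by (rule ext, rule partial_eqI[THEN trans])
     (use assms in \<open>auto simp: partial_def frechet_derivative_works intro!: has_derivative_add\<close>)

lemma partial_cmult:
  assumes "\<And>x. f differentiable (at x)"
  shows "partial i (\<lambda>x. c * f x) = (\<lambda>x. c * partial i f x)"
  by (rule ext, rule partial_eqI[THEN trans])
     (use assms in \<open>auto simp: partial_def frechet_derivative_works intro!: has_derivative_mult_right\<close>)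

lemma partial_mult:
  assumes "\<And>x. f differentiable (at x)" "\<And>x. g differentiable (at x)"
  shows "partial i (\<lambda>x. f x * g x) = (\<lambda>x. partial i f x * g x + f x * partial i g x)"
  by (rule ext, rule partial_eqI[THEN trans, OF has_derivative_mult[OF
       assms(1)[unfolded frechet_derivative_works] assms(2)[unfolded frechet_derivative_works]]])
     (auto simp: partial_def)

lemma partial_cnj:
  assumes "\<And>x. f differentiable (at x)"
  shows "partial i (\<lambda>x. cnj (f x)) = (\<lambda>x. cnj (partial i f x))"
  by (rule ext, rule partial_eqI[THEN trans, OF has_derivative_cnj[OF
       assms(1)[unfolded frechet_derivative_works]]])
     (auto simp: partial_def)

lemma partial_translate:
  assumes "\<And>x. f differentiable (at x)"
  shows "partial i (translate a f) = translate a (partial i f)"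
proof
  fix x
  have "((\<lambda>x. f (x - a)) has_derivative (\<lambda>h. frechet_derivative f (at (x - a)) h)) (at x)"
    by (rule has_derivative_compose[of "\<lambda>x. x - a" "\<lambda>h. h" x UNIV f, simplified])
       (use assms in \<open>auto simp: frechet_derivative_works intro!: derivative_eq_intros\<close>)
  then show "partial i (translate a f) x = translate a (partial i f) x"
    by (subst partial_eqI[where F = "frechet_derivative f (at (x - a))"])
       (auto simp: translate_def [abs_def] partial_def)
qed

lemma differentiable_cnj:
  "f differentiable F \<Longrightarrow> (\<lambda>x. cnj (f x)) differentiable F"
  unfolding differentiable_def by (metis has_derivative_cnj)

lemma norm_triangle_le_diff:
  "norm x + norm y \<le> e \<Longrightarrow> norm (x - y) \<le> e" for x y :: "'a::real_normed_vector"
  using norm_triangle_ineq4[of x y] by linarith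

lemma ndiff_const: "ndiff n (\<lambda>x. c)"
  by (induction n arbitrary: c) (auto simp: ndiff_0 ndiff_Suc partial_const)

lemma ndiff_add: "ndiff n f \<Longrightarrow> ndiff n g \<Longrightarrow> ndiff n (\<lambda>x. f x + g x)"
proof (induction n arbitrary: f g)
  case (Suc n)
  then show ?case by (auto simp: ndiff_Suc partial_add)
qed (auto simp: ndiff_0)

lemma ndiff_mult: "ndiff n f \<Longrightarrow> ndiff n g \<Longrightarrow> ndiff n (\<lambda>x. f x * g x)"
proof (induction n arbitrary: f g)
  case (Suc n)
  have "ndiff n (\<lambda>x. partial i f x * g x + f x * partial i g x)" for i
    using Suc.prems ndiff_SucD[OF Suc.prems(1)] ndiff_SucD[OF Suc.prems(2)]
    by (intro ndiff_add Suc.IH) (auto simp: ndiff_Suc)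
  then show ?case using Suc.prems by (auto simp: ndiff_Suc partial_mult)
qed (auto simp: ndiff_0)

lemma ndiff_cnj: "ndiff n f \<Longrightarrow> ndiff n (\<lambda>x. cnj (f x))"
proof (induction n arbitrary: f)
  case (Suc n)
  then show ?case
    by (auto simp: ndiff_Suc partial_cnj differentiable_cnj)
qed (auto simp: ndiff_0 differentiable_cnj)

lemma smooth_const: "smooth (\<lambda>x. c)"
  by (simp add: smooth_iff_ndiff ndiff_const)

lemma smooth_add: "smooth f \<Longrightarrow> smooth g \<Longrightarrow> smooth (\<lambda>x. f x + g x)"
  by (simp add: smooth_iff_ndiff ndiff_add)

lemma smooth_mult: "smooth f \<Longrightarrow> smooth g \<Longrightarrow> smooth (\<lambda>x. f x * g x)"
  by (simp add: smooth_iff_ndiff ndiff_mult)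

lemma smooth_cnj: "smooth f \<Longrightarrow> smooth (\<lambda>x. cnj (f x))"
  by (simp add: smooth_iff_ndiff ndiff_cnj)

lemma smooth_cmult: "smooth f \<Longrightarrow> smooth (\<lambda>x. c * f x)"
  by (intro smooth_mult smooth_const)

lemma smooth_diff: "smooth f \<Longrightarrow> smooth g \<Longrightarrow> smooth (\<lambda>x. f x - g x)"
  using smooth_add[of f "\<lambda>x. (-1) * g x"] smooth_cmult[of g "-1"] by simp

lemma smooth_sum: "(\<And>k. k \<in> K \<Longrightarrow> smooth (f k)) \<Longrightarrow> smooth (\<lambda>x. \<Sum>k\<in>K. f k x)"
  by (induction K rule: infinite_finite_induct) (auto intro: smooth_const smooth_add)

lemma derivs_const_0: "derivs w (\<lambda>x. 0) = (\<lambda>x. 0)"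
  by (induction w) (auto simp: partial_const)

lemma derivs_add:
  "smooth f \<Longrightarrow> smooth g \<Longrightarrow> derivs w (\<lambda>x. f x + g x) = (\<lambda>x. derivs w f x + derivs w g x)"
  by (induction w) (auto simp: partial_add smooth_differentiable smooth_derivs)

lemma derivs_cmult: "smooth f \<Longrightarrow> derivs w (\<lambda>x. c * f x) = (\<lambda>x. c * derivs w f x)"
  by (induction w) (auto simp: partial_cmult smooth_differentiable smooth_derivs)

lemma derivs_diff:
  "smooth f \<Longrightarrow> smooth g \<Longrightarrow> derivs w (\<lambda>x. f x - g x) = (\<lambda>x. derivs w f x - derivs w g x)"
  using derivs_add[of f "\<lambda>x. (-1) * g x" w] derivs_cmult[of g w "-1"] smooth_cmult[of g "-1"] by simp

lemma derivs_sum: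
  "finite K \<Longrightarrow> (\<And>k. k \<in> K \<Longrightarrow> smooth (f k)) \<Longrightarrow>
    derivs w (\<lambda>x. \<Sum>k\<in>K. f k x) = (\<lambda>x. \<Sum>k\<in>K. derivs w (f k) x)"
  by (induction K rule: finite_induct) (auto simp: derivs_const_0 derivs_add smooth_sum)

lemma derivs_cnj: "smooth f \<Longrightarrow> derivs w (\<lambda>x. cnj (f x)) = (\<lambda>x. cnj (derivs w f x))"
  by (induction w) (auto simp: partial_cnj smooth_differentiable smooth_derivs)

lemma derivs_translate: "smooth f \<Longrightarrow> derivs w (translate a f) = translate a (derivs w f)"
  by (induction w) (auto simp: partial_translate smooth_differentiable smooth_derivs)

lemma smooth_translate: 
  assumes "smooth f" shows "smooth (translate a f)"
  unfolding smooth_def derivs_translate[OF assms]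
proof (intro allI)
  fix w x
  have "derivs w f differentiable (at (x - a))"
    using assms smooth_derivs smooth_differentiable by blast
  then show "translate a (derivs w f) differentiable (at x)"
    unfolding translate_def [abs_def]
    using differentiable_compose[of "derivs w f" "\<lambda>x. x - a" x UNIV] by simp
qed

section \<open>Mean value estimate and symmetry of second derivatives\<close>

lemma mean_value_partial:
  fixes f :: "real ^ 'n::finite \<Rightarrow> complex"
  assumes "\<And>x. f differentiable (at x)"
    and B: "\<And>i z. z \<in> closed_segment x y \<Longrightarrow> norm (partial i f z) \<le> B"
  shows "norm (f y - f x) \<le> real CARD('n) * B * norm (y - x)"
proof -
  have "norm (f y - f x) \<le> (real CARD('n) * B) * norm (y - x)"
  proof (rule differentiable_bound[where S = "closed_segment x y"
        and f' = "\<lambda>z h. \<Sum>i\<in>UNIV. h $ i *\<^sub>R partial i f z"])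
    fix z assume z: "z \<in> closed_segment x y"
    show "(f has_derivative (\<lambda>h. \<Sum>i\<in>UNIV. h $ i *\<^sub>R partial i f z)) (at z within closed_segment x y)"
      using has_derivative_partial assms(1) has_derivative_at_withinI by blast
    show "onorm (\<lambda>h. \<Sum>i\<in>UNIV. h $ i *\<^sub>R partial i f z) \<le> real CARD('n) * B"
    proof (rule onorm_le)
      fix h :: "real ^ 'n"
      have "norm (\<Sum>i\<in>UNIV. h $ i *\<^sub>R partial i f z) \<le> (\<Sum>i\<in>(UNIV::'n set). norm h * B)"
        by (intro sum_norm_le) (auto intro!: mult_mono B z component_le_norm_cart)
      then show "norm (\<Sum>i\<in>UNIV. h $ i *\<^sub>R partial i f z) \<le> real CARD('n) * B * norm h"
        by (simp add: mult_ac)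
    qed
  qed auto
  then show ?thesis .
qed

text \<open>The second difference over a small parallelogram is symmetric in i and j, yet
  approximates h^2 times one particular mixed derivative. Applied in both orders it forces the two
  mixed derivatives to agree.\<close>

lemma second_difference_bound:
  fixes f :: "real ^ 'n::finite \<Rightarrow> complex"
  assumes f: "\<And>x. f differentiable (at x)" and fi: "partial i f differentiable (at x)" and "\<epsilon> > 0"
  shows "\<exists>\<delta>>0. \<forall>h. 0 < h \<and> h < \<delta> \<longrightarrow>
    norm (f (x + h *\<^sub>R axis i 1 + h *\<^sub>R axis j 1) - f (x + h *\<^sub>R axis i 1)
      - f (x + h *\<^sub>R axis j 1) + f x - (h^2) *\<^sub>R partial j (partial i f) x) \<le> \<epsilon> * h^2"
proof -
  let ?L = "frechet_derivative (partial i f) (at x)"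
  let ?g = "partial i f"
  have L: "(?g has_derivative ?L) (at x)" using fi frechet_derivative_works by blast
  have lin: "linear ?L" using fi by (rule linear_frechet_derivative)
  obtain d where d: "d > 0" "\<And>y. norm (y - x) < d \<Longrightarrow>
      norm (?g y - ?g x - ?L (y - x)) \<le> \<epsilon> / 3 * norm (y - x)"
    using L[unfolded has_derivative_at_alt] \<open>\<epsilon> > 0\<close>
    by (metis divide_pos_pos zero_less_numeral)
  define a b :: "real ^ 'n" where "a = axis i 1" and "b = axis j 1"
  have ab: "norm a = 1" "norm b = 1" by (auto simp: a_def b_def)
  show ?thesis
  \<comment> \<open>All points used lie within 2 * h of x, so d / 2 keeps them where the first-order
    expansion is valid.\<close>
  proof (intro exI[of _ "d / 2"] conjI allI impI)
    show "d / 2 > 0" using d by simp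
    fix h assume h: "0 < h \<and> h < d / 2"
    \<comment> \<open>With the expected linear growth subtracted, the derivative in \<tau> has norm
      at most \<epsilon> * h, and the mean value bound on [0, h] gives \<epsilon> * h^2.\<close>
    define \<phi> where "\<phi> = (\<lambda>\<tau>. f (x + \<tau> *\<^sub>R a + h *\<^sub>R b) - f (x + \<tau> *\<^sub>R a) - \<tau> *\<^sub>R (h *\<^sub>R ?L b))"
    have der: "((\<lambda>\<tau>. f (c + \<tau> *\<^sub>R a)) has_vector_derivative ?g (c + \<tau> *\<^sub>R a)) (at \<tau> within S)" for c \<tau> S
    proof -
      have "((\<lambda>\<tau>. f (c + \<tau> *\<^sub>R a)) has_derivative (\<lambda>k. frechet_derivative f (at (c + \<tau> *\<^sub>R a)) (k *\<^sub>R a))) (at \<tau> within S)"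
        by (rule has_derivative_compose[of "\<lambda>\<tau>. c + \<tau> *\<^sub>R a" _ _ _ f])
           (use f in \<open>auto simp: frechet_derivative_works intro!: derivative_eq_intros\<close>)
      then show ?thesis
        unfolding has_vector_derivative_def
        by (simp add: linear_scale[OF linear_frechet_derivative[OF f]] partial_def a_def)
    qed
    have "norm (\<phi> h - \<phi> 0) \<le> (\<epsilon> * h) * norm (h - 0)"
    proof (rule differentiable_bound[where S = "{0..h}"
          and f' = "\<lambda>\<tau> k. k *\<^sub>R (?g (x + h *\<^sub>R b + \<tau> *\<^sub>R a) - ?g (x + \<tau> *\<^sub>R a) - h *\<^sub>R ?L b)"])
      fix \<tau> assume \<tau>: "\<tau> \<in> {0..h}"
      have der0: "((\<lambda>\<tau>. \<tau> *\<^sub>R (h *\<^sub>R ?L b)) has_vector_derivative h *\<^sub>R ?L b) (at \<tau> within {0..h})"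
        unfolding has_vector_derivative_def
        by (intro bounded_linear_imp_has_derivative bounded_linear_scaleR_left)
      have "(\<phi> has_vector_derivative (?g (x + h *\<^sub>R b + \<tau> *\<^sub>R a) - ?g (x + \<tau> *\<^sub>R a) - h *\<^sub>R ?L b)) (at \<tau> within {0..h})"
        unfolding \<phi>_def
        using has_vector_derivative_diff[OF has_vector_derivative_diff[OF der[of "x + h *\<^sub>R b" \<tau>] der[of x \<tau>]] der0]
        by (simp add: add_ac)
      then show "(\<phi> has_derivative (\<lambda>k. k *\<^sub>R (?g (x + h *\<^sub>R b + \<tau> *\<^sub>R a) - ?g (x + \<tau> *\<^sub>R a) - h *\<^sub>R ?L b))) (at \<tau> within {0..h})"
        by (simp add: has_vector_derivative_def)
      have n1: "norm (h *\<^sub>R b + \<tau> *\<^sub>R a) \<le> 2 * h" 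
        using norm_triangle_ineq[of "h *\<^sub>R b" "\<tau> *\<^sub>R a"] \<tau> h ab by auto
      have n2: "norm (\<tau> *\<^sub>R a) \<le> h" using \<tau> h ab by auto
      have e1: "norm (?g (x + h *\<^sub>R b + \<tau> *\<^sub>R a) - ?g x - ?L (h *\<^sub>R b + \<tau> *\<^sub>R a)) \<le> \<epsilon> / 3 * (2 * h)"
      proof -
        have "norm (?g (x + h *\<^sub>R b + \<tau> *\<^sub>R a) - ?g x - ?L (h *\<^sub>R b + \<tau> *\<^sub>R a)) \<le> \<epsilon> / 3 * norm (h *\<^sub>R b + \<tau> *\<^sub>R a)"
          using d(2)[of "x + (h *\<^sub>R b + \<tau> *\<^sub>R a)"] n1 h by (simp add: add.assoc)
        also have "\<dots> \<le> \<epsilon> / 3 * (2 * h)"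
          using n1 \<open>\<epsilon> > 0\<close> by (intro mult_left_mono) auto
        finally show ?thesis by (simp add: add.assoc)
      qed
      have e2: "norm (?g (x + \<tau> *\<^sub>R a) - ?g x - ?L (\<tau> *\<^sub>R a)) \<le> \<epsilon> / 3 * h"
      proof -
        have "norm (?g (x + \<tau> *\<^sub>R a) - ?g x - ?L (\<tau> *\<^sub>R a)) \<le> \<epsilon> / 3 * norm (\<tau> *\<^sub>R a)"
          using d(2)[of "x + (\<tau> *\<^sub>R a)"] n2 h by (simp add: add.assoc)
        also have "\<dots> \<le> \<epsilon> / 3 * h"
          using n2 \<open>\<epsilon> > 0\<close> by (intro mult_left_mono) auto
        finally show ?thesis by (simp add: add.assoc)
      qed
      \<comment> \<open>Both values of ?g are expanded at the same point x, the only point where ?g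
        is assumed differentiable; the two errors, 2/3 and 1/3 of \<epsilon> * h, add up.\<close>
      have eq: "?g (x + h *\<^sub>R b + \<tau> *\<^sub>R a) - ?g (x + \<tau> *\<^sub>R a) - h *\<^sub>R ?L b =
         (?g (x + h *\<^sub>R b + \<tau> *\<^sub>R a) - ?g x - ?L (h *\<^sub>R b + \<tau> *\<^sub>R a)) - (?g (x + \<tau> *\<^sub>R a) - ?g x - ?L (\<tau> *\<^sub>R a))"
        by (simp add: linear_add[OF lin] linear_scale[OF lin])
      have "norm (?g (x + h *\<^sub>R b + \<tau> *\<^sub>R a) - ?g (x + \<tau> *\<^sub>R a) - h *\<^sub>R ?L b) \<le> \<epsilon> / 3 * (2 * h) + \<epsilon> / 3 * h"
        unfolding eq by (rule norm_triangle_le_diff[OF add_mono[OF e1 e2]])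
      then have "norm (?g (x + h *\<^sub>R b + \<tau> *\<^sub>R a) - ?g (x + \<tau> *\<^sub>R a) - h *\<^sub>R ?L b) \<le> \<epsilon> * h" by simp
      then show "onorm (\<lambda>k. k *\<^sub>R (?g (x + h *\<^sub>R b + \<tau> *\<^sub>R a) - ?g (x + \<tau> *\<^sub>R a) - h *\<^sub>R ?L b)) \<le> \<epsilon> * h"
        by (intro onorm_le) (metis mult.commute mult_left_mono norm_ge_zero norm_scaleR real_norm_def)
    qed (use h in auto)
    then show "norm (f (x + h *\<^sub>R axis i 1 + h *\<^sub>R axis j 1) - f (x + h *\<^sub>R axis i 1)
      - f (x + h *\<^sub>R axis j 1) + f x - (h^2) *\<^sub>R partial j (partial i f) x) \<le> \<epsilon> * h^2"
      using h by (simp add: \<phi>_def a_def b_def partial_def power2_eq_square algebra_simps)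
  qed
qed

lemma partial_commute:
  fixes f :: "real ^ 'n::finite \<Rightarrow> complex"
  assumes f: "\<And>x. f differentiable (at x)"
    and fi: "\<And>i x. partial i f differentiable (at x)"
  shows "partial i (partial j f) = partial j (partial i f)"
proof
  fix x
  let ?A = "partial i (partial j f) x" and ?B = "partial j (partial i f) x"
  have "norm (?A - ?B) \<le> 0 + e" if "e > 0" for e
  proof -
    have e: "e / 2 > 0" using that by simp
    obtain d1 where d1: "d1 > 0" "\<And>h. 0 < h \<and> h < d1 \<Longrightarrow>
      norm (f (x + h *\<^sub>R axis i 1 + h *\<^sub>R axis j 1) - f (x + h *\<^sub>R axis i 1)
      - f (x + h *\<^sub>R axis j 1) + f x - (h^2) *\<^sub>R ?B) \<le> e / 2 * h^2"
      using second_difference_bound[OF f fi e] by metis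
    obtain d2 where d2: "d2 > 0" "\<And>h. 0 < h \<and> h < d2 \<Longrightarrow>
      norm (f (x + h *\<^sub>R axis j 1 + h *\<^sub>R axis i 1) - f (x + h *\<^sub>R axis j 1)
      - f (x + h *\<^sub>R axis i 1) + f x - (h^2) *\<^sub>R ?A) \<le> e / 2 * h^2"
      using second_difference_bound[OF f fi e] by metis
    define h where "h = min d1 d2 / 2"
    have h: "h > 0" "h < d1" "h < d2" using d1(1) d2(1) by (auto simp: h_def)
    define \<Delta> where "\<Delta> = f (x + h *\<^sub>R axis i 1 + h *\<^sub>R axis j 1) - f (x + h *\<^sub>R axis i 1)
      - f (x + h *\<^sub>R axis j 1) + f x"
    have 1: "norm (\<Delta> - (h^2) *\<^sub>R ?B) \<le> e / 2 * h^2" using d1(2) h by (simp add: \<Delta>_def)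
    have 2: "norm (\<Delta> - (h^2) *\<^sub>R ?A) \<le> e / 2 * h^2" using d2(2)[of h] h 
      by (simp add: \<Delta>_def algebra_simps)
    have "h^2 * norm (?A - ?B) = norm ((\<Delta> - (h^2) *\<^sub>R ?B) - (\<Delta> - (h^2) *\<^sub>R ?A))"
      by (simp add: norm_mult flip: scaleR_diff_right)
    also have "\<dots> \<le> e * h^2" using norm_triangle_le_diff[OF add_mono[OF 1 2]] by simp
    finally show ?thesis using h by (simp add: mult.commute)
  qed
  then have "norm (?A - ?B) \<le> 0" using field_le_epsilon by blast
  then show "?A = ?B" by simp
qed

text \<open>The first letter of v occurs somewhere in w and is moved to the front by adjacent swaps,
  each an instance of \<open>partial_commute\<close>.\<close>

lemma derivs_mset_eq:
  "smooth f \<Longrightarrow> mset v = mset w \<Longrightarrow> derivs v f = derivs w f"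
proof (induction v arbitrary: w)
  case (Cons i v)
  have swap: "derivs (i # u1 @ u2) f = derivs (u1 @ i # u2) f" for u1 u2
  proof (induction u1)
    case (Cons j u1)
    have "smooth (derivs (u1 @ u2) f)" using smooth_derivs[OF \<open>smooth f\<close>] .
    then have "partial i (partial j (derivs (u1 @ u2) f)) = partial j (partial i (derivs (u1 @ u2) f))"
      by (intro partial_commute) (auto simp: smooth_differentiable smooth_partial)
    then show ?case using Cons by (simp only: foldr.simps append_Cons o_apply)
  qed auto
  have "i \<in> set w" using Cons.prems(2) by (metis list.set_intros(1) mset_eq_setD)
  then obtain u1 u2 where w: "w = u1 @ i # u2" by (meson split_list)
  then have "derivs v f = derivs (u1 @ u2) f"
    using Cons.IH[of "u1 @ u2"] Cons.prems by (simp del: foldr_append)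
  then show ?case unfolding w using swap[of u1 u2] by simp
qed auto

text \<open>Only the number of derivatives falling on each factor matters for the estimates, so the
  bounds are indexed by word length and the sum over subwords collapses to binomial coefficients.
  \<open>A\<close> and \<open>B\<close> vary in the induction because each new letter shifts one of
  them.\<close>

lemma derivs_mult_bound:
  assumes "smooth a" "smooth b"
    and "\<And>v. norm (derivs v a y) \<le> A (length v)" "\<And>v. norm (derivs v b y) \<le> B (length v)"
  shows "norm (derivs w (\<lambda>x. a x * b x) y) \<le>
    (\<Sum>k\<le>length w. real (length w choose k) * (A k * B (length w - k)))"
  using assms
proof (induction w arbitrary: a b A B rule: rev_induct)
  case Nil
  then show ?case using Nil.prems(3)[of "[]"] Nil.prems(4)[of "[]"] by (auto simp: norm_mult intro!: mult_mono')
next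
  case (snoc i w)
  let ?n = "length w"
  have sm: "smooth (partial i a)" "smooth (partial i b)" using snoc.prems smooth_partial by auto
  have "derivs (w @ [i]) (\<lambda>x. a x * b x) = derivs w (\<lambda>x. partial i a x * b x + a x * partial i b x)"
    using snoc.prems by (simp add: partial_mult smooth_differentiable)
  also have "\<dots> = (\<lambda>x. derivs w (\<lambda>x. partial i a x * b x) x + derivs w (\<lambda>x. a x * partial i b x) x)"
    by (intro derivs_add smooth_mult sm snoc.prems)
  finally have eq: "derivs (w @ [i]) (\<lambda>x. a x * b x) y =
     derivs w (\<lambda>x. partial i a x * b x) y + derivs w (\<lambda>x. a x * partial i b x) y" by simp
  have pa: "norm (derivs v (partial i a) y) \<le> A (Suc (length v))" for v
    using snoc.prems(3)[of "v @ [i]"] by simp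
  have pb: "norm (derivs v (partial i b) y) \<le> B (Suc (length v))" for v
    using snoc.prems(4)[of "v @ [i]"] by simp
  have 1: "norm (derivs w (\<lambda>x. partial i a x * b x) y) \<le>
      (\<Sum>k\<le>?n. real (?n choose k) * (A (Suc k) * B (?n - k)))"
    using snoc.IH[OF sm(1) snoc.prems(2), of "\<lambda>k. A (Suc k)" B] pa snoc.prems(4) by simp
  have 2: "norm (derivs w (\<lambda>x. a x * partial i b x) y) \<le>
      (\<Sum>k\<le>?n. real (?n choose k) * (A k * B (Suc (?n - k))))"
    using snoc.IH[OF snoc.prems(1) sm(2), of A "\<lambda>k. B (Suc k)"] pb snoc.prems(3) by simp
  \<comment> \<open>The added index Suc n has binomial coefficient 0; splitting off index 0 then
    aligns this sum with the other one for Pascal's rule.\<close>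
  have "(\<Sum>k\<le>?n. real (?n choose k) * (A k * B (Suc (?n - k)))) =
    (\<Sum>k\<le>Suc ?n. real (?n choose k) * (A k * B (Suc ?n - k)))"
    by (auto simp: Suc_diff_le)
  also have "\<dots> = A 0 * B (Suc ?n) + (\<Sum>k\<le>?n. real (?n choose Suc k) * (A (Suc k) * B (?n - k)))"
    by (subst sum.atMost_Suc_shift) simp
  finally have 3: "(\<Sum>k\<le>?n. real (?n choose k) * (A k * B (Suc (?n - k)))) = \<dots>" .
  have "norm (derivs (w @ [i]) (\<lambda>x. a x * b x) y) \<le> 
      (\<Sum>k\<le>?n. real (?n choose k) * (A (Suc k) * B (?n - k))) +
      (A 0 * B (Suc ?n) + (\<Sum>k\<le>?n. real (?n choose Suc k) * (A (Suc k) * B (?n - k))))"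
    unfolding eq using norm_triangle_mono[OF 1 2] unfolding 3 .
  also have "\<dots> = (\<Sum>k\<le>Suc ?n. real (Suc ?n choose k) * (A k * B (Suc ?n - k)))"
    unfolding sum.atMost_Suc_shift[of "\<lambda>k. real (Suc ?n choose k) * (A k * B (Suc ?n - k))"]
    by (simp add: sum.distrib algebra_simps)
  finally show ?case by simp
qed

lemma partial_matrix:
  fixes A :: "real ^ 'n ^ 'n::finite"
  assumes "\<And>x. f differentiable (at x)"
  shows "partial j (\<lambda>y. f (A *v y)) = (\<lambda>y. \<Sum>i\<in>UNIV. of_real (A $ i $ j) * partial i f (A *v y))"
proof
  fix y
  have "((\<lambda>y. f (A *v y)) has_derivative (\<lambda>h. \<Sum>i\<in>UNIV. (A *v h) $ i *\<^sub>R partial i f (A *v y))) (at y)"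
    by (rule has_derivative_compose[OF _ has_derivative_partial[OF assms]])
       (simp add: bounded_linear_imp_has_derivative matrix_vector_mul_bounded_linear)
  then show "partial j (\<lambda>y. f (A *v y)) y = (\<Sum>i\<in>UNIV. of_real (A $ i $ j) * partial i f (A *v y))"
    by (subst partial_eqI, assumption)
       (simp add: matrix_vector_mul_component inner_axis scaleR_conv_of_real)
qed

lemma differentiable_matrix:
  fixes A :: "real ^ 'n ^ 'n::finite" and f :: "real ^ 'n \<Rightarrow> complex"
  assumes "\<And>x. f differentiable (at x)"
  shows "(\<lambda>y. f (A *v y)) differentiable (at x)"
  using has_derivative_compose[OF bounded_linear_imp_has_derivative[OF matrix_vector_mul_bounded_linear[of A]] has_derivative_partial[OF assms]]
  unfolding differentiable_def by blast

lemma smooth_matrix: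
  fixes A :: "real ^ 'n ^ 'n::finite"
  assumes "smooth f"
  shows "smooth (\<lambda>y. f (A *v y))"
proof -
  have sum: "ndiff n (\<lambda>x. \<Sum>k\<in>K. g k x)" if "\<And>k. ndiff n (g k)" for n and K :: "'n set" and g
    by (induction K rule: infinite_finite_induct) (auto intro: ndiff_const ndiff_add that)
  have "ndiff n f \<Longrightarrow> ndiff n (\<lambda>y. f (A *v y))" for n f
  proof (induction n arbitrary: f)
    case (Suc n)
    then show ?case
      by (auto simp: ndiff_Suc partial_matrix differentiable_matrix intro!: sum ndiff_mult ndiff_const)
  qed (auto simp: ndiff_0 differentiable_matrix)
  then show ?thesis using assms by (auto simp: smooth_iff_ndiff)
qed

text \<open>Each letter brings coefficients from one column of A; the sum of all absolute entries
  bounds every column sum, hence the constant does not depend on the letters.\<close>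

lemma derivs_matrix_bound:
  fixes A :: "real ^ 'n ^ 'n::finite"
  assumes "smooth f" "\<And>v. length v = length w \<Longrightarrow> norm (derivs v f (A *v y)) \<le> B"
  shows "norm (derivs w (\<lambda>y. f (A *v y)) y) \<le> (\<Sum>i\<in>UNIV. \<Sum>j\<in>UNIV. \<bar>A $ i $ j\<bar>) ^ length w * B"
  using assms
proof (induction w arbitrary: f rule: rev_induct)
  case Nil then show ?case using Nil.prems(2)[of "[]"] by simp
next
  case (snoc j w)
  let ?K = "(\<Sum>i\<in>UNIV. \<Sum>j\<in>UNIV. \<bar>A $ i $ j\<bar>)"
  have B: "B \<ge> 0" using order_trans[OF norm_ge_zero snoc.prems(2)[of "w @ [j]"]] by simp
  have K: "(\<Sum>i\<in>UNIV. \<bar>A $ i $ j\<bar>) \<le> ?K" by (intro sum_mono member_le_sum) auto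
  have K0: "?K \<ge> 0" by (intro sum_nonneg) auto
  have sm: "smooth (\<lambda>y. partial i f (A *v y))" for i
    using snoc.prems smooth_partial smooth_matrix by blast
  have "derivs (w @ [j]) (\<lambda>y. f (A *v y)) y =
      (\<Sum>i\<in>UNIV. of_real (A $ i $ j) * derivs w (\<lambda>y. partial i f (A *v y)) y)"
    using snoc.prems sm by (simp add: partial_matrix smooth_differentiable derivs_sum derivs_cmult smooth_cmult)
  also have "norm \<dots> \<le> (\<Sum>i\<in>UNIV. \<bar>A $ i $ j\<bar> * (?K ^ length w * B))"
  proof (intro sum_norm_le)
    fix i
    have "norm (derivs w (\<lambda>y. partial i f (A *v y)) y) \<le> ?K ^ length w * B"
      by (rule snoc.IH[OF smooth_partial[OF snoc.prems(1)]]) (use snoc.prems(2)[of "_ @ [i]"] in simp)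
    then show "norm (complex_of_real (A $ i $ j) * derivs w (\<lambda>y. partial i f (A *v y)) y) \<le> \<bar>A $ i $ j\<bar> * (?K ^ length w * B)"
      by (simp add: norm_mult mult_left_mono)
  qed
  also have "\<dots> = (\<Sum>i\<in>UNIV. \<bar>A $ i $ j\<bar>) * (?K ^ length w * B)" by (simp add: sum_distrib_right)
  also have "\<dots> \<le> ?K * (?K ^ length w * B)" using K K0 B by (intro mult_right_mono) auto
  finally show ?case by (simp add: mult_ac)
qed

section \<open>Plane waves and coordinate functions\<close>

lemma has_derivative_plane_wave:
  "((\<lambda>y. c * exp (\<i> * complex_of_real (y \<bullet> \<xi>))) has_derivative
      (\<lambda>h. c * (\<i> * complex_of_real (h \<bullet> \<xi>) * exp (\<i> * complex_of_real (y \<bullet> \<xi>))))) (at y)"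
proof -
  have 1: "((\<lambda>y. \<i> * complex_of_real (y \<bullet> \<xi>)) has_derivative (\<lambda>h. \<i> * complex_of_real (h \<bullet> \<xi>))) (at y)"
    by (auto intro!: derivative_eq_intros)
  have 2: "(exp has_derivative (\<lambda>z. exp (\<i> * complex_of_real (y \<bullet> \<xi>)) * z)) (at (\<i> * complex_of_real (y \<bullet> \<xi>)))"
    using DERIV_exp unfolding has_field_derivative_def .
  have "((\<lambda>y. c * exp (\<i> * complex_of_real (y \<bullet> \<xi>))) has_derivative
      (\<lambda>h. c * (exp (\<i> * complex_of_real (y \<bullet> \<xi>)) * (\<i> * complex_of_real (h \<bullet> \<xi>))))) (at y)"
    by (rule has_derivative_mult_right[OF has_derivative_compose[OF 1 2]])
  then show ?thesis by (simp add: mult_ac)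
qed

text \<open>The factor \<open>c\<close> is carried along so that the family is closed under
  differentiation, as the induction in \<open>smooth_exp\<close> needs.\<close>

lemma partial_exp:
  "partial j (\<lambda>y. c * exp (\<i> * complex_of_real (y \<bullet> \<xi>))) =
    (\<lambda>y. (c * (\<i> * complex_of_real (\<xi> $ j))) * exp (\<i> * complex_of_real (y \<bullet> \<xi>)))"
proof
  fix y
  show "partial j (\<lambda>y. c * exp (\<i> * complex_of_real (y \<bullet> \<xi>))) y =
    (c * (\<i> * complex_of_real (\<xi> $ j))) * exp (\<i> * complex_of_real (y \<bullet> \<xi>))"
    unfolding partial_eqI[OF has_derivative_plane_wave] by (simp add: inner_axis' mult_ac)
qed

lemma smooth_exp: "smooth (\<lambda>y. c * exp (\<i> * complex_of_real (y \<bullet> \<xi>)))"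
proof -
  have "(\<lambda>y. c * exp (\<i> * complex_of_real (y \<bullet> \<xi>))) differentiable (at x)" for c x
    unfolding differentiable_def using has_derivative_plane_wave by blast
  then have "ndiff n (\<lambda>y. c * exp (\<i> * complex_of_real (y \<bullet> \<xi>)))" for n
    by (induction n arbitrary: c) (auto simp: ndiff_0 ndiff_Suc partial_exp)
  then show ?thesis by (simp add: smooth_iff_ndiff)
qed

lemma derivs_exp:
  "derivs w (\<lambda>y. exp (\<i> * complex_of_real (y \<bullet> \<xi>))) =
    (\<lambda>y. (\<Prod>j\<leftarrow>w. \<i> * complex_of_real (\<xi> $ j)) * exp (\<i> * complex_of_real (y \<bullet> \<xi>)))"
proof (induction w)
  case (Cons j w)
  show ?case
    unfolding foldr.simps o_apply Cons partial_exp by (simp add: mult_ac)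
qed auto

lemma norm_derivs_exp_le:
  "norm (derivs w (\<lambda>y. exp (\<i> * complex_of_real (y \<bullet> \<xi>))) y) \<le> norm \<xi> ^ length w"
proof -
  have "norm (\<Prod>j\<leftarrow>w. \<i> * complex_of_real (\<xi> $ j)) \<le> norm \<xi> ^ length w"
    by (induction w) (auto simp: norm_mult component_le_norm_cart intro!: mult_mono)
  then show ?thesis unfolding derivs_exp by (simp add: norm_mult)
qed

lemma partial_coordinate:
  "partial i (\<lambda>y. complex_of_real (y $ j)) = (\<lambda>y. if i = j then 1 else 0)"
  by (rule ext, rule partial_eqI[THEN trans, where F1 = "\<lambda>h. complex_of_real (h $ j)"])
     (auto intro!: bounded_linear_imp_has_derivative bounded_linear_compose[OF bounded_linear_of_real]
       bounded_linear_vec_nth simp: axis_def)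

lemma smooth_coordinate: "smooth (\<lambda>y :: real ^ 'n::finite. complex_of_real (y $ j))"
proof -
  have "(\<lambda>y :: real ^ 'n. complex_of_real (y $ j)) differentiable (at x)" for x
    unfolding differentiable_def
    by (auto intro!: exI bounded_linear_imp_has_derivative bounded_linear_compose[OF bounded_linear_of_real]
       bounded_linear_vec_nth)
  then have "ndiff n (\<lambda>y :: real ^ 'n. complex_of_real (y $ j))" for n
    by (cases n) (auto simp: ndiff_0 ndiff_Suc partial_coordinate ndiff_const)
  then show ?thesis by (simp add: smooth_iff_ndiff)
qed

section \<open>The seminorms in terms of words\<close>

text \<open>Replacing monomials by powers of the norm and multi-indices by words changes h only by a factor
  depending on the dimension and on t, s, hence does not change the space.\<close>

definition gsb :: "real \<Rightarrow> real \<Rightarrow> real \<Rightarrow> real \<Rightarrow> (real ^ 'n::finite \<Rightarrow> complex) \<Rightarrow> bool" where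
  "gsb t s h C f \<longleftrightarrow> smooth f \<and> (\<forall>m w y. norm y ^ m * norm (derivs w f y) \<le>
     C * h ^ (m + length w) * fact m powr t * fact (length w) powr s)"

lemma gsb_smooth: "gsb t s h C f \<Longrightarrow> smooth f"
  by (simp add: gsb_def)

lemma gsbD:
  "gsb t s h C f \<Longrightarrow> norm y ^ m * norm (derivs w f y) \<le>
     C * h ^ (m + length w) * fact m powr t * fact (length w) powr s"
  by (simp add: gsb_def)

lemma gsb_nonneg: "gsb t s h C f \<Longrightarrow> C \<ge> 0"
  using order_trans[OF norm_ge_zero gsbD[of t s h C f _ 0 "[]", simplified]] by simp

lemma gsb_mono:
  fixes f :: "real ^ 'n::finite \<Rightarrow> complex"
  assumes "gsb t s h C f" "0 < h" "h \<le> h'" "C \<le> C'"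
  shows "gsb t s h' C' f"
  unfolding gsb_def
proof (intro conjI allI gsb_smooth[OF assms(1)])
  fix m and w :: "'n list" and y
  have "C * h ^ (m + length w) \<le> C' * h' ^ (m + length w)"
    using assms gsb_nonneg[OF assms(1)] by (intro mult_mono power_mono) auto
  then have "C * h ^ (m + length w) * fact m powr t * fact (length w) powr s \<le>
      C' * h' ^ (m + length w) * fact m powr t * fact (length w) powr s"
    by (intro mult_right_mono) auto
  then show "norm y ^ m * norm (derivs w f y) \<le>
      C' * h' ^ (m + length w) * fact m powr t * fact (length w) powr s"
    using gsbD[OF assms(1)] by (rule order_trans[rotated])
qed

lemma gsb_cmult:
  fixes f :: "real ^ 'n::finite \<Rightarrow> complex"
  shows "gsb t s h C f \<Longrightarrow> gsb t s h (norm c * C) (\<lambda>x. c * f x)"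
  unfolding gsb_def
proof (intro conjI allI smooth_cmult)
  fix m and w :: "'n list" and y
  assume f: "smooth f \<and> (\<forall>m w y. norm y ^ m * norm (derivs w f y) \<le>
     C * h ^ (m + length w) * fact m powr t * fact (length w) powr s)"
  have "norm c * (norm y ^ m * norm (derivs w f y)) \<le>
      norm c * (C * h ^ (m + length w) * fact m powr t * fact (length w) powr s)"
    using f by (intro mult_left_mono) auto
  then show "norm y ^ m * norm (derivs w (\<lambda>x. c * f x) y) \<le>
      norm c * C * h ^ (m + length w) * fact m powr t * fact (length w) powr s"
    using f by (simp add: derivs_cmult norm_mult mult_ac)
qed auto

lemma gsb_add:
  fixes f g :: "real ^ 'n::finite \<Rightarrow> complex"
  assumes "gsb t s h C f" "gsb t s h C' g"
  shows "gsb t s h (C + C') (\<lambda>x. f x + g x)"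
  unfolding gsb_def
proof (intro conjI allI)
  have sm: "smooth f" "smooth g" using gsb_smooth[OF assms(1)] gsb_smooth[OF assms(2)] by simp_all
  then show "smooth (\<lambda>x. f x + g x)" by (rule smooth_add)
  fix m and w :: "'n list" and y
  have "norm y ^ m * norm (derivs w (\<lambda>x. f x + g x) y) \<le>
      norm y ^ m * norm (derivs w f y) + norm y ^ m * norm (derivs w g y)"
    by (simp add: derivs_add sm mult_left_mono norm_triangle_ineq flip: distrib_left)
  also have "\<dots> \<le> C * h ^ (m + length w) * fact m powr t * fact (length w) powr s +
       C' * h ^ (m + length w) * fact m powr t * fact (length w) powr s"
    using assms by (intro add_mono gsbD)
  finally show "norm y ^ m * norm (derivs w (\<lambda>x. f x + g x) y) \<le>
      (C + C') * h ^ (m + length w) * fact m powr t * fact (length w) powr s"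
    by (simp add: algebra_simps)
qed

section \<open>Factorials, multi-indices and words\<close>

lemma fact_mult_le: "fact a * fact b \<le> (fact (a + b) :: real)"
proof -
  have "fact a * fact b \<le> (fact (a + b) :: nat)"
    by (rule dvd_imp_le[OF fact_fact_dvd_fact]) auto
  then show ?thesis by (metis of_nat_fact of_nat_le_iff of_nat_mult)
qed

lemma mi_fact_pos: "mi_fact \<alpha> > 0"
  by (auto simp: mi_fact_def intro!: prod_pos)

lemma mi_fact_neq_0 [simp]: "mi_fact \<alpha> \<noteq> 0"
  using mi_fact_pos[of \<alpha>] by simp

lemma mi_fact_le_fact: "real (mi_fact \<alpha>) \<le> fact (mi_abs \<alpha>)"
proof -
  have "(\<Prod>i\<in>I. fact (\<alpha> i) :: real) \<le> fact (\<Sum>i\<in>I. \<alpha> i)" for I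
  proof (induction I rule: infinite_finite_induct)
    case (insert i I)
    have "(\<Prod>i\<in>insert i I. fact (\<alpha> i) :: real) \<le> fact (\<alpha> i) * fact (\<Sum>i\<in>I. \<alpha> i)"
      using insert by (simp add: mult_left_mono)
    also have "\<dots> \<le> fact (\<alpha> i + (\<Sum>i\<in>I. \<alpha> i))" by (rule fact_mult_le)
    finally show ?case using insert by simp
  qed auto
  from this[of UNIV] show ?thesis by (simp add: mi_fact_def mi_abs_def)
qed

text \<open>The multinomial coefficient of \<alpha> is at most d^n with n =
  \<open>mi_abs \<alpha>\<close>. By averaging some coordinate satisfies n \<le> d * \<alpha> i;
  lowering it by one costs a single factor d.\<close>

lemma fact_le_mi_fact: "fact (mi_abs \<alpha>) \<le> CARD('n) ^ mi_abs \<alpha> * mi_fact (\<alpha> :: 'n::finite \<Rightarrow> nat)"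
proof (induction "mi_abs \<alpha>" arbitrary: \<alpha>)
  case 0
  then show ?case using mi_fact_pos[of \<alpha>] by (metis One_nat_def Suc_leI fact_0 mult_1 power_0)
next
  case (Suc n)
  have "\<exists>i. Suc n \<le> CARD('n) * \<alpha> i"
  proof (rule ccontr)
    assume "\<not> ?thesis"
    then have "(\<Sum>i\<in>UNIV. CARD('n) * \<alpha> i) < (\<Sum>i\<in>(UNIV :: 'n set). Suc n)"
      by (intro sum_strict_mono) (auto simp: not_le)
    also have "(\<Sum>i\<in>UNIV. CARD('n) * \<alpha> i) = CARD('n) * Suc n"
      using Suc(2) by (simp add: mi_abs_def flip: sum_distrib_left)
    finally show False by simp
  qed
  then obtain i where i: "Suc n \<le> CARD('n) * \<alpha> i" by auto
  then obtain k where k: "\<alpha> i = Suc k" by (cases "\<alpha> i") auto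
  define \<beta> where "\<beta> = \<alpha>(i := k)"
  have "mi_abs \<alpha> = \<alpha> i + (\<Sum>j\<in>UNIV - {i}. \<alpha> j)"
    unfolding mi_abs_def by (simp add: sum.remove)
  moreover have "mi_abs \<beta> = k + (\<Sum>j\<in>UNIV - {i}. \<beta> j)"
    unfolding mi_abs_def by (subst sum.remove[of UNIV i]) (auto simp: \<beta>_def)
  moreover have "(\<Sum>j\<in>UNIV - {i}. \<beta> j) = (\<Sum>j\<in>UNIV - {i}. \<alpha> j)"
    by (rule sum.cong) (auto simp: \<beta>_def)
  ultimately have n: "n = mi_abs \<beta>" using Suc(2) k by simp
  have "mi_fact \<alpha> = fact (\<alpha> i) * (\<Prod>j\<in>UNIV - {i}. fact (\<alpha> j))"
    unfolding mi_fact_def by (simp add: prod.remove)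
  moreover have "mi_fact \<beta> = fact k * (\<Prod>j\<in>UNIV - {i}. fact (\<beta> j))"
    unfolding mi_fact_def by (subst prod.remove[of UNIV i]) (auto simp: \<beta>_def)
  moreover have "(\<Prod>j\<in>UNIV - {i}. fact (\<beta> j)) = (\<Prod>j\<in>UNIV - {i}. fact (\<alpha> j) :: nat)"
    by (rule prod.cong) (auto simp: \<beta>_def)
  ultimately have f: "mi_fact \<alpha> = \<alpha> i * mi_fact \<beta>" using k by (simp add: algebra_simps)
  have "fact (mi_abs \<alpha>) = Suc n * fact n" by (simp flip: Suc(2))
  also have "\<dots> \<le> (CARD('n) * \<alpha> i) * (CARD('n) ^ n * mi_fact \<beta>)"
    using Suc(1)[OF n] i n by (intro mult_mono) auto
  also have "\<dots> = CARD('n) ^ mi_abs \<alpha> * mi_fact \<alpha>" by (simp add: f flip: Suc(2))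
  finally show ?case .
qed

text \<open>Concatenating along \<open>coords\<close> makes the word derivative coincide with
  \<open>mi_deriv\<close> by unfolding alone, for every f; Schwarz's theorem is needed only for
  other words.\<close>

definition mi_word :: "('n::finite \<Rightarrow> nat) \<Rightarrow> 'n list" where
  "mi_word \<beta> = concat (map (\<lambda>i. replicate (\<beta> i) i) coords)"

lemma distinct_coords: "distinct (coords :: 'n::finite list)" and set_coords: "set coords = (UNIV :: 'n::finite set)"
proof -
  have "\<exists>is :: 'n list. distinct is \<and> set is = UNIV"
    using finite_distinct_list[of "UNIV :: 'n set"] by auto
  from someI_ex[OF this] show "distinct (coords :: 'n list)" "set coords = (UNIV :: 'n set)"
    by (auto simp: coords_def)
qed

lemma mi_deriv_eq_derivs: "mi_deriv \<beta> f = derivs (mi_word \<beta>) f"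
proof -
  have rep: "foldr partial (replicate n i) f = (partial i ^^ n) f" for n i and f :: "real ^ 'a \<Rightarrow> complex"
    by (induction n) auto
  have "foldr (\<lambda>i. partial i ^^ \<beta> i) xs f = derivs (concat (map (\<lambda>i. replicate (\<beta> i) i) xs)) f" for xs
    by (induction xs) (auto simp: rep)
  then show ?thesis by (simp add: mi_deriv_def mi_word_def)
qed

lemma count_mi_word: "count (mset (mi_word \<beta>)) i = \<beta> i"
proof -
  have "distinct xs \<Longrightarrow> count (mset (concat (map (\<lambda>i. replicate (\<beta> i) i) xs))) x = (if x \<in> set xs then \<beta> x else 0)" for xs x
    by (induction xs) auto
  from this[OF distinct_coords] show ?thesis by (simp add: mi_word_def set_coords)
qed

lemma length_mi_word: "length (mi_word \<beta>) = mi_abs \<beta>"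
  unfolding mi_word_def mi_abs_def set_coords[symmetric]
    sum_list_distinct_conv_sum_set[OF distinct_coords, symmetric]
  by (simp add: length_concat o_def)

lemma derivs_eq_mi_deriv: "smooth f \<Longrightarrow> derivs w f = mi_deriv (count (mset w)) f"
  unfolding mi_deriv_eq_derivs
  by (rule derivs_mset_eq) (auto intro!: multiset_eqI simp: count_mi_word)

lemma mi_abs_count: "mi_abs (count (mset w)) = length w"
proof -
  have "mset (mi_word (count (mset w))) = mset w"
    by (auto intro!: multiset_eqI simp: count_mi_word)
  then show ?thesis by (metis length_mi_word size_mset)
qed

lemma abs_mi_pow_le: "\<bar>mi_pow x \<alpha>\<bar> \<le> norm x ^ mi_abs \<alpha>"
proof -
  have "\<bar>mi_pow x \<alpha>\<bar> \<le> (\<Prod>i\<in>UNIV. norm x ^ \<alpha> i)"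
    unfolding mi_pow_def abs_prod
    by (intro prod_mono) (auto simp: power_abs intro!: power_mono component_le_norm_cart)
  also have "\<dots> = norm x ^ mi_abs \<alpha>" by (simp add: power_sum mi_abs_def)
  finally show ?thesis .
qed

lemma norm_D: "norm (D \<beta> f x) = norm (mi_deriv \<beta> f x)"
  by (simp add: D_def norm_mult norm_power)

text \<open>Replacing the factorial of the order by \<open>mi_fact\<close> costs d to the order, by
  \<open>fact_le_mi_fact\<close>, raised to t or to s; the exponent t + s covers both cases.\<close>

lemma gsb_term_le:
  fixes f :: "real ^ 'n::finite \<Rightarrow> complex"
  assumes "gsb t s h C f" and h: "h > 0" and t: "t > 0" and s: "s > 0"
    and h': "h' = h * real CARD('n) powr (t + s)"
  shows "norm (complex_of_real (mi_pow x \<alpha>) * D \<beta> f x) /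
        (h' ^ (mi_abs \<alpha> + mi_abs \<beta>) * real (mi_fact \<alpha>) powr t * real (mi_fact \<beta>) powr s) \<le> C"
proof -
  let ?d = "real CARD('n)" and ?m = "mi_abs \<alpha>" and ?n = "mi_abs \<beta>"
  have d: "?d \<ge> 1" by (simp add: Suc_leI)
  have fa: "fact (mi_abs \<gamma>) powr r \<le> (?d powr (t + s)) ^ mi_abs \<gamma> * real (mi_fact \<gamma>) powr r"
    if "r > 0" "r \<le> t + s" for r and \<gamma> :: "'n \<Rightarrow> nat"
  proof -
    have "(fact (mi_abs \<gamma>) :: real) \<le> ?d ^ mi_abs \<gamma> * real (mi_fact \<gamma>)"
      using fact_le_mi_fact[of \<gamma>] by (metis of_nat_fact of_nat_le_iff of_nat_mult of_nat_power)
    then have "fact (mi_abs \<gamma>) powr r \<le> (?d ^ mi_abs \<gamma> * real (mi_fact \<gamma>)) powr r"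
      using that by (intro powr_mono2) auto
    also have "\<dots> = (?d powr r) ^ mi_abs \<gamma> * real (mi_fact \<gamma>) powr r"
      using d by (simp add: powr_mult powr_realpow[symmetric] powr_powr mult.commute)
    also have "\<dots> \<le> (?d powr (t + s)) ^ mi_abs \<gamma> * real (mi_fact \<gamma>) powr r"
      using that d by (intro mult_right_mono power_mono powr_mono) auto
    finally show ?thesis .
  qed
  have C: "C \<ge> 0" using assms(1) by (rule gsb_nonneg)
  have "norm (complex_of_real (mi_pow x \<alpha>) * D \<beta> f x) \<le> norm x ^ ?m * norm (derivs (mi_word \<beta>) f x)"
    unfolding norm_mult norm_D mi_deriv_eq_derivs
    by (intro mult_right_mono) (auto simp: abs_mi_pow_le)
  also have "\<dots> \<le> C * h ^ (?m + ?n) * fact ?m powr t * fact ?n powr s"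
    using gsbD[OF assms(1), of x ?m "mi_word \<beta>"] by (simp add: length_mi_word)
  also have "\<dots> \<le> C * h ^ (?m + ?n) * ((?d powr (t + s)) ^ ?m * real (mi_fact \<alpha>) powr t) *
      ((?d powr (t + s)) ^ ?n * real (mi_fact \<beta>) powr s)"
    using C h t s by (intro mult_mono fa) auto
  finally have "norm (complex_of_real (mi_pow x \<alpha>) * D \<beta> f x) \<le> C * (h' ^ (?m + ?n) * real (mi_fact \<alpha>) powr t * real (mi_fact \<beta>) powr s)"
    by (simp add: h' power_mult_distrib power_add mult_ac)
  moreover have "h' ^ (?m + ?n) * real (mi_fact \<alpha>) powr t * real (mi_fact \<beta>) powr s > 0"
    using h d by (simp add: h')
  ultimately show ?thesis by (simp add: pos_divide_le_eq)
qed

lemma gs_norm_le: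
  fixes f :: "real ^ 'n::finite \<Rightarrow> complex"
  assumes "gsb t s h C f" "h > 0" "t > 0" "s > 0" "h' = h * real CARD('n) powr (t + s)"
  shows "gs_norm t s h' f \<le> ennreal C"
  unfolding gs_norm_def by (intro SUP_least ennreal_leI gsb_term_le[OF assms])

text \<open>Follows from the bound of the norm by the sum of the coordinates. It replaces a power of
  the norm by a power of one coordinate, i.e. by a single monomial.\<close>

lemma exists_coordinate: "\<exists>i. norm y \<le> real CARD('n) * \<bar>y $ i\<bar>" for y :: "real ^ 'n::finite"
proof (rule ccontr)
  let ?d = "real CARD('n)"
  assume "\<not> ?thesis"
  then have "(\<Sum>i\<in>UNIV. ?d * \<bar>y $ i\<bar>) < (\<Sum>i\<in>(UNIV :: 'n set). norm y)"
    by (intro sum_strict_mono) (auto simp: not_le)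
  then have "?d * (\<Sum>i\<in>UNIV. \<bar>y $ i\<bar>) < ?d * norm y" by (simp add: sum_distrib_left)
  then show False using norm_le_l1_cart[of y] by simp
qed

lemma gs_norm_finite_imp_gsb:
  fixes f :: "real ^ 'n::finite \<Rightarrow> complex"
  assumes "smooth f" "gs_norm t s h f < \<infinity>" "h > 0" "t > 0" "s > 0"
  shows "\<exists>C. gsb t s (h * real CARD('n)) C f"
proof -
  let ?d = "real CARD('n)"
  have d: "?d \<ge> 1" by (simp add: Suc_leI)
  define C where "C = enn2real (gs_norm t s h f)"
  have C: "C \<ge> 0" by (simp add: C_def)
  have trm: "norm (complex_of_real (mi_pow x \<alpha>) * D \<beta> f x) \<le>
        C * (h ^ (mi_abs \<alpha> + mi_abs \<beta>) * real (mi_fact \<alpha>) powr t * real (mi_fact \<beta>) powr s)" for x \<alpha> \<beta>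
  proof -
    let ?q = "h ^ (mi_abs \<alpha> + mi_abs \<beta>) * real (mi_fact \<alpha>) powr t * real (mi_fact \<beta>) powr s"
    have q: "?q > 0" using assms by simp
    have "ennreal (norm (complex_of_real (mi_pow x \<alpha>) * D \<beta> f x) / ?q) \<le> gs_norm t s h f"
      unfolding gs_norm_def by (intro SUP_upper2[of \<alpha>] SUP_upper2[of \<beta>] SUP_upper2[of x]) auto
    also have "\<dots> = ennreal C" using assms(2) by (simp add: C_def)
    finally have "norm (complex_of_real (mi_pow x \<alpha>) * D \<beta> f x) / ?q \<le> C"
      using C by (simp add: ennreal_le_iff)
    then show ?thesis using q by (simp add: pos_divide_le_eq)
  qed
  have "norm y ^ m * norm (derivs w f y) \<le>
     C * (h * ?d) ^ (m + length w) * fact m powr t * fact (length w) powr s" for m w y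
  proof -
    obtain i where i: "norm y \<le> ?d * \<bar>y $ i\<bar>" using exists_coordinate by blast
    \<comment> \<open>All of m sits on the dominant coordinate, so \<open>mi_fact \<alpha>\<close>
      is exactly fact m.\<close>
    define \<alpha> where "\<alpha> = (\<lambda>j. if j = i then m else 0)"
    have a: "mi_abs \<alpha> = m" "mi_fact \<alpha> = fact m" "mi_pow y \<alpha> = (y $ i) ^ m"
      unfolding mi_abs_def mi_fact_def mi_pow_def \<alpha>_def
      by (auto simp: if_distrib[of fact] if_distrib[of "(^) _"] prod.delta simp del: One_nat_def cong: if_cong)
    have "norm y ^ m * norm (derivs w f y) \<le> (?d * \<bar>y $ i\<bar>) ^ m * norm (derivs w f y)"
      using i by (intro mult_right_mono power_mono) auto
    also have "\<dots> = ?d ^ m * norm (complex_of_real (mi_pow y \<alpha>) * D (count (mset w)) f y)"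
      using derivs_eq_mi_deriv[OF assms(1), of w]
      by (simp add: a norm_mult norm_D norm_power power_mult_distrib)
    also have "\<dots> \<le> ?d ^ (m + length w) * (C * (h ^ (m + length w) * fact m powr t * fact (length w) powr s))"
    proof (rule mult_mono)
      show "?d ^ m \<le> ?d ^ (m + length w)" using d by (intro power_increasing) auto
      have "norm (complex_of_real (mi_pow y \<alpha>) * D (count (mset w)) f y) \<le> 
          C * (h ^ (m + length w) * fact m powr t * real (mi_fact (count (mset w))) powr s)"
        using trm[of y \<alpha> "count (mset w)"] by (simp add: a mi_abs_count)
      also have "\<dots> \<le> C * (h ^ (m + length w) * fact m powr t * fact (length w) powr s)"
        using mi_fact_le_fact[of "count (mset w)"] C assms(3,5)
        by (intro mult_left_mono powr_mono2) (auto simp: mi_abs_count)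
      finally show "norm (complex_of_real (mi_pow y \<alpha>) * D (count (mset w)) f y) \<le>
        C * (h ^ (m + length w) * fact m powr t * fact (length w) powr s)" .
    qed auto
    finally show ?thesis by (simp add: power_mult_distrib mult_ac)
  qed
  then show ?thesis using assms(1) by (auto simp: gsb_def)
qed

lemma gs_space_iff_gsb:
  fixes f :: "real ^ 'n::finite \<Rightarrow> complex"
  assumes "t > 0" "s > 0"
  shows "f \<in> gs_space t s \<longleftrightarrow> (\<forall>h>0. \<exists>C. gsb t s h C f)"
proof
  assume f: "f \<in> gs_space t s"
  show "\<forall>h>0. \<exists>C. gsb t s h C f"
  proof (intro allI impI)
    fix h :: real assume h: "h > 0"
    have "\<exists>C. gsb t s (h / real CARD('n) * real CARD('n)) C f"
      using f h assms by (intro gs_norm_finite_imp_gsb) (auto simp: gs_space_def)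
    then show "\<exists>C. gsb t s h C f" by simp
  qed
next
  assume *: "\<forall>h>0. \<exists>C. gsb t s h C f"
  have "gs_norm t s h f < \<infinity>" if h: "h > 0" for h
  proof -
    obtain C where "gsb t s (h / real CARD('n) powr (t + s)) C f"
      using *[rule_format, of "h / real CARD('n) powr (t + s)"] h by auto
    then have "gs_norm t s h f \<le> ennreal C" by (rule gs_norm_le) (use assms h in auto)
    then show ?thesis by (metis ennreal_less_top infinity_ennreal_def order_le_less_trans)
  qed
  moreover have "smooth f" using * gsb_smooth zero_less_one by blast
  ultimately show "f \<in> gs_space t s" by (simp add: gs_space_def)
qed

lemma gs_space_smooth: "f \<in> gs_space t s \<Longrightarrow> smooth f"
  by (simp add: gs_space_def)

section \<open>Vector space structure, topology and dual of the test space\<close>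

context
  fixes t s :: real
  assumes t: "t > 0" and s: "s > 0"
begin

lemma gs_space_add: "f \<in> gs_space t s \<Longrightarrow> g \<in> gs_space t s \<Longrightarrow> (\<lambda>x. f x + g x) \<in> gs_space t s"
  unfolding gs_space_iff_gsb[OF t s]
proof (intro allI impI)
  fix h :: real assume "\<forall>h>0. \<exists>C. gsb t s h C f" "\<forall>h>0. \<exists>C. gsb t s h C g" "h > 0"
  then obtain C C' where "gsb t s h C f" "gsb t s h C' g" by blast
  from gsb_add[OF this] show "\<exists>C. gsb t s h C (\<lambda>x. f x + g x)" by blast
qed

lemma gs_space_cmult: "f \<in> gs_space t s \<Longrightarrow> (\<lambda>x. c * f x) \<in> gs_space t s"
  unfolding gs_space_iff_gsb[OF t s]
proof (intro allI impI)
  fix h :: real assume "\<forall>h>0. \<exists>C. gsb t s h C f" "h > 0"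
  then obtain C where "gsb t s h C f" by blast
  from gsb_cmult[OF this] show "\<exists>C. gsb t s h C (\<lambda>x. c * f x)" by blast
qed

lemma gs_space_0: "(\<lambda>x. 0) \<in> gs_space t s"
  unfolding gs_space_iff_gsb[OF t s] by (auto simp: gsb_def smooth_const derivs_const_0 intro: exI[of _ 0])

lemma gs_space_diff: "f \<in> gs_space t s \<Longrightarrow> g \<in> gs_space t s \<Longrightarrow> (\<lambda>x. f x - g x) \<in> gs_space t s"
  using gs_space_add[of f "\<lambda>x. (-1) * g x"] gs_space_cmult[of g "-1"] by simp

lemma gs_space_sum:
  "(\<And>k. k \<in> K \<Longrightarrow> f k \<in> gs_space t s) \<Longrightarrow> (\<lambda>x. \<Sum>k\<in>K. f k x) \<in> gs_space t s"
  by (induction K rule: infinite_finite_induct) (auto intro: gs_space_0 gs_space_add)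

text \<open>The generating sets are balls around arbitrary centres and form only a subbasis.
  Induction over the generated topology moves the centre to 0 and merges finitely many seminorms
  into one.\<close>

lemma gs_topology_neighbourhood:
  fixes V :: "(real ^ 'n::finite \<Rightarrow> complex) set"
  assumes "openin (gs_topology t s) V" "(\<lambda>x. 0) \<in> V"
  shows "\<exists>h>0. \<exists>e>0. \<forall>g C. g \<in> gs_space t s \<and> C < e \<and> gsb t s h C g \<longrightarrow> g \<in> V"
proof -
  let ?S = "{{g \<in> gs_space t s. gs_norm t s h (\<lambda>x. g x - f x) < ennreal e} | f h e.
        f \<in> gs_space t s \<and> h > 0 \<and> e > 0} :: (real ^ 'n \<Rightarrow> complex) set set"
  have "generate_topology_on ?S V"
    using assms(1) by (simp add: gs_topology_def openin_topology_generated_by_iff)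
  then show ?thesis using assms(2)
  proof (induction)
    case Empty then show ?case by simp
  next
    case (Int a b)
    obtain h1 e1 where 1: "h1 > 0" "e1 > 0" "\<And>g C. g \<in> gs_space t s \<and> C < e1 \<and> gsb t s h1 C g \<Longrightarrow> g \<in> a"
      using Int by blast
    obtain h2 e2 where 2: "h2 > 0" "e2 > 0" "\<And>g C. g \<in> gs_space t s \<and> C < e2 \<and> gsb t s h2 C g \<Longrightarrow> g \<in> b"
      using Int by blast
    \<comment> \<open>A smaller h is the stronger condition (\<open>gsb_mono\<close>), so the minima
      serve both neighbourhoods.\<close>
    have "g \<in> a \<inter> b" if g: "g \<in> gs_space t s" "C < min e1 e2" "gsb t s (min h1 h2) C g" for g C
      using 1(3)[of g C] 2(3)[of g C] g gsb_mono[OF g(3), of h1 C] gsb_mono[OF g(3), of h2 C] 1 2 by simp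
    then show ?case using 1 2 by (intro exI[of _ "min h1 h2"] conjI exI[of _ "min e1 e2"]) auto
  next
    case (UN K)
    then obtain k where k: "k \<in> K" "(\<lambda>x. 0) \<in> k" by auto
    then show ?case using UN.IH[OF k] by (meson UnionI)
  next
    case (Basis a)
    then obtain f h e where a: "a = {g \<in> gs_space t s. gs_norm t s h (\<lambda>x. g x - f x) < ennreal e}"
      and f: "f \<in> gs_space t s" and h: "h > 0" and e: "e > 0" by blast
    let ?mf = "\<lambda>x. - f x"
    have lt: "gs_norm t s h ?mf < ennreal e" using Basis a by simp
    \<comment> \<open>As 0 lies in the ball around f, the seminorm N of - f is below e; by the
      triangle inequality a function of seminorm below e - N stays in that ball.\<close>
    define N where "N = enn2real (gs_norm t s h ?mf)"
    have "gs_norm t s h ?mf < top" using lt ennreal_less_top order_less_trans by blast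
    then have NN: "gs_norm t s h ?mf = ennreal N" by (simp add: N_def)
    have N0: "N \<ge> 0" by (simp add: N_def)
    have N: "N \<ge> 0" "N < e" using lt N0 unfolding NN by (auto simp: ennreal_less_iff)
    have smf: "smooth ?mf" using smooth_cmult[OF gs_space_smooth[OF f], of "-1"] by simp
    have "g \<in> a" if g: "g \<in> gs_space t s" "C < e - N" "gsb t s (h / real CARD('n) powr (t + s)) C g" for g C
    proof -
      have C: "C \<ge> 0" using g by (intro gsb_nonneg)
      have "gs_norm t s h (\<lambda>x. g x - f x) \<le> ennreal (C + N)"
        unfolding gs_norm_def
      proof (intro SUP_least)
        fix \<alpha> \<beta> :: "'n \<Rightarrow> nat" and x
        let ?q = "h ^ (mi_abs \<alpha> + mi_abs \<beta>) * real (mi_fact \<alpha>) powr t * real (mi_fact \<beta>) powr s"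
        let ?T = "\<lambda>f. norm (complex_of_real (mi_pow x \<alpha>) * D \<beta> f x) / ?q"
        have q: "?q > 0" using h by simp
        have "derivs (mi_word \<beta>) (\<lambda>x. g x + - f x) x = derivs (mi_word \<beta>) g x + derivs (mi_word \<beta>) ?mf x"
          using derivs_add[OF gs_space_smooth[OF g(1)] smf] by simp
        then have D: "D \<beta> (\<lambda>x. g x - f x) x = D \<beta> g x + D \<beta> ?mf x"
          by (simp add: D_def mi_deriv_eq_derivs distrib_left)
        have "?T (\<lambda>x. g x - f x) \<le> ?T g + ?T ?mf"
          unfolding D distrib_left add_divide_distrib[symmetric] using q
          by (intro divide_right_mono norm_triangle_ineq) auto
        moreover have "?T g \<le> C" using h t s
          by (intro gsb_term_le[OF g(3)]) auto
        moreover have "ennreal (?T ?mf) \<le> ennreal N"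
          unfolding NN[symmetric] gs_norm_def by (intro SUP_upper2[of \<alpha>] SUP_upper2[of \<beta>] SUP_upper2[of x]) auto
        then have "?T ?mf \<le> N" using N by (simp add: ennreal_le_iff)
        ultimately show "ennreal (?T (\<lambda>x. g x - f x)) \<le> ennreal (C + N)"
          by (intro ennreal_leI) linarith
      qed
      also have "\<dots> < ennreal e" using g(2) C N by (intro ennreal_lessI) auto
      finally show ?thesis using g a by simp
    qed
    then show ?case using N h
      by (intro exI[of _ "h / real CARD('n) powr (t + s)"] conjI exI[of _ "e - N"]) auto
  qed
qed

lemma topspace_gs_topology: "topspace (gs_topology t s) = (gs_space t s :: (real ^ 'n::finite \<Rightarrow> complex) set)"
proof -
  let ?N = "\<lambda>f. {g \<in> gs_space t s. gs_norm t s 1 (\<lambda>x. g x - f x) < ennreal 1}"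
  let ?S = "{{g \<in> gs_space t s. gs_norm t s h (\<lambda>x. g x - f x) < ennreal e} | f h e.
        f \<in> gs_space t s \<and> h > 0 \<and> e > 0} :: (real ^ 'n \<Rightarrow> complex) set set"
  have "gs_norm t s 1 (\<lambda>x :: real ^ 'n. 0) \<le> ennreal 0"
    by (rule gs_norm_le[of t s "1 / real CARD('n) powr (t + s)"])
       (auto simp: gsb_def smooth_const derivs_const_0 t s)
  then have mem: "f \<in> ?N f" if "f \<in> gs_space t s" for f :: "real ^ 'n \<Rightarrow> complex"
    using that by simp
  have "?N f \<in> ?S" if "f \<in> gs_space t s" for f using that zero_less_one by blast
  then have "gs_space t s \<subseteq> \<Union> ?S" using mem by (meson UnionI subsetI)
  moreover have "\<Union> ?S \<subseteq> gs_space t s" by auto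
  ultimately show ?thesis
    unfolding gs_topology_def topology_generated_by_topspace by (rule equalityI[rotated])
qed

text \<open>By homogeneity, a neighbourhood of 0 on which u is below 1 yields a linear bound.
  Continuity of u enters the later arguments in this form only.\<close>

lemma gs_dual_bounded:
  fixes u :: "(real ^ 'n::finite \<Rightarrow> complex) \<Rightarrow> complex"
  assumes "u \<in> gs_dual t s"
  shows "\<exists>h>0. \<exists>B\<ge>0. \<forall>f C. f \<in> gs_space t s \<and> C > 0 \<and> gsb t s h C f \<longrightarrow> norm (u f) \<le> B * C"
proof -
  have cm: "\<And>c \<phi>. \<phi> \<in> gs_space t s \<Longrightarrow> u (\<lambda>x. c * \<phi> x) = cnj c * u \<phi>"
    and cont: "continuous_map (gs_topology t s) euclidean u"
    using assms by (auto simp: gs_dual_def)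
  have u0: "u (\<lambda>x. 0) = 0" using cm[OF gs_space_0, of 0] by simp
  have op: "openin (gs_topology t s) {f \<in> gs_space t s. u f \<in> ball 0 1}"
    using openin_continuous_map_preimage[OF cont, of "ball 0 1"] by (simp add: topspace_gs_topology)
  have 0: "(\<lambda>x. 0) \<in> {f \<in> gs_space t s. u f \<in> ball 0 1}" using u0 gs_space_0 by simp
  obtain h e where he: "h > 0" "e > 0"
    and nb: "\<forall>g C. g \<in> gs_space t s \<and> C < e \<and> gsb t s h C g \<longrightarrow> g \<in> {f \<in> gs_space t s. u f \<in> ball 0 1}"
    using gs_topology_neighbourhood[OF op 0] by blast
  have "norm (u f) \<le> (2 / e) * C" if f: "f \<in> gs_space t s" "C > 0" "gsb t s h C f" for f C
  proof -
    \<comment> \<open>Scaling to e / 2 meets the strict bound by e.\<close>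
    let ?c = "complex_of_real (e / (2 * C))"
    have "gsb t s h (norm ?c * C) (\<lambda>x. ?c * f x)" using f by (intro gsb_cmult)
    moreover have "norm ?c * C < e" using he f by (simp add: norm_divide norm_mult field_simps)
    ultimately have "norm (u (\<lambda>x. ?c * f x)) < 1"
      using nb[rule_format, of "\<lambda>x. ?c * f x" "norm ?c * C"] gs_space_cmult[OF f(1), of ?c] by simp
    then have "e / (2 * C) * norm (u f) < 1"
      using cm[OF f(1), of ?c] f he by (simp add: norm_mult norm_divide)
    then show ?thesis using f he by (simp add: field_simps)
  qed
  then show ?thesis using he by (intro exI[of _ h] conjI exI[of _ "2 / e"]) auto
qed

end

section \<open>Time-frequency shifts of test functions\<close>

text \<open>Up to changing h, this is the supremum over m of \<open>norm x ^ m / (h ^ m * fact m powr t)\<close>.\<close>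

definition gw :: "real \<Rightarrow> real \<Rightarrow> 'a::real_normed_vector \<Rightarrow> real" where
  "gw t h x = exp (t * (norm x / h) powr (1 / t))"

lemma power_powr_nonneg: "(a::real) \<ge> 0 \<Longrightarrow> (a ^ m) powr t = (a powr t) ^ m"
proof (cases "a = 0")
  case True then show ?thesis by (cases m) auto
next
  case False
  assume "a \<ge> 0"
  then show ?thesis using False by (simp add: powr_realpow[symmetric] powr_powr mult.commute)
qed

lemma power_le_fact_exp: "(a::real) \<ge> 0 \<Longrightarrow> a ^ m \<le> fact m * exp a"
proof -
  assume a: "a \<ge> 0"
  have "(\<Sum>k\<in>{m}. a ^ k /\<^sub>R fact k) \<le> (\<Sum>k. a ^ k /\<^sub>R fact k)"
    by (rule sum_le_suminf[OF summable_exp_generic]) (use a in auto)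
  then have "a ^ m / fact m \<le> exp a" by (simp add: exp_def field_simps)
  then show ?thesis by (simp add: field_simps)
qed

text \<open>The bound a^m \<le> fact m * exp a is used with a = (norm x / h) powr (1 / t) and raised
  to the power t. It trades powers of a shift parameter for a factorial and a weight.\<close>

lemma power_le_gw:
  assumes "h > 0" "t > 0"
  shows "norm x ^ m \<le> h ^ m * fact m powr t * gw t h x"
proof -
  let ?a = "(norm x / h) powr (1 / t)"
  have "(?a ^ m) powr t \<le> (fact m * exp ?a) powr t"
    using assms by (intro powr_mono2 power_le_fact_exp) auto
  moreover have "?a powr t = norm x / h" using assms by (simp add: powr_powr)
  ultimately have "(norm x / h) ^ m \<le> fact m powr t * gw t h x"
    by (simp add: power_powr_nonneg powr_mult exp_powr_real gw_def mult.commute)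
  then show ?thesis using assms by (simp add: power_divide field_simps)
qed

text \<open>Converse of \<open>power_le_gw\<close>. The moment bounds are raised to the power 1 / t,
  weighted by 2^(-m) / fact m and summed: one side becomes an exponential series, the other a
  geometric series of sum 2. The weights 2^(-m) cause the half in the exponent, the sum 2 causes the
  factor 2 powr t.\<close>

lemma moments_imp_decay:
  fixes h t r C X :: real
  assumes h: "h > 0" and t: "t > 0" and X: "X \<ge> 0" and r: "r \<ge> 0"
    and mom: "\<And>m. r ^ m * X \<le> C * h ^ m * fact m powr t"
  shows "X \<le> 2 powr t * C * exp (- (t / 2 * (r / h) powr (1 / t)))"
proof -
  let ?a = "(r / h) powr (1 / t)"
  have C: "C \<ge> 0" using X mom[of 0] by simp
  have "(?a / 2) ^ m /\<^sub>R fact m * X powr (1 / t) \<le> C powr (1 / t) * (1 / 2) ^ m" for m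
  proof -
    have "(r / h) ^ m * X \<le> C * fact m powr t"
      using mom[of m] h by (simp add: power_divide field_simps)
    then have "((r / h) ^ m * X) powr (1 / t) \<le> (C * fact m powr t) powr (1 / t)"
      using t h r X by (intro powr_mono2) auto
    then have "?a ^ m * X powr (1 / t) \<le> C powr (1 / t) * fact m"
      using t h r X C by (simp add: powr_mult power_powr_nonneg powr_powr)
    then show ?thesis by (simp add: power_divide field_simps)
  qed
  moreover have "summable (\<lambda>m. (?a / 2) ^ m /\<^sub>R fact m * X powr (1 / t))"
    by (intro summable_mult2 summable_exp_generic)
  moreover have "summable (\<lambda>m. C powr (1 / t) * (1 / 2 :: real) ^ m)"
    by (intro summable_mult summable_geometric) auto
  ultimately have "(\<Sum>m. (?a / 2) ^ m /\<^sub>R fact m * X powr (1 / t)) \<le> (\<Sum>m. C powr (1 / t) * (1 / 2) ^ m)"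
    by (rule suminf_le)
  also have "(\<Sum>m. C powr (1 / t) * (1 / 2 :: real) ^ m) = C powr (1 / t) * 2"
    by (subst suminf_mult) (auto simp: suminf_geometric intro: summable_geometric)
  also have "(\<Sum>m. (?a / 2) ^ m /\<^sub>R fact m * X powr (1 / t)) = exp (?a / 2) * X powr (1 / t)"
    unfolding exp_def by (rule suminf_mult2[symmetric, OF summable_exp_generic])
  finally have "(exp (?a / 2) * X powr (1 / t)) powr t \<le> (C powr (1 / t) * 2) powr t"
    using t by (intro powr_mono2) auto
  then have "exp (t / 2 * ?a) * X \<le> 2 powr t * C"
    using t X C by (simp add: powr_mult powr_powr exp_powr_real mult_ac)
  then show ?thesis by (simp add: exp_minus field_simps)
qed

lemma gw_ge_1: "t > 0 \<Longrightarrow> gw t h x \<ge> 1"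
  by (simp add: gw_def)

lemma gw_mono: "t > 0 \<Longrightarrow> h > 0 \<Longrightarrow> norm x \<le> norm y \<Longrightarrow> gw t h x \<le> gw t h y"
  by (auto simp: gw_def intro!: powr_mono2 divide_right_mono)

lemma gw_eq: "h > 0 \<Longrightarrow> gw t h x = exp (t * h powr (- 1 / t) * norm x powr (1 / t))"
  by (simp add: gw_def powr_divide powr_minus divide_simps)

text \<open>Weights are at least 1, so a maximum may be replaced by a product, which separates the
  variables.\<close>

lemma gw_le_max:
  assumes "t > 0" "h > 0" "norm x \<le> max (norm y) (norm z)"
  shows "gw t h x \<le> gw t h y * gw t h z"
proof -
  have "gw t h x \<le> max (gw t h y) (gw t h z)"
    using assms gw_mono[of t h x y] gw_mono[of t h x z] by (auto simp: max_def split: if_splits)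
  also have "\<dots> \<le> gw t h y * gw t h z"
    using gw_ge_1[OF assms(1), of h y] gw_ge_1[OF assms(1), of h z]
    by (auto simp: max_def mult_le_cancel_left1 mult_le_cancel_right1)
  finally show ?thesis .
qed

lemma add_power_le: "0 \<le> p \<Longrightarrow> 0 \<le> q \<Longrightarrow> (p + q) ^ m \<le> 2 ^ m * (p ^ m + q ^ m)" for p q :: real
proof -
  assume pq: "0 \<le> p" "0 \<le> q"
  then have "(p + q) ^ m \<le> (2 * max p q) ^ m" by (intro power_mono) auto
  also have "\<dots> \<le> 2 ^ m * (p ^ m + q ^ m)"
    using pq by (auto simp: power_mult_distrib max_def)
  finally show ?thesis .
qed

text \<open>A maximum over words of one length depends on the order k alone, which is the form of
  bound that \<open>derivs_mult_bound\<close> takes.\<close>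

definition dmax :: "nat \<Rightarrow> (real ^ 'n::finite \<Rightarrow> complex) \<Rightarrow> real ^ 'n \<Rightarrow> real" where
  "dmax k f y = Max ((\<lambda>v. norm (derivs v f y)) ` {v. length v = k})"

lemma finite_words: "finite {v :: 'n::finite list. length v = k}"
  using finite_lists_length_eq[of "UNIV :: 'n set" k] by simp

lemma words_nonempty: "{v :: 'n::finite list. length v = k} \<noteq> {}"
proof -
  have "replicate k undefined \<in> {v :: 'n list. length v = k}" by simp
  then show ?thesis by blast
qed

lemma norm_derivs_le_dmax: "norm (derivs v f y) \<le> dmax (length v) f y"
  unfolding dmax_def by (intro Max_ge finite_imageI finite_words) auto

lemma dmax_attained: "\<exists>v. length v = k \<and> dmax k f y = norm (derivs v f y)"
proof -
  have "dmax k f y \<in> (\<lambda>v. norm (derivs v f y)) ` {v. length v = k}"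
    unfolding dmax_def using words_nonempty by (intro Max_in finite_imageI finite_words) blast
  then show ?thesis by auto
qed

lemma dmax_nonneg: "dmax k f y \<ge> 0"
  using dmax_attained[of k f y] by auto

lemma gsbD_dmax:
  "gsb t s h C f \<Longrightarrow> norm y ^ m * dmax k f y \<le> C * h ^ (m + k) * fact m powr t * fact k powr s"
  using dmax_attained[of k f y] gsbD[of t s h C f y m] by metis

text \<open>As k! (n-k)! \<le> n!, the binomial coefficients simply add up to 2^n. The Leibniz rule
  thus costs only a factor 2 in h.\<close>

lemma sum_binomial_fact_powr_le:
  assumes "s \<ge> 0"
  shows "(\<Sum>k\<le>n. real (n choose k) * (fact k powr s * fact (n - k) powr s)) \<le> 2 ^ n * fact n powr s"
proof -
  have "(\<Sum>k\<le>n. real (n choose k) * (fact k powr s * fact (n - k) powr s)) \<le>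
      (\<Sum>k\<le>n. real (n choose k) * fact n powr s)"
  proof (intro sum_mono mult_left_mono)
    fix k assume "k \<in> {..n}"
    then show "fact k powr s * fact (n - k) powr s \<le> fact n powr s"
      using assms fact_mult_le[of k "n - k"] by (auto simp flip: powr_mult intro!: powr_mono2)
  qed auto
  also have "\<dots> = real (\<Sum>k\<le>n. n choose k) * fact n powr s" by (simp add: sum_distrib_right)
  finally show ?thesis by (simp add: choose_row_sum)
qed

text \<open>From Suc n \<le> 2^n: one extra derivative or one extra power of y only enlarges
  h.\<close>

lemma fact_Suc_powr_le: "s \<ge> 0 \<Longrightarrow> fact (Suc n) powr s \<le> (2 powr s) ^ n * fact n powr (s :: real)"
proof -
  assume s: "s \<ge> 0"
  have "real (Suc n) \<le> 2 ^ n"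
    using less_exp[of n] by (metis Suc_leI of_nat_le_iff of_nat_numeral of_nat_power)
  then have "(fact (Suc n) :: real) \<le> 2 ^ n * fact n" unfolding fact_Suc by (intro mult_right_mono) auto
  then have "fact (Suc n) powr s \<le> (2 ^ n * fact n :: real) powr s" using s by (intro powr_mono2) auto
  then show ?thesis by (simp add: powr_mult power_powr_nonneg)
qed

section \<open>Translations, modulations and their differences in the seminorms\<close>

context
  fixes t s h C :: real and f :: "real ^ 'n::finite \<Rightarrow> complex"
  assumes f: "gsb t s h C f" and h: "h > 0" and t: "t > 0" and s: "s > 0"
begin

text \<open>The power of norm y is split between norm (y - a), controlled by f, and norm a, which
  \<open>power_le_gw\<close> turns into the weight. Splitting doubles h.\<close>

lemma gsb_translate: "gsb t s (2 * h) (2 * C * gw t h a) (translate a f)"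
  unfolding gsb_def
proof (intro conjI allI smooth_translate gsb_smooth[OF f])
  fix m and w :: "'n list" and y :: "real ^ 'n"
  let ?X = "norm (derivs w f (y - a))" and ?n = "length w"
  let ?R = "h ^ (m + ?n) * fact m powr t * fact ?n powr s"
  have C: "C \<ge> 0" using f by (rule gsb_nonneg)
  have "norm y ^ m \<le> (norm (y - a) + norm a) ^ m"
    using norm_triangle_ineq[of "y - a" a] by (intro power_mono) auto
  also have "\<dots> \<le> 2 ^ m * (norm (y - a) ^ m + norm a ^ m)" by (rule add_power_le) auto
  finally have "norm y ^ m * ?X \<le> 2 ^ m * (norm (y - a) ^ m + norm a ^ m) * ?X"
    by (rule mult_right_mono) auto
  also have "\<dots> = 2 ^ m * (norm (y - a) ^ m * ?X + norm a ^ m * ?X)" by (simp add: algebra_simps)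
  also have "norm (y - a) ^ m * ?X \<le> C * gw t h a * ?R"
  proof -
    have "norm (y - a) ^ m * ?X \<le> C * 1 * ?R" using gsbD[OF f, of "y - a" m w] by (simp add: mult_ac)
    also have "\<dots> \<le> C * gw t h a * ?R" using C h gw_ge_1[OF t]
      by (intro mult_right_mono mult_left_mono) auto
    finally show ?thesis .
  qed
  also have "norm a ^ m * ?X \<le> C * gw t h a * ?R"
  proof -
    have "norm a ^ m * ?X \<le> (h ^ m * fact m powr t * gw t h a) * (C * h ^ ?n * fact ?n powr s)"
      using gsbD[OF f, of "y - a" 0 w] h gw_ge_1[OF t, of h a]
      by (intro mult_mono power_le_gw h t) auto
    then show ?thesis by (simp add: mult_ac power_add)
  qed
  finally have "norm y ^ m * ?X \<le> 2 ^ m * (C * gw t h a * ?R + C * gw t h a * ?R)" by simp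
  also have "\<dots> \<le> 2 ^ (m + ?n) * (C * gw t h a * ?R + C * gw t h a * ?R)"
    using C h gw_ge_1[OF t, of h a] by (intro mult_right_mono power_increasing) auto
  finally show "norm y ^ m * norm (derivs w (translate a f) y) \<le>
      2 * C * gw t h a * (2 * h) ^ (m + ?n) * fact m powr t * fact ?n powr s"
    by (simp add: derivs_translate gsb_smooth[OF f] translate_def power_mult_distrib mult_ac)
qed

text \<open>Each derivative of the wave costs a factor norm \<xi>; \<open>power_le_gw\<close> with
  exponent s supplies exactly the factorial that the Leibniz sum needs.\<close>

lemma gsb_modulate: "gsb t s (2 * h) (C * gw s h \<xi>) (modulate \<xi> f)"
  unfolding gsb_def modulate_def
proof (intro conjI allI)
  have sm: "smooth (\<lambda>y :: real ^ 'n. exp (\<i> * complex_of_real (y \<bullet> \<xi>)))" using smooth_exp[of 1 \<xi>] by simp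
  then show "smooth (\<lambda>y. exp (\<i> * complex_of_real (y \<bullet> \<xi>)) * f y)"
    by (intro smooth_mult gsb_smooth[OF f])
  fix m and w :: "'n list" and y :: "real ^ 'n"
  let ?n = "length w"
  have C: "C \<ge> 0" using f by (rule gsb_nonneg)
  let ?Q = "C * gw s h \<xi> * h ^ (m + ?n) * fact m powr t"
  have "norm y ^ m * norm (derivs w (\<lambda>y. exp (\<i> * complex_of_real (y \<bullet> \<xi>)) * f y) y) \<le>
      norm y ^ m * (\<Sum>k\<le>?n. real (?n choose k) * (norm \<xi> ^ k * dmax (?n - k) f y))"
    by (intro mult_left_mono derivs_mult_bound sm gsb_smooth[OF f] norm_derivs_exp_le norm_derivs_le_dmax) auto
  also have "\<dots> = (\<Sum>k\<le>?n. real (?n choose k) * (norm \<xi> ^ k * (norm y ^ m * dmax (?n - k) f y)))"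
    by (simp add: sum_distrib_left mult_ac)
  also have "\<dots> \<le> (\<Sum>k\<le>?n. real (?n choose k) * (?Q * (fact k powr s * fact (?n - k) powr s)))"
  proof (intro sum_mono mult_left_mono)
    fix k assume k: "k \<in> {..?n}"
    have "norm \<xi> ^ k * (norm y ^ m * dmax (?n - k) f y) \<le>
        (h ^ k * fact k powr s * gw s h \<xi>) * (C * h ^ (m + (?n - k)) * fact m powr t * fact (?n - k) powr s)"
      using gw_ge_1[OF s, of h \<xi>] h
      by (intro mult_mono gsbD_dmax[OF f] power_le_gw h s mult_nonneg_nonneg dmax_nonneg) auto
    also have "\<dots> = C * gw s h \<xi> * (h ^ k * h ^ (m + (?n - k))) * fact m powr t * (fact k powr s * fact (?n - k) powr s)"
      by (simp add: mult_ac)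
    also have "h ^ k * h ^ (m + (?n - k)) = h ^ (m + ?n)" using k by (simp flip: power_add)
    finally show "norm \<xi> ^ k * (norm y ^ m * dmax (?n - k) f y) \<le> ?Q * (fact k powr s * fact (?n - k) powr s)" .
  qed auto
  also have "\<dots> = ?Q * (\<Sum>k\<le>?n. real (?n choose k) * (fact k powr s * fact (?n - k) powr s))"
    by (simp add: sum_distrib_left mult_ac)
  also have "\<dots> \<le> ?Q * (2 ^ ?n * fact ?n powr s)"
    using C gw_ge_1[OF s, of h \<xi>] h s by (intro mult_left_mono sum_binomial_fact_powr_le) auto
  also have "\<dots> \<le> ?Q * (2 ^ (m + ?n) * fact ?n powr s)"
    using C gw_ge_1[OF s, of h \<xi>] h by (intro mult_left_mono mult_right_mono power_increasing) auto
  finally show "norm y ^ m * norm (derivs w (\<lambda>y. exp (\<i> * complex_of_real (y \<bullet> \<xi>)) * f y) y) \<le>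
      C * gw s h \<xi> * (2 * h) ^ (m + ?n) * fact m powr t * fact ?n powr s"
    by (simp add: power_mult_distrib mult_ac)
qed

text \<open>Mean value estimate along the segment from b to a. The one extra derivative is paid for
  by 2 powr s in h, through \<open>fact_Suc_powr_le\<close>.\<close>

lemma gsb_translate_diff:
  "gsb t s (2 * h * 2 powr s) (4 * h * real CARD('n) * norm (a - b) * C * gw t h a * gw t h b)
    (\<lambda>y. translate a f y - translate b f y)"
  unfolding gsb_def
proof (intro conjI allI)
  have sm: "smooth f" using f by (rule gsb_smooth)
  then show "smooth (\<lambda>y. translate a f y - translate b f y)"
    by (intro smooth_diff smooth_translate)
  fix m and w :: "'n list" and y :: "real ^ 'n"
  let ?n = "length w"
  have C: "C \<ge> 0" using f by (rule gsb_nonneg)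
  \<comment> \<open>The weight at the fixed y is treated as a constant, so the mean value bound
    differentiates only f and the weight can still be paired with the translate at y.\<close>
  let ?p = "complex_of_real (norm y ^ m)"
  define B where "B = 2 * C * (gw t h a * gw t h b) * (2 * h) ^ (m + Suc ?n) * fact m powr t * fact (Suc ?n) powr s"
  have "norm (?p * derivs w f (y - a) - ?p * derivs w f (y - b)) \<le> real CARD('n) * B * norm ((y - a) - (y - b))"
  proof (rule mean_value_partial)
    show "(\<lambda>x. ?p * derivs w f x) differentiable (at x)" for x
      using sm by (intro smooth_differentiable smooth_cmult smooth_derivs)
    fix i z assume "z \<in> closed_segment (y - b) (y - a)"
    then obtain v where v: "0 \<le> v" "v \<le> 1" "z = (1 - v) *\<^sub>R (y - b) + v *\<^sub>R (y - a)"
      by (auto simp: in_segment)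
    \<comment> \<open>A point between y - b and y - a is y - c with c between b and a, so the bound
      for the translate by c applies.\<close>
    define c where "c = (1 - v) *\<^sub>R b + v *\<^sub>R a"
    have z: "z = y - c" by (simp add: v c_def algebra_simps)
    have "norm c \<le> (1 - v) * norm b + v * norm a"
      unfolding c_def using v norm_triangle_ineq[of "(1 - v) *\<^sub>R b" "v *\<^sub>R a"] by simp
    also have "\<dots> \<le> (1 - v) * max (norm a) (norm b) + v * max (norm a) (norm b)"
      using v by (intro add_mono mult_left_mono) auto
    finally have c: "norm c \<le> max (norm a) (norm b)" by (simp add: algebra_simps)
    have "norm (partial i (\<lambda>x. ?p * derivs w f x) z) = norm y ^ m * norm (derivs (i # w) (translate c f) y)"
      using sm by (simp add: partial_cmult smooth_differentiable smooth_derivs z norm_mult norm_power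
          derivs_translate[of f "i # w", simplified] translate_def [of c])
    also have "\<dots> \<le> 2 * C * gw t h c * (2 * h) ^ (m + Suc ?n) * fact m powr t * fact (Suc ?n) powr s"
      using gsbD[OF gsb_translate[of c], of y m "i # w"] by simp
    also have "\<dots> \<le> B"
      unfolding B_def using C h by (intro mult_right_mono mult_left_mono gw_le_max[OF t h c]) auto
    finally show "norm (partial i (\<lambda>x. ?p * derivs w f x) z) \<le> B" .
  qed
  moreover have eq: "derivs w (\<lambda>y. translate a f y - translate b f y) y = derivs w f (y - a) - derivs w f (y - b)"
    by (subst derivs_diff) (simp_all add: sm smooth_translate derivs_translate, simp add: translate_def)
  ultimately have "norm y ^ m * norm (derivs w (\<lambda>y. translate a f y - translate b f y) y) \<le>
      real CARD('n) * B * norm (a - b)"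
    unfolding eq using sm by (simp add: norm_mult norm_power norm_minus_commute flip: right_diff_distrib)
  also have "B \<le> 2 * C * (gw t h a * gw t h b) * (2 * h * (2 * h * 2 powr s) ^ (m + ?n)) * fact m powr t * fact ?n powr s"
  proof -
    have "(2 * h) ^ (m + Suc ?n) * fact (Suc ?n) powr s \<le> (2 * h) ^ (m + Suc ?n) * ((2 powr s) ^ ?n * fact ?n powr s)"
      using h s by (intro mult_left_mono fact_Suc_powr_le) auto
    also have "\<dots> \<le> (2 * h) ^ (m + Suc ?n) * ((2 powr s) ^ (m + ?n) * fact ?n powr s)"
      using h s by (intro mult_left_mono mult_right_mono power_increasing) (auto simp: ge_one_powr_ge_zero)
    also have "\<dots> = (2 * h * (2 * h * 2 powr s) ^ (m + ?n)) * fact ?n powr s"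
      by (simp add: power_mult_distrib mult_ac)
    finally have "(2 * C * (gw t h a * gw t h b) * fact m powr t) * ((2 * h) ^ (m + Suc ?n) * fact (Suc ?n) powr s) \<le>
      (2 * C * (gw t h a * gw t h b) * fact m powr t) * ((2 * h * (2 * h * 2 powr s) ^ (m + ?n)) * fact ?n powr s)"
      using C gw_ge_1[OF t, of h a] gw_ge_1[OF t, of h b] by (intro mult_left_mono) auto
    then show ?thesis by (simp add: B_def mult_ac)
  qed
  finally show "norm y ^ m * norm (derivs w (\<lambda>y. translate a f y - translate b f y) y) \<le>
      4 * h * real CARD('n) * norm (a - b) * C * gw t h a * gw t h b * (2 * h * 2 powr s) ^ (m + ?n) *
      fact m powr t * fact ?n powr s"
    by (simp add: mult_ac mult_left_mono mult_right_mono)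
qed

text \<open>Undifferentiated, the bracket is at most norm y * norm c; this extra power of norm y is
  paid for by 2 powr t in h. Differentiated, it already carries powers of norm c. Thus every Leibniz
  term has a factor norm c.\<close>

lemma gsb_modulate_diff_1:
  "gsb t s (2 * h * 2 powr t) (norm c * C * (h + 1 / h) * gw s h c) (\<lambda>y. (exp (\<i> * complex_of_real (y \<bullet> c)) - 1) * f y)"
  unfolding gsb_def
proof (intro conjI allI)
  let ?e = "\<lambda>y :: real ^ 'n. exp (\<i> * complex_of_real (y \<bullet> c))"
  have sme: "smooth ?e" using smooth_exp[of 1 c] by simp
  have sm: "smooth (\<lambda>y. ?e y - 1)" by (intro smooth_diff sme smooth_const)
  then show "smooth (\<lambda>y. (?e y - 1) * f y)"
    by (intro smooth_mult gsb_smooth[OF f])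
  fix m and w :: "'n list" and y :: "real ^ 'n"
  let ?n = "length w"
  have C: "C \<ge> 0" using f by (rule gsb_nonneg)
  let ?Q = "norm c * C * (h + 1 / h) * gw s h c * h ^ (m + ?n) * fact (Suc m) powr t"
  let ?A = "\<lambda>k. if k = 0 then norm y * norm c else norm c ^ k"
  have A: "norm (derivs v (\<lambda>y. ?e y - 1) y) \<le> ?A (length v)" for v
  proof (cases v rule: rev_cases)
    case Nil
    have "norm (?e y - 1) \<le> \<bar>y \<bullet> c\<bar>"
      using iexp_approx1[of "y \<bullet> c" 0] by simp
    also have "\<dots> \<le> norm y * norm c" by (rule Cauchy_Schwarz_ineq2)
    finally show ?thesis using Nil by simp
  next
    case (snoc v' i)
    have "derivs v (\<lambda>y. ?e y - 1) = (\<lambda>y. derivs v ?e y - derivs v (\<lambda>y. 1) y)"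
      by (intro derivs_diff sme smooth_const)
    moreover have "derivs v (\<lambda>y. 1) = (\<lambda>y :: real ^ 'n. 0)"
      using snoc by (simp add: partial_const derivs_const_0)
    ultimately show ?thesis using norm_derivs_exp_le[of v c y] snoc by simp
  qed
  have ff: "fact m powr t \<le> fact (Suc m) powr t"
    using t by (intro powr_mono2 fact_mono) auto
  have "norm y ^ m * norm (derivs w (\<lambda>y. (?e y - 1) * f y) y) \<le>
      norm y ^ m * (\<Sum>k\<le>?n. real (?n choose k) * (?A k * dmax (?n - k) f y))"
    by (intro mult_left_mono derivs_mult_bound sm gsb_smooth[OF f] A norm_derivs_le_dmax) auto
  also have "\<dots> = (\<Sum>k\<le>?n. real (?n choose k) * (?A k * (norm y ^ m * dmax (?n - k) f y)))"
    by (simp add: sum_distrib_left mult_ac)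
  also have "\<dots> \<le> (\<Sum>k\<le>?n. real (?n choose k) * (?Q * (fact k powr s * fact (?n - k) powr s)))"
  proof (intro sum_mono mult_left_mono)
    fix k assume k: "k \<in> {..?n}"
    show "?A k * (norm y ^ m * dmax (?n - k) f y) \<le> ?Q * (fact k powr s * fact (?n - k) powr s)"
    proof (cases k)
      case 0
      have "?A k * (norm y ^ m * dmax (?n - k) f y) = norm c * (norm y ^ Suc m * dmax ?n f y)"
        by (simp add: 0)
      also have "\<dots> \<le> norm c * (C * h ^ (Suc m + ?n) * fact (Suc m) powr t * fact ?n powr s)"
        by (intro mult_left_mono gsbD_dmax[OF f]) auto
      also have "\<dots> = norm c * C * h * 1 * h ^ (m + ?n) * fact (Suc m) powr t * fact ?n powr s" by simp
      also have "\<dots> \<le> ?Q * fact ?n powr s"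
        using C h gw_ge_1[OF s, of h c]
        by (intro mult_mono mult_nonneg_nonneg order_refl) auto
      finally show ?thesis by (simp add: 0)
    next
      case (Suc j)
      \<comment> \<open>One factor norm c is kept for the Lipschitz bound, so
        \<open>power_le_gw\<close> supplies h^j instead of h^k: hence the 1 / h in the constant,
        while the case k = 0 gives the h.\<close>
      have "norm c ^ j \<le> h ^ j * fact j powr s * gw s h c" by (intro power_le_gw h s)
      also have "\<dots> \<le> h ^ j * fact k powr s * gw s h c"
        using h s gw_ge_1[OF s, of h c] Suc
        by (intro mult_right_mono mult_left_mono powr_mono2 fact_mono) auto
      finally have cj: "norm c ^ k \<le> norm c * (h ^ j * fact k powr s * gw s h c)"
        by (simp add: Suc mult_left_mono)
      have "?A k * (norm y ^ m * dmax (?n - k) f y) \<le>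
          (norm c * (h ^ j * fact k powr s * gw s h c)) * (C * h ^ (m + (?n - k)) * fact m powr t * fact (?n - k) powr s)"
        using cj gw_ge_1[OF s, of h c] h Suc
        by (intro mult_mono gsbD_dmax[OF f] mult_nonneg_nonneg dmax_nonneg) auto
      also have "\<dots> = norm c * C * (1 / h) * gw s h c * (h * h ^ j * h ^ (m + (?n - k))) * fact m powr t * (fact k powr s * fact (?n - k) powr s)"
        using h by (simp add: mult_ac)
      also have "h * h ^ j * h ^ (m + (?n - k)) = h ^ (m + ?n)"
      proof -
        have "Suc j + (m + (?n - k)) = m + ?n" using k Suc by simp
        then show ?thesis by (metis power_Suc power_add)
      qed
      also have "norm c * C * (1 / h) * gw s h c * h ^ (m + ?n) * fact m powr t * (fact k powr s * fact (?n - k) powr s) \<le>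
         ?Q * (fact k powr s * fact (?n - k) powr s)"
        using C h gw_ge_1[OF s, of h c] ff
        by (intro mult_mono mult_nonneg_nonneg order_refl) auto
      finally show ?thesis .
    qed
  qed auto
  also have "\<dots> = ?Q * (\<Sum>k\<le>?n. real (?n choose k) * (fact k powr s * fact (?n - k) powr s))"
    by (simp add: sum_distrib_left mult_ac)
  also have "\<dots> \<le> ?Q * (2 ^ ?n * fact ?n powr s)"
    using C gw_ge_1[OF s, of h c] h s by (intro mult_left_mono sum_binomial_fact_powr_le) auto
  also have "\<dots> = (norm c * C * (h + 1 / h) * gw s h c * h ^ (m + ?n) * fact ?n powr s) * (2 ^ ?n * fact (Suc m) powr t)"
    by (simp add: mult_ac)
  also have "\<dots> \<le> (norm c * C * (h + 1 / h) * gw s h c * h ^ (m + ?n) * fact ?n powr s) *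
      (2 ^ (m + ?n) * ((2 powr t) ^ (m + ?n) * fact m powr t))"
  proof (intro mult_left_mono mult_mono)
    have "fact (Suc m) powr t \<le> (2 powr t) ^ m * fact m powr t" using t by (intro fact_Suc_powr_le) auto
    also have "\<dots> \<le> (2 powr t) ^ (m + ?n) * fact m powr t"
      using t by (intro mult_right_mono power_increasing) (auto simp: ge_one_powr_ge_zero)
    finally show "fact (Suc m) powr t \<le> (2 powr t) ^ (m + ?n) * fact m powr t" .
  qed (use C gw_ge_1[OF s, of h c] h in \<open>auto intro!: mult_nonneg_nonneg power_increasing\<close>)
  finally show "norm y ^ m * norm (derivs w (\<lambda>y. (?e y - 1) * f y) y) \<le>
      norm c * C * (h + 1 / h) * gw s h c * (2 * h * 2 powr t) ^ (m + ?n) * fact m powr t * fact ?n powr s"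
    by (simp add: power_mult_distrib mult_ac)
qed

end

lemma gw_le_exp:
  assumes "h > 0" "t * h powr (- 1 / t) \<le> r"
  shows "gw t h x \<le> exp (r * norm x powr (1 / t))"
  unfolding gw_eq[OF assms(1)] using assms by (simp add: mult_right_mono)

lemma gw_diff_le:
  fixes x y :: "'a::real_normed_vector"
  assumes "t > 0" "h > 0"
  shows "gw t h (x - y) \<le> gw t (h / 2) x * gw t (h / 2) y"
proof -
  have "gw t h (x - y) = gw t (h / 2) ((1 / 2) *\<^sub>R (x - y))"
    by (simp add: gw_def)
  also have "\<dots> \<le> gw t (h / 2) x * gw t (h / 2) y"
    using norm_triangle_ineq4[of x y] assms by (intro gw_le_max) (auto simp: max_def)
  finally show ?thesis .
qed

text \<open>For z = (x, \<xi>) this is \<open>M_\<xi> T_x f\<close>; the weight \<open>wt\<close> is homogeneous of degree one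
  under the anisotropic dilations that define the wave front set.\<close>

definition tfs :: "(real ^ 'n) \<times> (real ^ 'n) \<Rightarrow> (real ^ 'n::finite \<Rightarrow> complex) \<Rightarrow> real ^ 'n \<Rightarrow> complex" where
  "tfs z f = modulate (snd z) (translate (fst z) f)"

definition wt :: "real \<Rightarrow> real \<Rightarrow> (real ^ 'n) \<times> (real ^ 'n::finite) \<Rightarrow> real" where
  "wt t s z = norm (fst z) powr (1 / t) + norm (snd z) powr (1 / s)"

lemma wt_nonneg: "wt t s z \<ge> 0"
  by (simp add: wt_def)

lemma gsb_cnj:
  fixes f :: "real ^ 'n::finite \<Rightarrow> complex"
  shows "gsb t s h C f \<Longrightarrow> gsb t s h C (\<lambda>y. cnj (f y))"
  by (auto simp: gsb_def smooth_cnj derivs_cnj)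

section \<open>Time-frequency shifts measured by the weight \<open>wt\<close>, and linear
  substitutions\<close>

context
  fixes t s :: real
  assumes t: "t > 0" and s: "s > 0"
begin

lemma tfs_bound:
  fixes f :: "real ^ 'n::finite \<Rightarrow> complex"
  assumes f: "f \<in> gs_space t s" and h: "h > 0"
  shows "\<exists>C r. \<forall>z. gsb t s h (C * exp (r * wt t s z)) (tfs z f)"
proof -
  \<comment> \<open>Translation and modulation double h once each.\<close>
  define k where "k = h / 4"
  have k: "k > 0" "2 * (2 * k) = h" using h by (auto simp: k_def)
  obtain C where C: "gsb t s k C f" using f k unfolding gs_space_iff_gsb[OF t s] by blast
  have C0: "C \<ge> 0" using C by (rule gsb_nonneg)
  define r where "r = max (t * k powr (- 1 / t)) (s * (2 * k) powr (- 1 / s))"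
  have "gsb t s h (2 * C * exp (r * wt t s z)) (tfs z f)" for z
  proof (rule gsb_mono)
    show "gsb t s h (2 * C * gw t k (fst z) * gw s (2 * k) (snd z)) (tfs z f)"
      unfolding tfs_def
      using gsb_modulate[OF gsb_translate[OF C k(1) t s] _ t s] k by simp
    have "2 * C * (gw t k (fst z) * gw s (2 * k) (snd z)) \<le>
        2 * C * (exp (r * norm (fst z) powr (1 / t)) * exp (r * norm (snd z) powr (1 / s)))"
      using C0 k gw_ge_1[OF t, of k "fst z"] gw_ge_1[OF s, of "2 * k" "snd z"]
      by (intro mult_left_mono mult_mono gw_le_exp) (auto simp: r_def)
    then show "2 * C * gw t k (fst z) * gw s (2 * k) (snd z) \<le> 2 * C * exp (r * wt t s z)"
      by (simp add: wt_def distrib_left exp_add mult_ac)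
  qed (use h in auto)
  then show ?thesis by blast
qed

lemma tfs_in_gs_space: "f \<in> gs_space t s \<Longrightarrow> tfs z f \<in> gs_space t s"
  using tfs_bound unfolding gs_space_iff_gsb[OF t s, of "tfs z f"] by blast

text \<open>The difference is split into a modulated difference of translates and a modulation of
  (wave - 1) times one translate, so that each part varies only one of the two parameters.\<close>

lemma tfs_diff_bound:
  fixes f :: "real ^ 'n::finite \<Rightarrow> complex"
  assumes f: "f \<in> gs_space t s" and h: "h > 0"
  shows "\<exists>C r. \<forall>z z'. gsb t s h (C * (norm (fst z - fst z') + norm (snd z - snd z')) *
     exp (r * (wt t s z + wt t s z'))) (\<lambda>y. tfs z f y - tfs z' f y)"
proof -
  \<comment> \<open>Both values undo the accumulated losses: 2 * 2 powr s for the difference of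
    translates and 2 for the modulation; respectively 2 for the translate, 2 * 2 powr t for the
    factor wave - 1 and 2 for the outer modulation.\<close>
  define h1 where "h1 = h / (4 * 2 powr s)"
  define h2 where "h2 = h / (8 * 2 powr t)"
  have h1: "h1 > 0" "2 * (2 * h1 * 2 powr s) = h" using h by (auto simp: h1_def)
  have h2: "h2 > 0" "2 * (2 * (2 * h2) * 2 powr t) = h" using h by (auto simp: h2_def)
  obtain C1 where C1: "gsb t s h1 C1 f" using f h1 unfolding gs_space_iff_gsb[OF t s] by blast
  obtain C2 where C2: "gsb t s h2 C2 f" using f h2 unfolding gs_space_iff_gsb[OF t s] by blast
  have C0: "C1 \<ge> 0" "C2 \<ge> 0" using C1 C2 by (auto intro: gsb_nonneg)
  define r where "r = Max {t * h1 powr (- 1 / t), t * h2 powr (- 1 / t), s * (2 * h1 * 2 powr s) powr (- 1 / s),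
     s * h2 powr (- 1 / s), s * (2 * (2 * h2) * 2 powr t) powr (- 1 / s)}"
  have r: "t * h1 powr (- 1 / t) \<le> r" "t * h2 powr (- 1 / t) \<le> r" "s * (2 * h1 * 2 powr s) powr (- 1 / s) \<le> r"
     "s * h2 powr (- 1 / s) \<le> r" "s * (2 * (2 * h2) * 2 powr t) powr (- 1 / s) \<le> r"
    unfolding r_def by (auto intro: Max_ge)
  have r0: "r \<ge> 0" using order_trans[OF _ r(1)] t by simp
  define K1 where "K1 = 4 * h1 * real CARD('n) * C1"
  define K2 where "K2 = 2 * C2 * (2 * h2 + 1 / (2 * h2))"
  have K: "K1 \<ge> 0" "K2 \<ge> 0" using C0 h1 h2 by (auto simp: K1_def K2_def)
  have "gsb t s h ((K1 + K2) * (norm (fst z - fst z') + norm (snd z - snd z')) *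
     exp (2 * r * (wt t s z + wt t s z'))) (\<lambda>y. tfs z f y - tfs z' f y)" for z z'
  proof -
    obtain x \<xi> x' \<xi>' where z: "z = (x, \<xi>)" "z' = (x', \<xi>')" by (cases z, cases z')
    let ?a = "norm x powr (1 / t)" and ?a' = "norm x' powr (1 / t)"
    let ?b = "norm \<xi> powr (1 / s)" and ?b' = "norm \<xi>' powr (1 / s)"
    let ?N = "norm (x - x') + norm (\<xi> - \<xi>')" and ?E = "exp (2 * r * (wt t s z + wt t s z'))"
    have A: "gsb t s h (K1 * ?N * ?E) (modulate \<xi> (\<lambda>y. translate x f y - translate x' f y))"
    proof (rule gsb_mono)
      show "gsb t s h (4 * h1 * real CARD('n) * norm (x - x') * C1 * gw t h1 x * gw t h1 x' * gw s (2 * h1 * 2 powr s) \<xi>)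
         (modulate \<xi> (\<lambda>y. translate x f y - translate x' f y))"
        using gsb_modulate[OF gsb_translate_diff[OF C1 h1(1) t s, of x x'] _ t s, of \<xi>] h1 by simp
      have "K1 * norm (x - x') * (gw t h1 x * gw t h1 x' * gw s (2 * h1 * 2 powr s) \<xi>)
          \<le> K1 * ?N * (exp (r * ?a) * exp (r * ?a') * exp (r * ?b))"
        using K h1 r gw_ge_1[OF t, of h1 x] gw_ge_1[OF t, of h1 x'] gw_ge_1[OF s, of "2 * h1 * 2 powr s" \<xi>]
        by (intro mult_mono gw_le_exp mult_nonneg_nonneg) (auto intro: mult_nonneg_nonneg)
      also have "\<dots> \<le> K1 * ?N * ?E"
      proof (intro mult_left_mono)
        have "r * ?a + r * ?a' + r * ?b \<le> 2 * r * (wt t s z + wt t s z')"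
          using r0 by (simp add: wt_def z algebra_simps)
        then show "exp (r * ?a) * exp (r * ?a') * exp (r * ?b) \<le> ?E"
          by (simp flip: exp_add)
      qed (use K in auto)
      finally show "4 * h1 * real CARD('n) * norm (x - x') * C1 * gw t h1 x * gw t h1 x' * gw s (2 * h1 * 2 powr s) \<xi> \<le> K1 * ?N * ?E"
        by (simp add: K1_def mult_ac)
    qed (use h in auto)
    have B: "gsb t s h (K2 * ?N * ?E) (modulate \<xi>' (\<lambda>y. (exp (\<i> * complex_of_real (y \<bullet> (\<xi> - \<xi>'))) - 1) * translate x' f y))"
    proof (rule gsb_mono)
      show "gsb t s h (norm (\<xi> - \<xi>') * (2 * C2 * gw t h2 x') * (2 * h2 + 1 / (2 * h2)) * gw s (2 * h2) (\<xi> - \<xi>')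
          * gw s (2 * (2 * h2) * 2 powr t) \<xi>')
         (modulate \<xi>' (\<lambda>y. (exp (\<i> * complex_of_real (y \<bullet> (\<xi> - \<xi>'))) - 1) * translate x' f y))"
        using gsb_modulate[OF gsb_modulate_diff_1[OF gsb_translate[OF C2 h2(1) t s, of x'] _ t s, of "\<xi> - \<xi>'"] _ t s, of \<xi>'] h2 by simp
      have d: "gw s (2 * h2) (\<xi> - \<xi>') \<le> exp (r * ?b) * exp (r * ?b')"
      proof -
        have "gw s (2 * h2) (\<xi> - \<xi>') \<le> gw s h2 \<xi> * gw s h2 \<xi>'"
          using gw_diff_le[OF s, of "2 * h2" \<xi> \<xi>'] h2 by simp
        also have "\<dots> \<le> exp (r * ?b) * exp (r * ?b')"
          using h2 r gw_ge_1[OF s, of h2 \<xi>'] by (intro mult_mono gw_le_exp) auto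
        finally show ?thesis .
      qed
      have "K2 * norm (\<xi> - \<xi>') * (gw t h2 x' * gw s (2 * h2) (\<xi> - \<xi>') * gw s (2 * (2 * h2) * 2 powr t) \<xi>')
          \<le> K2 * ?N * (exp (r * ?a') * (exp (r * ?b) * exp (r * ?b')) * exp (r * ?b'))"
        using K h2 r d gw_ge_1[OF t, of h2 x'] gw_ge_1[OF s, of "2 * h2" "\<xi> - \<xi>'"] gw_ge_1[OF s, of "2 * (2 * h2) * 2 powr t" \<xi>']
        by (intro mult_mono gw_le_exp mult_nonneg_nonneg) (auto intro: mult_nonneg_nonneg)
      also have "\<dots> \<le> K2 * ?N * ?E"
      proof (intro mult_left_mono)
        \<comment> \<open>The frequency \<xi>' is charged twice, by the frequency difference and by
          the outer modulation; hence the rate 2 * r.\<close>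
        have "r * ?a' + (r * ?b + r * ?b') + r * ?b' \<le> 2 * r * (wt t s z + wt t s z')"
          using r0 by (simp add: wt_def z algebra_simps)
        then show "exp (r * ?a') * (exp (r * ?b) * exp (r * ?b')) * exp (r * ?b') \<le> ?E"
          by (simp flip: exp_add)
      qed (use K in auto)
      finally show "norm (\<xi> - \<xi>') * (2 * C2 * gw t h2 x') * (2 * h2 + 1 / (2 * h2)) * gw s (2 * h2) (\<xi> - \<xi>')
          * gw s (2 * (2 * h2) * 2 powr t) \<xi>' \<le> K2 * ?N * ?E"
        by (simp only: K2_def mult_ac)
    qed (use h in auto)
    have "(\<lambda>y. tfs z f y - tfs z' f y) = (\<lambda>y. modulate \<xi> (\<lambda>y. translate x f y - translate x' f y) y +
       modulate \<xi>' (\<lambda>y. (exp (\<i> * complex_of_real (y \<bullet> (\<xi> - \<xi>'))) - 1) * translate x' f y) y)"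
      by (auto simp: tfs_def z modulate_def algebra_simps inner_diff_right exp_diff)
    then show ?thesis using gsb_add[OF A B] by (simp add: z distrib_right)
  qed
  then show ?thesis by blast
qed

text \<open>Derivatives cost entries of A, powers of norm y cost the operator norm of the left
  inverse B. \<open>K\<close> dominates both, and the bound of f for h / K is used.\<close>

lemma gs_space_matrix:
  fixes A B :: "real ^ 'n ^ 'n::finite"
  assumes f: "f \<in> gs_space t s" and BA: "B ** A = mat 1"
  shows "(\<lambda>y. f (A *v y)) \<in> gs_space t s"
  unfolding gs_space_iff_gsb[OF t s]
proof (intro allI impI)
  fix h :: real assume h: "h > 0"
  define K where "K = (\<Sum>i\<in>UNIV. \<Sum>j\<in>UNIV. \<bar>A $ i $ j\<bar>) + onorm ((*v) B) + 1"
  have on: "onorm ((*v) B) \<ge> 0" by (rule onorm_pos_le[OF matrix_vector_mul_bounded_linear])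
  have K: "K > 0" "(\<Sum>i\<in>UNIV. \<Sum>j\<in>UNIV. \<bar>A $ i $ j\<bar>) \<le> K" "onorm ((*v) B) \<le> K"
    using on by (auto simp: K_def intro!: add_nonneg_pos sum_nonneg add_nonneg_nonneg)
  obtain C where C: "gsb t s (h / K) C f"
    using f h K unfolding gs_space_iff_gsb[OF t s] by (meson divide_pos_pos)
  have sm: "smooth f" using C by (rule gsb_smooth)
  have "gsb t s h C (\<lambda>y. f (A *v y))"
    unfolding gsb_def
  proof (intro conjI allI smooth_matrix sm)
    fix m and w :: "'n list" and y :: "real ^ 'n"
    let ?n = "length w"
    have "y = B *v (A *v y)" using BA by (simp add: matrix_vector_mul_assoc)
    then have "norm y \<le> onorm ((*v) B) * norm (A *v y)"
      by (metis onorm[OF matrix_vector_mul_bounded_linear])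
    also have "\<dots> \<le> K * norm (A *v y)" using K by (intro mult_right_mono) auto
    finally have y: "norm y ^ m \<le> (K * norm (A *v y)) ^ m" by (intro power_mono) auto
    have "norm (derivs w (\<lambda>y. f (A *v y)) y) \<le> (\<Sum>i\<in>UNIV. \<Sum>j\<in>UNIV. \<bar>A $ i $ j\<bar>) ^ ?n * dmax ?n f (A *v y)"
      by (intro derivs_matrix_bound sm) (metis norm_derivs_le_dmax)
    also have "\<dots> \<le> K ^ ?n * dmax ?n f (A *v y)"
      using K by (intro mult_right_mono power_mono dmax_nonneg sum_nonneg) auto
    finally have "norm y ^ m * norm (derivs w (\<lambda>y. f (A *v y)) y) \<le> (K * norm (A *v y)) ^ m * (K ^ ?n * dmax ?n f (A *v y))"
      using y K by (intro mult_mono) auto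
    also have "\<dots> = K ^ (m + ?n) * (norm (A *v y) ^ m * dmax ?n f (A *v y))"
      by (simp add: power_mult_distrib power_add)
    also have "\<dots> \<le> K ^ (m + ?n) * (C * (h / K) ^ (m + ?n) * fact m powr t * fact ?n powr s)"
      using K by (intro mult_left_mono gsbD_dmax[OF C]) auto
    also have "\<dots> = C * h ^ (m + ?n) * fact m powr t * fact ?n powr s"
      using K by (simp add: power_divide)
    finally show "norm y ^ m * norm (derivs w (\<lambda>y. f (A *v y)) y) \<le> C * h ^ (m + ?n) * fact m powr t * fact ?n powr s" .
  qed
  then show "\<exists>C. gsb t s h C (\<lambda>y. f (A *v y))" by blast
qed

text \<open>Reverse of \<open>fact_mult_le\<close> up to 2^(m+n), from the bound on binomial
  coefficients; it detaches a fixed n from a varying m.\<close>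

lemma fact_add_powr_le: "r \<ge> 0 \<Longrightarrow> fact (m + n) powr (r :: real) \<le> (2 powr r) ^ m * ((2 powr r) ^ n * fact n powr r) * fact m powr r"
proof -
  assume r: "r \<ge> 0"
  have "fact m * fact n * real (m + n choose m) = fact (m + n)"
    using binomial_fact_lemma[of m "m + n"] by (metis add_diff_cancel_left' le_add1 of_nat_fact of_nat_mult)
  moreover have "real (m + n choose m) \<le> 2 ^ (m + n)"
    using binomial_le_pow2[of "m + n" m] by (metis of_nat_le_iff of_nat_numeral of_nat_power)
  ultimately have "(fact (m + n) :: real) \<le> fact m * fact n * 2 ^ (m + n)"
    by (metis fact_ge_zero mult_left_mono mult_nonneg_nonneg)
  then have "fact (m + n) powr r \<le> (fact m * fact n * 2 ^ (m + n)) powr r" using r by (intro powr_mono2) auto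
  then show ?thesis by (simp add: powr_mult power_powr_nonneg power_add mult_ac)
qed

text \<open>A fixed polynomial weight raises the moment from m to m + 2 * N. The factorial then
  splits with a loss (2 powr t)^m, absorbed by starting from g = h / 2 powr t, and a constant
  depending on N. This gives integrability together with the seminorm bounds.\<close>

lemma gs_space_weighted:
  fixes f :: "real ^ 'n::finite \<Rightarrow> complex"
  assumes f: "f \<in> gs_space t s" and h: "h > 0"
  shows "\<exists>C\<ge>0. \<forall>m k y. (1 + norm y ^ 2) ^ N * (norm y ^ m * dmax k f y) \<le> C * h ^ (m + k) * fact m powr t * fact k powr s"
proof -
  define g where "g = h / 2 powr t"
  have g: "g > 0" "2 powr t * g = h" "g \<le> h" using h t by (auto simp: g_def divide_simps ge_one_powr_ge_zero)
  obtain C where C: "gsb t s g C f"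
    using f g unfolding gs_space_iff_gsb[OF t s] by blast
  have C0: "C \<ge> 0" using C by (rule gsb_nonneg)
  define G where "G = g ^ (2 * N) * ((2 powr t) ^ (2 * N) * fact (2 * N) powr t)"
  have G: "G \<ge> 0" using g by (simp add: G_def)
  have "(1 + norm y ^ 2) ^ N * (norm y ^ m * dmax k f y) \<le> 2 ^ N * (C * (1 + G)) * h ^ (m + k) * fact m powr t * fact k powr s" for m k y
  proof -
    let ?R = "h ^ (m + k) * fact m powr t * fact k powr s"
    have "(1 + norm y ^ 2) ^ N \<le> 2 ^ N * (1 + norm y ^ (2 * N))"
      using add_power_le[of 1 "norm y ^ 2" N] by (simp add: power_mult)
    then have "(1 + norm y ^ 2) ^ N * (norm y ^ m * dmax k f y) \<le> 2 ^ N * (1 + norm y ^ (2 * N)) * (norm y ^ m * dmax k f y)"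
      by (intro mult_right_mono mult_nonneg_nonneg dmax_nonneg) auto
    also have "\<dots> = 2 ^ N * (norm y ^ m * dmax k f y + norm y ^ (m + 2 * N) * dmax k f y)"
      by (simp add: algebra_simps power_add)
    also have "norm y ^ m * dmax k f y \<le> C * ?R"
    proof -
      have "norm y ^ m * dmax k f y \<le> C * g ^ (m + k) * fact m powr t * fact k powr s" by (rule gsbD_dmax[OF C])
      also have "\<dots> \<le> C * h ^ (m + k) * fact m powr t * fact k powr s"
        using g C0 by (intro mult_right_mono mult_left_mono power_mono) auto
      finally show ?thesis by (simp add: mult_ac)
    qed
    also have "norm y ^ (m + 2 * N) * dmax k f y \<le> C * G * ?R"
    proof -
      have "norm y ^ (m + 2 * N) * dmax k f y \<le> C * g ^ (m + 2 * N + k) * fact (m + 2 * N) powr t * fact k powr s"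
        by (rule gsbD_dmax[OF C])
      also have "\<dots> \<le> C * g ^ (m + 2 * N + k) * ((2 powr t) ^ m * ((2 powr t) ^ (2 * N) * fact (2 * N) powr t) * fact m powr t) * fact k powr s"
        using g C0 t by (intro mult_right_mono mult_left_mono fact_add_powr_le) auto
      also have "\<dots> = C * G * (((2 powr t * g) ^ m * g ^ k) * fact m powr t * fact k powr s)"
        by (simp add: G_def power_add power_mult_distrib mult_ac)
      also have "\<dots> \<le> C * G * ((h ^ m * h ^ k) * fact m powr t * fact k powr s)"
        using g G C0 h by (intro mult_left_mono mult_right_mono) (auto intro!: power_mono)
      finally show ?thesis by (simp add: power_add)
    qed
    finally show ?thesis by (simp add: algebra_simps)
  qed
  then show ?thesis using C0 G by (intro exI[of _ "2 ^ N * (C * (1 + G))"]) auto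
qed

end

section \<open>Integrals depending on a parameter\<close>

lemma
  fixes f :: "'a::euclidean_space \<Rightarrow> real \<Rightarrow> 'b::{real_normed_field, banach, second_countable_topology}"
  assumes "\<And>b. b \<in> Basis \<Longrightarrow> integrable lborel (f b)"
  shows integrable_lborel_prod: "integrable lborel (\<lambda>x. \<Prod>b\<in>Basis. f b (x \<bullet> b))" (is ?A)
    and integral_lborel_prod: "(LINT x|lborel. (\<Prod>b\<in>Basis. f b (x \<bullet> b))) = (\<Prod>b\<in>Basis. (LINT x|lborel. f b x))" (is ?B)
proof -
  interpret product_sigma_finite "\<lambda>b :: 'a. lborel :: real measure" ..
  have [measurable]: "f b \<in> borel_measurable borel" if "b \<in> Basis" for b
    using borel_measurable_integrable[OF assms[OF that]] by simp
  have m: "(\<lambda>x. \<Prod>b\<in>Basis. f b (x \<bullet> b)) \<in> borel_measurable borel" by measurable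
  have eq: "(\<Prod>b\<in>Basis. f b ((\<Sum>c\<in>Basis. x c *\<^sub>R c) \<bullet> b)) = (\<Prod>b\<in>Basis. f b (x b))" for x
    by (intro prod.cong) (auto simp: inner_sum_left_Basis)
  show ?A
    by (subst lborel_eq, subst integrable_distr_eq)
       (use m product_integrable_prod[of Basis f] assms in \<open>auto simp: eq\<close>)
  show ?B
    by (subst lborel_eq, subst integral_distr)
       (use m product_integral_prod[of Basis f] assms in \<open>auto simp: eq\<close>)
qed

text \<open>Integrable polynomial weight; the exponent is the dimension so that it is dominated by
  the product of inverse (1 + x_b^2) over the coordinates.\<close>

definition jw :: "'a::euclidean_space \<Rightarrow> real" where
  "jw y = inverse ((1 + norm y ^ 2) ^ DIM('a))"

lemma jw_pos: "jw y > 0"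
  by (simp add: jw_def add_pos_nonneg)

lemma jw_measurable [measurable]: "jw \<in> borel_measurable borel"
  unfolding jw_def [abs_def] by measurable

lemma integrable_jw: "integrable lborel (jw :: 'a::euclidean_space \<Rightarrow> real)"
proof -
  have 1: "integrable lborel (\<lambda>x :: real. inverse (1 + x^2))"
    using integrable_inverse_1_plus_square by (simp add: set_integrable_def)
  have "integrable lborel (\<lambda>x :: 'a. \<Prod>b\<in>Basis. inverse (1 + (x \<bullet> b)^2))"
    by (rule integrable_lborel_prod) (rule 1)
  then show ?thesis
  proof (rule Bochner_Integration.integrable_bound)
    show "AE x in lborel. norm (jw (x :: 'a)) \<le> norm (\<Prod>b\<in>Basis. inverse (1 + (x \<bullet> b)^2) :: real)"
    proof (intro AE_I2)
      fix x :: 'a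
      have "(\<Prod>b\<in>Basis. 1 + (x \<bullet> b)^2) \<le> (\<Prod>b\<in>(Basis :: 'a set). 1 + norm x ^ 2)"
        using Basis_le_norm[of _ x] by (intro prod_mono) (auto intro!: power2_le_iff_abs_le[THEN iffD2])
      moreover have p: "0 < 1 + r^2" for r :: real by (simp add: add_pos_nonneg)
      have "(\<Prod>b\<in>Basis. 1 + (x \<bullet> b)^2) > 0" by (intro prod_pos) (simp add: p)
      moreover have "(\<Prod>b\<in>Basis. inverse (1 + (x \<bullet> b)^2)) = inverse (\<Prod>b\<in>Basis. 1 + (x \<bullet> b)^2)"
        using prod_inversef[of "\<lambda>b. 1 + (x \<bullet> b)^2" Basis] by (simp add: o_def)
      ultimately show "norm (jw x) \<le> norm (\<Prod>b\<in>Basis. inverse (1 + (x \<bullet> b)^2) :: real)"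
        using jw_pos[of x] by (simp add: jw_def le_imp_inverse_le)
    qed
  qed simp
qed

text \<open>Differentiation under the integral by dominated convergence of the difference quotients.
  The unit ball is convex, so a bound on the partial derivatives there controls the quotients by
  \<open>mean_value_partial\<close>.\<close>

lemma has_derivative_integral:
  fixes G :: "'a \<Rightarrow> real ^ 'n::finite \<Rightarrow> complex"
  assumes diff: "\<And>z x. G z differentiable (at x)"
    and int: "\<And>x. integrable M (\<lambda>z. G z x)"
    and meas: "\<And>i. (\<lambda>z. partial i (G z) y) \<in> borel_measurable M"
    and K: "integrable M K" "\<And>z x i. x \<in> ball y 1 \<Longrightarrow> norm (partial i (G z) x) \<le> K z"
  shows "((\<lambda>x. (LINT z|M. G z x)) has_derivative (\<lambda>h. \<Sum>i\<in>UNIV. h $ i *\<^sub>R (LINT z|M. partial i (G z) y))) (at y)"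
proof -
  let ?d = "real CARD('n)"
  let ?F = "\<lambda>x. (LINT z|M. G z x)" and ?L = "\<lambda>z h. \<Sum>i\<in>UNIV. h $ i *\<^sub>R partial i (G z) y"
  let ?D = "\<lambda>h. \<Sum>i\<in>UNIV. h $ i *\<^sub>R (LINT z|M. partial i (G z) y)"
  have K0: "K z \<ge> 0" for z using order_trans[OF norm_ge_zero K(2)[of y _ z]] by simp
  have ip: "integrable M (\<lambda>z. partial i (G z) y)" for i
    by (rule Bochner_Integration.integrable_bound[OF K(1) meas]) (use K(2)[of y] K0 in auto)
  have iL: "integrable M (\<lambda>z. ?L z h)" for h using ip by simp
  have D: "?D h = (LINT z|M. ?L z h)" for h using ip by simp
  \<comment> \<open>Restricting to the ball does not change the limit, and makes every test sequence
    stay where \<open>K\<close> dominates.\<close>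
  have at_eq: "at y within ball y 1 = at y" by (rule at_within_open) auto
  have "bounded_linear ?D"
    by (intro bounded_linear_sum bounded_linear_scaleR_const bounded_linear_vec_nth)
  moreover have "((\<lambda>x. norm (?F x - ?F y - ?D (x - y)) / norm (x - y)) \<longlongrightarrow> 0) (at y within ball y 1)"
    unfolding tendsto_at_iff_sequentially
  proof (intro allI impI)
    fix X :: "nat \<Rightarrow> real ^ 'n" assume X: "\<forall>n. X n \<in> ball y 1 - {y}" "X \<longlonglongrightarrow> y"
    let ?q = "\<lambda>n z. (G z (X n) - G z y - ?L z (X n - y)) /\<^sub>R norm (X n - y)"
    have ne: "norm (X n - y) > 0" for n using X by auto
    have "(\<lambda>n. (LINT z|M. ?q n z)) \<longlonglongrightarrow> (LINT z|M. 0 :: complex)"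
    \<comment> \<open>One share d * K z bounds the increment, another the linear part.\<close>
    proof (rule integral_dominated_convergence[where w = "\<lambda>z. 2 * ?d * K z"])
      show "(\<lambda>z. ?q n z) \<in> borel_measurable M" for n
        using int[of "X n"] int[of y] iL[of "X n - y"] by measurable
      show "integrable M (\<lambda>z. 2 * ?d * K z)" using K by simp
      show "AE z in M. (\<lambda>n. ?q n z) \<longlonglongrightarrow> 0"
      proof (intro AE_I2)
        fix z
        have "((\<lambda>x. norm (G z x - G z y - ?L z (x - y)) / norm (x - y)) \<longlongrightarrow> 0) (at y)"
          using has_derivative_partial[OF diff[of z y]] unfolding has_derivative_iff_norm by blast
        then have "((\<lambda>x. norm (G z x - G z y - ?L z (x - y)) / norm (x - y)) \<longlongrightarrow> 0) (at y within ball y 1)"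
          by (simp only: at_eq)
        then have "(\<lambda>n. norm (G z (X n) - G z y - ?L z (X n - y)) / norm (X n - y)) \<longlonglongrightarrow> 0"
          unfolding tendsto_at_iff_sequentially using X by (simp add: o_def)
        then have "(\<lambda>n. norm (?q n z)) \<longlonglongrightarrow> 0" by (simp add: divide_inverse mult.commute)
        then show "(\<lambda>n. ?q n z) \<longlonglongrightarrow> 0" by (simp only: tendsto_norm_zero_iff)
      qed
      show "AE z in M. norm (?q n z) \<le> 2 * ?d * K z" for n
      proof (intro AE_I2)
        fix z
        have "norm (G z (X n) - G z y) \<le> ?d * K z * norm (X n - y)"
        proof (rule mean_value_partial[OF diff])
          fix i x assume x: "x \<in> closed_segment y (X n)"
          have "closed_segment y (X n) \<subseteq> ball y 1"
            using X by (intro closed_segment_subset) auto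
          then show "norm (partial i (G z) x) \<le> K z" using x by (intro K) auto
        qed
        moreover have "norm (?L z (X n - y)) \<le> ?d * K z * norm (X n - y)"
        proof -
          have "norm (?L z (X n - y)) \<le> (\<Sum>i\<in>(UNIV :: 'n set). norm (X n - y) * K z)"
            by (intro sum_norm_le) (auto intro!: mult_mono K K0 simp: component_le_norm_cart simp flip: vector_minus_component)
          then show ?thesis by (simp add: mult_ac)
        qed
        ultimately have "norm (G z (X n) - G z y - ?L z (X n - y)) \<le> ?d * K z * norm (X n - y) + ?d * K z * norm (X n - y)"
          by (rule norm_triangle_le_diff[OF add_mono])
        also have "\<dots> = 2 * ?d * K z * norm (X n - y)" by simp
        finally have "norm (G z (X n) - G z y - ?L z (X n - y)) / norm (X n - y) \<le> 2 * ?d * K z"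
          by (subst pos_divide_le_eq[OF ne])
        then show "norm (?q n z) \<le> 2 * ?d * K z" by (simp only: norm_scaleR) (simp add: divide_inverse mult.commute)
      qed
    qed simp
    moreover have "(LINT z|M. ?q n z) = (?F (X n) - ?F y - ?D (X n - y)) /\<^sub>R norm (X n - y)" for n
    proof -
      have "(LINT z|M. G z (X n) - G z y - ?L z (X n - y)) = ?F (X n) - ?F y - ?D (X n - y)"
        unfolding D
        by (subst Bochner_Integration.integral_diff[OF Bochner_Integration.integrable_diff[OF int int] iL],
            subst Bochner_Integration.integral_diff[OF int int]) (rule refl)
      then show ?thesis by (simp only: integral_scaleR_right)
    qed
    ultimately have "(\<lambda>n. (?F (X n) - ?F y - ?D (X n - y)) /\<^sub>R norm (X n - y)) \<longlonglongrightarrow> 0"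
      by (simp only: Bochner_Integration.integral_zero)
    then have "(\<lambda>n. norm ((?F (X n) - ?F y - ?D (X n - y)) /\<^sub>R norm (X n - y))) \<longlonglongrightarrow> 0" by (rule tendsto_norm_zero)
    then show "((\<lambda>x. norm (?F x - ?F y - ?D (x - y)) / norm (x - y)) \<circ> X) \<longlonglongrightarrow> 0"
      by (simp add: o_def divide_inverse mult.commute)
  qed
  then have "((\<lambda>x. norm (?F x - ?F y - ?D (x - y)) / norm (x - y)) \<longlongrightarrow> 0) (at y)"
    by (simp only: at_eq)
  ultimately show ?thesis unfolding has_derivative_iff_norm by blast
qed

text \<open>Iterates \<open>has_derivative_integral\<close> along a word; the summation of
  \<open>K\<close> over the coordinates provides one dominating function for all partial
  derivatives.\<close>

lemma
  fixes G :: "'a \<Rightarrow> real ^ 'n::finite \<Rightarrow> complex"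
  assumes sm: "\<And>z. smooth (G z)"
    and meas: "\<And>w y. (\<lambda>z. derivs w (G z) y) \<in> borel_measurable M"
    and bnd: "\<And>w y. \<exists>K. integrable M K \<and> (\<forall>z. \<forall>x\<in>ball y 1. norm (derivs w (G z) x) \<le> K z)"
  shows derivs_integral: "derivs w (\<lambda>y. (LINT z|M. G z y)) = (\<lambda>y. (LINT z|M. derivs w (G z) y))"
    and smooth_integral: "smooth (\<lambda>y. (LINT z|M. G z y))"
proof -
  have int: "integrable M (\<lambda>z. derivs w (G z) y)" for w y
  proof -
    obtain K where K: "integrable M K" "\<And>z x. x \<in> ball y 1 \<Longrightarrow> norm (derivs w (G z) x) \<le> K z"
      using bnd[of y w] by blast
    show ?thesis
    proof (rule Bochner_Integration.integrable_bound[OF K(1) meas], intro AE_I2)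
      fix z
      have "norm (derivs w (G z) y) \<le> K z" by (rule K) simp
      then show "norm (derivs w (G z) y) \<le> norm (K z)" by simp
    qed
  qed
  have der: "((\<lambda>x. (LINT z|M. derivs w (G z) x)) has_derivative
      (\<lambda>h. \<Sum>i\<in>UNIV. h $ i *\<^sub>R (LINT z|M. partial i (derivs w (G z)) y))) (at y)" for w y
  proof -
    have "\<forall>i. \<exists>K. integrable M K \<and> (\<forall>z. \<forall>x\<in>ball y 1. norm (derivs (i # w) (G z) x) \<le> K z)"
      using bnd by blast
    then obtain K where K: "\<And>i. integrable M (K i)"
      "\<And>i z x. x \<in> ball y 1 \<Longrightarrow> norm (derivs (i # w) (G z) x) \<le> K i z" by metis
    show ?thesis
    proof (rule has_derivative_integral[where K = "\<lambda>z. \<Sum>i\<in>UNIV. norm (K i z)"])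
      show "derivs w (G z) differentiable (at x)" for z x
        by (intro smooth_differentiable smooth_derivs sm)
      show "(\<lambda>z. partial i (derivs w (G z)) y) \<in> borel_measurable M" for i
        using meas[of "i # w" y] by simp
      show "integrable M (\<lambda>z. \<Sum>i\<in>UNIV. norm (K i z))" using K by simp
      show "norm (partial i (derivs w (G z)) x) \<le> (\<Sum>i\<in>UNIV. norm (K i z))" if x: "x \<in> ball y 1" for z x i
      proof -
        have "norm (partial i (derivs w (G z)) x) \<le> norm (K i z)"
          using K(2)[OF x, of i z] by simp
        also have "\<dots> \<le> (\<Sum>i\<in>UNIV. norm (K i z))" by (rule member_le_sum) auto
        finally show ?thesis .
      qed
    qed (rule int)
  qed
  have eq: "derivs w (\<lambda>y. (LINT z|M. G z y)) = (\<lambda>y. (LINT z|M. derivs w (G z) y))" for w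
  proof (induction w)
    case (Cons i w)
    have "partial i (\<lambda>y. (LINT z|M. derivs w (G z) y)) y = (LINT z|M. derivs (i # w) (G z) y)" for y
      unfolding partial_eqI[OF der] by (simp add: axis_def if_distrib[of "\<lambda>c. c *\<^sub>R _"] cong: if_cong)
    then show ?case using Cons by auto
  qed simp
  then show "derivs w (\<lambda>y. (LINT z|M. G z y)) = (\<lambda>y. (LINT z|M. derivs w (G z) y))" .
  show "smooth (\<lambda>y. (LINT z|M. G z y))"
    unfolding smooth_def eq using der by (auto simp: differentiable_def)
qed

text \<open>These are the multipliers of the Schwartz space, and the Schwartz space itself.\<close>

definition slow :: "(real ^ 'n::finite \<Rightarrow> complex) \<Rightarrow> bool" where
  "slow f \<longleftrightarrow> smooth f \<and> (\<forall>k. \<exists>N C. \<forall>y. dmax k f y \<le> C * (1 + norm y ^ 2) ^ N)"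

definition rapid :: "(real ^ 'n::finite \<Rightarrow> complex) \<Rightarrow> bool" where
  "rapid f \<longleftrightarrow> smooth f \<and> (\<forall>k N. \<exists>C. \<forall>y. (1 + norm y ^ 2) ^ N * dmax k f y \<le> C)"

lemma rapid_smooth: "rapid f \<Longrightarrow> smooth f"
  by (simp add: rapid_def)

lemma rapid_slow: 
  assumes "rapid f" shows "slow f"
  unfolding slow_def
proof (intro conjI allI rapid_smooth assms)
  fix k
  obtain C where "\<And>y. (1 + norm y ^ 2) ^ 0 * dmax k f y \<le> C"
    using assms unfolding rapid_def by meson
  then show "\<exists>N C. \<forall>y. dmax k f y \<le> C * (1 + norm y ^ 2) ^ N"
    by (intro exI[of _ 0] exI[of _ C]) auto
qed

lemma rapid_bound:
  fixes f :: "real ^ 'n::finite \<Rightarrow> complex"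
  assumes "rapid f"
  shows "\<exists>C\<ge>0. \<forall>y. (1 + norm y ^ 2) ^ N * norm (derivs w f y) \<le> C"
proof -
  obtain C where C: "\<And>y. (1 + norm y ^ 2) ^ N * dmax (length w) f y \<le> C"
    using assms unfolding rapid_def by meson
  have "(1 + norm y ^ 2) ^ N * norm (derivs w f y) \<le> C" for y
    by (rule order_trans[OF mult_left_mono[OF norm_derivs_le_dmax] C]) simp
  moreover from this[of 0] have "C \<ge> 0" by (rule order_trans[rotated]) simp
  ultimately show ?thesis by blast
qed

lemma rapid_bound_jw:
  fixes f :: "real ^ 'n::finite \<Rightarrow> complex"
  assumes "rapid f"
  shows "\<exists>C\<ge>0. \<forall>y. norm (derivs w f y) \<le> C * jw y"
proof -
  obtain C where C: "C \<ge> 0" "\<And>y. (1 + norm y ^ 2) ^ CARD('n) * norm (derivs w f y) \<le> C"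
    using rapid_bound[OF assms] by blast
  have "norm (derivs w f y) \<le> C * jw y" for y
  proof -
    have "(1 + norm y ^ 2) ^ CARD('n) > 0" by (simp add: add_pos_nonneg)
    then show ?thesis using C(2)[of y] by (simp add: jw_def field_simps)
  qed
  then show ?thesis using C by blast
qed

lemma rapid_integrable_derivs:
  fixes f :: "real ^ 'n::finite \<Rightarrow> complex"
  assumes "rapid f" shows "integrable lborel (derivs w f)"
proof -
  obtain C where C: "C \<ge> 0" "\<And>y. norm (derivs w f y) \<le> C * jw y" using rapid_bound_jw[OF assms] by blast
  have "integrable lborel (\<lambda>y :: real ^ 'n. C * jw y)" by (intro integrable_mult_right integrable_jw)
  then show ?thesis
    by (rule Bochner_Integration.integrable_bound)
       (use smooth_measurable[OF smooth_derivs[OF rapid_smooth[OF assms]]] C in \<open>auto intro!: AE_I2 order_trans[OF C(2) abs_ge_self]\<close>)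
qed

lemma rapid_integrable: "rapid f \<Longrightarrow> integrable lborel f"
  using rapid_integrable_derivs[of f "[]"] by simp

text \<open>The growth exponent M k of a may depend on the order of the derivative, but b decays
  against every power, so N + M k is requested from it.\<close>

lemma rapid_slow_mult:
  fixes a b :: "real ^ 'n::finite \<Rightarrow> complex"
  assumes a: "slow a" and b: "rapid b"
  shows "rapid (\<lambda>y. a y * b y)"
proof -
  have sm: "smooth a" "smooth b" using assms by (auto simp: slow_def rapid_def)
  have "\<exists>C. \<forall>y. (1 + norm y ^ 2) ^ N * dmax n (\<lambda>y. a y * b y) y \<le> C" for n N
  proof -
    have "\<forall>k. \<exists>M C. \<forall>y. dmax k a y \<le> C * (1 + norm y ^ 2) ^ M" using a by (auto simp: slow_def)
    then obtain M A where A: "\<And>k y. dmax k a y \<le> A k * (1 + norm y ^ 2) ^ M k" by metis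
    have "\<forall>k N. \<exists>C. \<forall>y. (1 + norm y ^ 2) ^ N * dmax k b y \<le> C" using b by (auto simp: rapid_def)
    then obtain B where B: "\<And>k N y. (1 + norm y ^ 2) ^ N * dmax k b y \<le> B k N" by metis
    have A0: "A k \<ge> 0" for k
      using order_trans[OF dmax_nonneg A[of k 0]] by simp
    have "(1 + norm y ^ 2) ^ N * dmax n (\<lambda>y. a y * b y) y \<le>
        (\<Sum>k\<le>n. real (n choose k) * (A k * B (n - k) (N + M k)))" for y
    proof -
      let ?p = "1 + norm y ^ 2"
      obtain w where w: "length w = n" "dmax n (\<lambda>y. a y * b y) y = norm (derivs w (\<lambda>y. a y * b y) y)"
        using dmax_attained by blast
      have "?p ^ N * dmax n (\<lambda>y. a y * b y) y \<le> ?p ^ N * (\<Sum>k\<le>n. real (n choose k) * (dmax k a y * dmax (n - k) b y))"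
        unfolding w(2) unfolding w(1)[symmetric]
        by (intro mult_left_mono derivs_mult_bound sm norm_derivs_le_dmax) auto
      also have "\<dots> = (\<Sum>k\<le>n. real (n choose k) * (dmax k a y * (?p ^ N * dmax (n - k) b y)))"
        by (simp add: sum_distrib_left mult_ac)
      also have "\<dots> \<le> (\<Sum>k\<le>n. real (n choose k) * (A k * B (n - k) (N + M k)))"
      proof (intro sum_mono mult_left_mono)
        fix k
        have "dmax k a y * (?p ^ N * dmax (n - k) b y) \<le> (A k * ?p ^ M k) * (?p ^ N * dmax (n - k) b y)"
          by (intro mult_right_mono A mult_nonneg_nonneg dmax_nonneg) auto
        also have "\<dots> = A k * (?p ^ (N + M k) * dmax (n - k) b y)" by (simp add: power_add mult_ac)
        also have "\<dots> \<le> A k * B (n - k) (N + M k)" by (intro mult_left_mono A0 B)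
        finally show "dmax k a y * (?p ^ N * dmax (n - k) b y) \<le> A k * B (n - k) (N + M k)" .
      qed auto
      finally show ?thesis .
    qed
    then show ?thesis by blast
  qed
  then show ?thesis using sm smooth_mult by (auto simp: rapid_def)
qed

lemma dmax_le: "(\<And>v. length v = k \<Longrightarrow> norm (derivs v f y) \<le> B) \<Longrightarrow> dmax k f y \<le> B"
  using dmax_attained[of k f y] by auto

lemma slow_plane_wave: "slow (\<lambda>y. exp (\<i> * complex_of_real (y \<bullet> \<xi>)))"
  unfolding slow_def
proof (intro conjI allI)
  show "smooth (\<lambda>y. exp (\<i> * complex_of_real (y \<bullet> \<xi>)))" using smooth_exp[of 1 \<xi>] by simp
  fix k
  have "dmax k (\<lambda>y. exp (\<i> * complex_of_real (y \<bullet> \<xi>))) y \<le> norm \<xi> ^ k * (1 + norm y ^ 2) ^ 0" for y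
    by (intro dmax_le) (metis norm_derivs_exp_le mult.right_neutral power_0)
  then show "\<exists>N C. \<forall>y. dmax k (\<lambda>y. exp (\<i> * complex_of_real (y \<bullet> \<xi>))) y \<le> C * (1 + norm y ^ 2) ^ N"
    by blast
qed

section \<open>The Fourier transform\<close>

lemma gs_space_rapid:
  fixes f :: "real ^ 'n::finite \<Rightarrow> complex"
  assumes "t > 0" "s > 0" "f \<in> gs_space t s"
  shows "rapid f"
  unfolding rapid_def
proof (intro conjI allI)
  show "smooth f" using assms(3) by (rule gs_space_smooth)
  fix k N
  obtain C where "\<And>m k y. (1 + norm y ^ 2) ^ N * (norm y ^ m * dmax k f y) \<le> C * 1 ^ (m + k) * fact m powr t * fact k powr s"
    using gs_space_weighted[OF assms zero_less_one, of N] by blast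
  from this[of _ 0 k] show "\<exists>C. \<forall>y. (1 + norm y ^ 2) ^ N * dmax k f y \<le> C"
    by (intro exI[of _ "C * fact k powr s"]) simp
qed

lemma rapid_partial:
  fixes f :: "real ^ 'n::finite \<Rightarrow> complex"
  assumes "rapid f" shows "rapid (partial i f)"
proof -
  have "dmax k (partial i f) y \<le> dmax (Suc k) f y" for k y
  proof (rule dmax_le)
    fix v :: "'n list" assume "length v = k"
    then show "norm (derivs v (partial i f) y) \<le> dmax (Suc k) f y"
      using norm_derivs_le_dmax[of "v @ [i]" f y] by simp
  qed
  then have "(1 + norm y ^ 2) ^ N * dmax k (partial i f) y \<le> (1 + norm y ^ 2) ^ N * dmax (Suc k) f y" for N k y
    by (intro mult_left_mono) auto
  then show ?thesis
    using assms unfolding rapid_def by (meson order_trans smooth_partial)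
qed

lemma rapid_derivs: "rapid f \<Longrightarrow> rapid (derivs w f)"
  by (induction w) (auto intro: rapid_partial)

section \<open>Affine substitution and integration by parts\<close>

lemma
  fixes f :: "'a::euclidean_space \<Rightarrow> 'b::{banach, second_countable_topology}"
  assumes f: "integrable lborel f" and c: "c \<noteq> 0"
  shows lborel_integrable_affine: "integrable lborel (\<lambda>x. f (t + c *\<^sub>R x))" (is ?A)
    and lborel_integral_affine: "(LINT x|lborel. f x) = \<bar>c\<bar> ^ DIM('a) *\<^sub>R (LINT x|lborel. f (t + c *\<^sub>R x))" (is ?B)
proof -
  have [measurable]: "f \<in> borel_measurable borel" using borel_measurable_integrable[OF f] by simp
  let ?T = "\<lambda>x. t + c *\<^sub>R x"
  have "integrable (density (distr lborel borel ?T) (\<lambda>_. ennreal (\<bar>c\<bar> ^ DIM('a)))) f"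
    using f lborel_affine[OF c, of t] by simp
  then have "integrable (distr lborel borel ?T) (\<lambda>x. \<bar>c\<bar> ^ DIM('a) *\<^sub>R f x)"
    by (subst (asm) integrable_density) auto
  then have "integrable (distr lborel borel ?T) (\<lambda>x. inverse (\<bar>c\<bar> ^ DIM('a)) *\<^sub>R \<bar>c\<bar> ^ DIM('a) *\<^sub>R f x)"
    by (rule integrable_scaleR_right)
  then have "integrable (distr lborel borel ?T) f" using c by simp
  then show ?A by (subst (asm) integrable_distr_eq) auto
  have "(LINT x|lborel. f x) = (LINT x|density (distr lborel borel ?T) (\<lambda>_. ennreal (\<bar>c\<bar> ^ DIM('a))). f x)"
    using lborel_affine[OF c, of t] by simp
  also have "\<dots> = (LINT x|distr lborel borel ?T. \<bar>c\<bar> ^ DIM('a) *\<^sub>R f x)"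
    by (subst integral_density) auto
  also have "\<dots> = \<bar>c\<bar> ^ DIM('a) *\<^sub>R (LINT x|lborel. f (?T x))"
    by (subst integral_distr) auto
  finally show ?B .
qed

text \<open>From norm z \<le> norm (x + z) + 1 one gets 1 + norm z^2 \<le> 3 * (1 + norm (x + z)^2).
  This provides domination uniform over the unit ball.\<close>

lemma jw_translate_le:
  fixes x z :: "'a::euclidean_space"
  assumes "norm x \<le> 1"
  shows "jw (x + z) \<le> 3 ^ DIM('a) * jw z"
proof -
  have "norm z \<le> norm (x + z) + 1" using norm_triangle_ineq4[of "x + z" x] assms by simp
  then have "norm z ^ 2 \<le> (norm (x + z) + 1) ^ 2" by (intro power_mono) auto
  also have "\<dots> \<le> 2 * norm (x + z) ^ 2 + 2" using sum_squares_bound[of "norm (x + z)" 1] by (simp add: power2_sum)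
  finally have "1 + norm z ^ 2 \<le> 3 * (1 + norm (x + z) ^ 2)" using zero_le_power2[of "norm (x + z)"] by argo
  then have "(1 + norm z ^ 2) ^ DIM('a) \<le> (3 * (1 + norm (x + z) ^ 2)) ^ DIM('a)" by (intro power_mono) auto
  then have le: "(1 + norm z ^ 2) ^ DIM('a) \<le> 3 ^ DIM('a) * (1 + norm (x + z) ^ 2) ^ DIM('a)"
    unfolding power_mult_distrib .
  have inv: "inverse A \<le> K * inverse B" if "B \<le> K * A" "A > 0" "B > 0" for A B K :: real
    using that by (simp add: field_simps)
  show ?thesis
    unfolding jw_def by (rule inv[OF le]) (auto intro!: zero_less_power add_pos_nonneg)
qed

text \<open>The integral of z \<mapsto> g (x + z) does not depend on x; differentiating it under the
  integral at x = 0 gives the claim without boundary terms.\<close>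

lemma integral_partial_eq_0:
  fixes g :: "real ^ 'n::finite \<Rightarrow> complex"
  assumes g: "rapid g"
  shows "(LINT x|lborel. partial i g x) = 0"
proof -
  let ?G = "\<lambda>z. translate (- z) g"
  have sm: "smooth g" using g by (rule rapid_smooth)
  have "\<forall>i. \<exists>C\<ge>0. \<forall>y. norm (derivs [i] g y) \<le> C * jw y" using rapid_bound_jw[OF g] by blast
  then obtain C where C: "\<And>i. C i \<ge> 0" "\<And>i y. norm (partial i g y) \<le> C i * jw y"
    by simp metis
  have tr: "translate (- z) f x = f (x + z)" for z x :: "real ^ 'n" and f :: "real ^ 'n \<Rightarrow> complex" by (simp add: translate_def)
  have "((\<lambda>x. (LINT z|lborel. ?G z x)) has_derivative (\<lambda>h. \<Sum>i\<in>UNIV. h $ i *\<^sub>R (LINT z|lborel. partial i (?G z) 0))) (at 0)"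
  proof (rule has_derivative_integral[where K = "\<lambda>z. (\<Sum>i\<in>UNIV. C i) * (3 ^ CARD('n) * jw z)"])
    show "?G z differentiable at x" for z x by (intro smooth_differentiable smooth_translate sm)
    show "integrable lborel (\<lambda>z. ?G z x)" for x
      using lborel_integrable_affine[OF rapid_integrable[OF g], of 1 x] by (simp add: tr)
    show "(\<lambda>z. partial i (?G z) 0) \<in> borel_measurable lborel" for i
      using smooth_measurable[OF smooth_partial[OF sm]]
      by (simp add: partial_translate smooth_differentiable sm tr)
    show "integrable lborel (\<lambda>z :: real ^ 'n. (\<Sum>i\<in>UNIV. C i) * (3 ^ CARD('n) * jw z))"
      by (intro integrable_mult_right integrable_jw)
    fix z x i assume x: "x \<in> ball (0 :: real ^ 'n) 1"
    have "norm (partial i (?G z) x) \<le> C i * jw (x + z)"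
      using C(2) by (simp add: partial_translate smooth_differentiable sm tr)
    also have "\<dots> \<le> C i * (3 ^ CARD('n) * jw z)"
      using jw_translate_le[of x z] x by (intro mult_left_mono C) auto
    also have "\<dots> \<le> (\<Sum>i\<in>UNIV. C i) * (3 ^ CARD('n) * jw z)"
      using jw_pos[of z] C by (intro mult_right_mono member_le_sum) auto
    finally show "norm (partial i (?G z) x) \<le> (\<Sum>i\<in>UNIV. C i) * (3 ^ CARD('n) * jw z)" .
  qed
  from partial_eqI[OF this, of i]
  have "partial i (\<lambda>x. (LINT z|lborel. ?G z x)) 0 = (LINT z|lborel. partial i (?G z) 0)"
    by (simp add: axis_def if_distrib[of "\<lambda>c. c *\<^sub>R _"] cong: if_cong)
  also have "(\<lambda>x. (LINT z|lborel. ?G z x)) = (\<lambda>x. (LINT z|lborel. g z))"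
    using lborel_integral_affine[OF rapid_integrable[OF g], of 1] by (auto simp: tr)
  also have "(\<lambda>z. partial i (?G z) 0) = partial i g"
    by (rule ext, subst partial_translate) (simp_all add: smooth_differentiable sm, simp add: translate_def)
  finally show ?thesis by (simp add: partial_const)
qed

definition cd :: "'n::finite itself \<Rightarrow> real" where
  "cd _ = (2 * pi) powr (- real CARD('n) / 2)"

lemma cd_pos: "cd TYPE('n::finite) > 0"
  by (simp add: cd_def)

abbreviation wave :: "real ^ 'n \<Rightarrow> real ^ 'n::finite \<Rightarrow> complex" where
  "wave \<xi> y \<equiv> exp (\<i> * complex_of_real (y \<bullet> \<xi>))"

lemma fourier_eq:
  "fourier f \<xi> = of_real (cd TYPE('n::finite)) * (LINT x|lborel. wave (- \<xi>) x * f x)"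
  for \<xi> :: "real ^ 'n"
  by (simp add: fourier_def cd_def mult.commute)

lemma rapid_wave_mult: "rapid f \<Longrightarrow> rapid (\<lambda>y. wave \<xi> y * f y)"
  by (intro rapid_slow_mult slow_plane_wave)

text \<open>Integration by parts: \<open>integral_partial_eq_0\<close> for the product of g with the
  wave.\<close>

lemma fourier_partial:
  fixes g :: "real ^ 'n::finite \<Rightarrow> complex"
  assumes g: "rapid g"
  shows "fourier (partial i g) \<xi> = \<i> * of_real (\<xi> $ i) * fourier g \<xi>"
proof -
  let ?e = "wave (- \<xi>)"
  have sm: "smooth g" "smooth ?e" using rapid_smooth[OF g] smooth_exp[of 1 "- \<xi>"] by auto
  have int: "integrable lborel (\<lambda>y. ?e y * g y)" "integrable lborel (\<lambda>y. ?e y * partial i g y)"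
    by (intro rapid_integrable rapid_wave_mult g rapid_partial)+
  have "partial i ?e = (\<lambda>y. - \<i> * of_real (\<xi> $ i) * ?e y)"
    using partial_exp[of i 1 "- \<xi>"] by simp
  then have "partial i (\<lambda>y. ?e y * g y) = (\<lambda>y. - \<i> * of_real (\<xi> $ i) * (?e y * g y) + ?e y * partial i g y)"
    using sm by (simp add: partial_mult smooth_differentiable mult.assoc)
  then have "0 = (LINT y|lborel. - \<i> * of_real (\<xi> $ i) * (?e y * g y) + ?e y * partial i g y)"
    using integral_partial_eq_0[OF rapid_wave_mult[OF g, of "- \<xi>"], of i] by simp
  also have "\<dots> = - \<i> * of_real (\<xi> $ i) * (LINT y|lborel. ?e y * g y) + (LINT y|lborel. ?e y * partial i g y)"
    by (subst Bochner_Integration.integral_add) (use int in \<open>auto simp del: mult_minus_left\<close>)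
  finally have "(LINT y|lborel. ?e y * partial i g y) = \<i> * of_real (\<xi> $ i) * (LINT y|lborel. ?e y * g y)" by simp
  then show ?thesis by (simp add: fourier_eq)
qed

lemma fourier_derivs_replicate:
  fixes g :: "real ^ 'n::finite \<Rightarrow> complex"
  assumes g: "rapid g"
  shows "fourier (derivs (replicate m i) g) \<xi> = (\<i> * of_real (\<xi> $ i)) ^ m * fourier g \<xi>"
proof (induction m)
  case (Suc m)
  then show ?case using fourier_partial[OF rapid_derivs[OF g], of i "replicate m i" \<xi>] by simp
qed simp

definition J0 :: "'n::finite itself \<Rightarrow> real" where
  "J0 _ = cd TYPE('n) * (LINT x|lborel. jw (x :: real ^ 'n))"

lemma J0_nonneg: "J0 TYPE('n::finite) \<ge> 0"
  unfolding J0_def using cd_pos[where 'n = 'n]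
  by (intro mult_nonneg_nonneg Bochner_Integration.integral_nonneg less_imp_le[OF jw_pos]) auto

lemma norm_fourier_le:
  fixes g :: "real ^ 'n::finite \<Rightarrow> complex"
  assumes "\<And>y. norm (g y) \<le> B * jw y"
  shows "norm (fourier g \<xi>) \<le> B * J0 TYPE('n)"
proof -
  have B: "B \<ge> 0"
    using order_trans[OF norm_ge_zero assms[of 0]] jw_pos[of "0 :: real ^ 'n"] by (simp add: zero_le_mult_iff)
  have "norm (LINT x|lborel. wave (- \<xi>) x * g x) \<le> (LINT x|lborel. norm (wave (- \<xi>) x * g x))"
    by (rule integral_norm_bound)
  also have "\<dots> \<le> (LINT x|lborel. B * jw (x :: real ^ 'n))"
    using assms B jw_pos by (intro integral_mono' integrable_mult_right integrable_jw)
      (auto simp: norm_mult intro: mult_nonneg_nonneg[OF B less_imp_le[OF jw_pos]])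
  finally have "norm (LINT x|lborel. wave (- \<xi>) x * g x) \<le> B * (LINT x|lborel. jw (x :: real ^ 'n))" by simp
  then show ?thesis
    using cd_pos[where 'n = 'n] by (simp add: fourier_eq norm_mult J0_def mult_left_mono mult.left_commute)
qed

lemma rapid_measurable: "rapid f \<Longrightarrow> f \<in> borel_measurable borel"
  using rapid_smooth smooth_measurable by blast

text \<open>The power of norm \<xi> is replaced by a power of its dominant coordinate, which
  corresponds to an iterated derivative in that single direction.\<close>

lemma fourier_moment_le:
  fixes g :: "real ^ 'n::finite \<Rightarrow> complex"
  assumes g: "rapid g" and B: "\<And>v y. length v = m \<Longrightarrow> norm (derivs v g y) \<le> B * jw y"
  shows "norm \<xi> ^ m * norm (fourier g \<xi>) \<le> real CARD('n) ^ m * (B * J0 TYPE('n))"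
proof -
  obtain i where i: "norm \<xi> \<le> real CARD('n) * \<bar>\<xi> $ i\<bar>" using exists_coordinate by blast
  have "norm \<xi> ^ m * norm (fourier g \<xi>) \<le> (real CARD('n) * \<bar>\<xi> $ i\<bar>) ^ m * norm (fourier g \<xi>)"
    using i by (intro mult_right_mono power_mono) auto
  also have "\<dots> = real CARD('n) ^ m * norm (fourier (derivs (replicate m i) g) \<xi>)"
    unfolding fourier_derivs_replicate[OF g] by (simp add: norm_mult norm_power power_mult_distrib)
  also have "\<dots> \<le> real CARD('n) ^ m * (B * J0 TYPE('n))"
    by (intro mult_left_mono norm_fourier_le B) auto
  finally show ?thesis .
qed

text \<open>Monomials are indexed by words so that they match derivatives of a Fourier transform
  letter by letter.\<close>

definition mon :: "'n::finite list \<Rightarrow> real ^ 'n \<Rightarrow> complex" where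
  "mon w y = (\<Prod>j\<leftarrow>w. complex_of_real (y $ j))"

lemma mon_Nil: "mon [] = (\<lambda>y. 1)" and mon_Cons: "mon (j # w) = (\<lambda>y. of_real (y $ j) * mon w y)"
  by (auto simp: mon_def)

lemma smooth_mon: "smooth (mon w)"
  by (induction w) (auto simp: mon_Nil mon_Cons intro: smooth_const smooth_mult smooth_coordinate)

text \<open>The factor is the falling factorial n! / (n-k)!; it is written with a binomial
  coefficient so that it vanishes when the word v is longer than w and the truncated exponent is
  meaningless.\<close>

lemma norm_derivs_mon_le:
  fixes v w :: "'n::finite list"
  shows "norm (derivs v (mon w) y) \<le> real (length w choose length v) * fact (length v) * norm y ^ (length w - length v)"
proof (induction w arbitrary: v)
  case Nil
  show ?case
  proof (cases v rule: rev_cases)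
    case (snoc v' i)
    then show ?thesis by (simp add: mon_Nil partial_const derivs_const_0)
  qed (simp add: mon_Nil)
next
  case (Cons j w)
  let ?n = "length w" and ?k = "length v"
  let ?A = "\<lambda>k :: nat. if k = 0 then norm y else if k = 1 then 1 else 0"
  let ?B = "\<lambda>k. real (?n choose k) * fact k * norm y ^ (?n - k)"
  have A: "norm (derivs u (\<lambda>y. complex_of_real (y $ j)) y) \<le> ?A (length u)" for u :: "'n list"
  proof (cases u rule: rev_cases)
    case (snoc u' i)
    show ?thesis
    proof (cases u' rule: rev_cases)
      case (snoc u'' i')
      have "partial i' (\<lambda>y. if i = j then 1 else 0) = (\<lambda>y :: real ^ 'n. 0)"
        using partial_const[of i' "if i = j then 1 else 0"] by simp
      then show ?thesis using \<open>u = u' @ [i]\<close> snoc by (simp add: partial_coordinate derivs_const_0)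
    qed (use \<open>u = u' @ [i]\<close> in \<open>simp add: partial_coordinate\<close>)
  qed (simp add: component_le_norm_cart)
  have "norm (derivs v (mon (j # w)) y) \<le> (\<Sum>k\<le>?k. real (?k choose k) * (?A k * ?B (?k - k)))"
    unfolding mon_Cons by (intro derivs_mult_bound smooth_coordinate smooth_mon A Cons)
  \<comment> \<open>A coordinate function has no derivatives beyond the first, so at most two
    Leibniz terms survive, and only one if v is empty.\<close>
  also have "\<dots> = (\<Sum>k\<in>({0, 1} \<inter> {..?k}). real (?k choose k) * (?A k * ?B (?k - k)))"
    by (rule sum.mono_neutral_right) auto
  also have "\<dots> = real (Suc ?n choose ?k) * fact ?k * norm y ^ (Suc ?n - ?k)"
  proof (cases ?k)
    case 0
    then have "{0, 1} \<inter> {..?k} = {0}" by auto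
    then show ?thesis using 0 by simp
  next
    case (Suc k)
    then have "{0, 1} \<inter> {..?k} = {0, 1}" by auto
    then have "(\<Sum>k\<in>({0, 1} \<inter> {..?k}). real (?k choose k) * (?A k * ?B (?k - k))) =
        fact (Suc k) * (real (?n choose Suc k) * (norm y * norm y ^ (?n - Suc k))) +
        (real (Suc k) * fact k) * (real (?n choose k) * norm y ^ (?n - k))"
      using Suc by (simp add: mult_ac del: fact_Suc of_nat_Suc)
    also have "real (?n choose Suc k) * (norm y * norm y ^ (?n - Suc k)) = real (?n choose Suc k) * norm y ^ (?n - k)"
    proof (cases "Suc k \<le> ?n")
      case True
      then show ?thesis by (metis Suc_diff_Suc less_eq_Suc_le power_Suc)
    qed (simp add: binomial_eq_0)
    also have "real (Suc k) * fact k = fact (Suc k)" by (simp only: fact_Suc)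
    also have "fact (Suc k) * (real (?n choose Suc k) * norm y ^ (?n - k)) + fact (Suc k) * (real (?n choose k) * norm y ^ (?n - k)) =
        real (Suc ?n choose ?k) * fact ?k * norm y ^ (Suc ?n - ?k)"
      using Suc by (simp add: algebra_simps del: fact_Suc)
    finally show ?thesis .
  qed
  finally show ?case by simp
qed

lemma slow_mon: "slow (mon w)"
  unfolding slow_def
proof (intro conjI allI smooth_mon)
  fix k
  let ?n = "length w"
  have "dmax k (mon w) y \<le> (real (?n choose k) * fact k) * (1 + norm y ^ 2) ^ ?n" for y
  proof (rule dmax_le)
    fix v :: "'a list" assume v: "length v = k"
    have "norm y \<le> 1 + norm y ^ 2"
      using sum_squares_bound[of "norm y" 1] norm_ge_zero[of y] unfolding one_power2 by linarith
    then have "norm y ^ (?n - k) \<le> (1 + norm y ^ 2) ^ (?n - k)" by (intro power_mono) auto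
    also have "\<dots> \<le> (1 + norm y ^ 2) ^ ?n" by (intro power_increasing) auto
    finally have "(real (?n choose k) * fact k) * norm y ^ (?n - k) \<le> (real (?n choose k) * fact k) * (1 + norm y ^ 2) ^ ?n"
      by (intro mult_left_mono) auto
    with norm_derivs_mon_le[of v w y] v
    show "norm (derivs v (mon w) y) \<le> (real (?n choose k) * fact k) * (1 + norm y ^ 2) ^ ?n" by simp
  qed
  then show "\<exists>N C. \<forall>y. dmax k (mon w) y \<le> C * (1 + norm y ^ 2) ^ N" by blast
qed

lemma rapid_mon_mult: "rapid g \<Longrightarrow> rapid (\<lambda>y. mon w y * g y)"
  by (intro rapid_slow_mult slow_mon)

lemma
  fixes g :: "real ^ 'n::finite \<Rightarrow> complex"
  assumes g: "rapid g"
  shows smooth_fourier: "smooth (fourier g)"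
    and derivs_fourier: "derivs w (fourier g) \<xi> = (- \<i>) ^ length w * fourier (\<lambda>y. mon w y * g y) \<xi>"
proof -
  let ?G = "\<lambda>x \<xi>. g x * wave (- x) \<xi>"
  have sm: "smooth (wave (- x))" for x :: "real ^ 'n" using smooth_exp[of 1 "- x"] by simp
  have pr: "(\<Prod>j\<leftarrow>w. \<i> * complex_of_real ((- x) $ j)) = (- \<i>) ^ length w * mon w x" for w and x :: "real ^ 'n"
    by (induction w) (auto simp: mon_def)
  have dG: "derivs w (?G x) \<xi> = (- \<i>) ^ length w * (wave (- \<xi>) x * (mon w x * g x))" for w x \<xi>
    unfolding derivs_cmult[OF sm] derivs_exp pr by (simp add: inner_commute mult_ac)
  have smG: "smooth (?G x)" for x by (intro smooth_cmult sm)
  have meas: "(\<lambda>x. derivs w (?G x) \<xi>) \<in> borel_measurable lborel" for w \<xi>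
    unfolding dG using rapid_measurable[OF rapid_wave_mult[OF rapid_mon_mult[OF g]], of "- \<xi>" w] by simp
  have bnd: "\<exists>K. integrable lborel K \<and> (\<forall>x. \<forall>\<eta>\<in>ball \<xi> 1. norm (derivs w (?G x) \<eta>) \<le> K x)" for w and \<xi> :: "real ^ 'n"
  proof (intro exI[of _ "\<lambda>x. norm (mon w x * g x)"] conjI)
    show "integrable lborel (\<lambda>x. norm (mon w x * g x))"
      by (intro integrable_norm rapid_integrable rapid_mon_mult g)
  qed (unfold dG, auto simp: norm_mult norm_power)
  have eq: "fourier g = (\<lambda>\<xi>. of_real (cd TYPE('n)) * (LINT x|lborel. ?G x \<xi>))"
    by (auto simp: fourier_eq inner_commute mult.commute)
  have smI: "smooth (\<lambda>\<xi>. (LINT x|lborel. ?G x \<xi>))"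
    by (rule smooth_integral[OF smG meas bnd])
  then show "smooth (fourier g)" unfolding eq by (rule smooth_cmult)
  show "derivs w (fourier g) \<xi> = (- \<i>) ^ length w * fourier (\<lambda>y. mon w y * g y) \<xi>"
    unfolding eq derivs_cmult[OF smI] derivs_integral[OF smG meas bnd] dG by (simp add: fourier_eq)
qed

text \<open>Derivatives turn into monomial multipliers and powers of \<xi> into derivatives; both
  operations preserve rapid decay. In particular the transform is integrable and may be transformed
  again.\<close>

lemma rapid_fourier:
  fixes g :: "real ^ 'n::finite \<Rightarrow> complex"
  assumes g: "rapid g"
  shows "rapid (fourier g)"
  unfolding rapid_def
proof (intro conjI allI smooth_fourier g)
  fix k N
  have "\<exists>C. \<forall>\<xi>. norm \<xi> ^ m * norm (fourier G \<xi>) \<le> C" if G: "rapid G" for m and G :: "real ^ 'n \<Rightarrow> complex"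
  proof -
    have "\<forall>v. \<exists>C\<ge>0. \<forall>y. norm (derivs v G y) \<le> C * jw y" using rapid_bound_jw[OF G] by blast
    then obtain C where C: "\<And>v. C v \<ge> 0" "\<And>v y. norm (derivs v G y) \<le> C v * jw y" by metis
    have "norm (derivs v G y) \<le> (\<Sum>v | length v = m. C v) * jw y" if "length v = m" for v y
    proof -
      have "C v \<le> (\<Sum>v | length v = m. C v)" using that C by (intro member_le_sum finite_words) auto
      then show ?thesis using C(2)[of v y] jw_pos[of y] by (meson less_imp_le mult_right_mono order_trans)
    qed
    from fourier_moment_le[OF G this] show ?thesis by blast
  qed
  then have "\<forall>w m. \<exists>C. \<forall>\<xi>. norm \<xi> ^ m * norm (fourier (\<lambda>y. mon w y * g y) \<xi>) \<le> C"
    using rapid_mon_mult[OF g] by blast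
  then obtain C where "\<And>w m \<xi>. norm \<xi> ^ m * norm (fourier (\<lambda>y. mon w y * g y) \<xi>) \<le> C w m" by metis
  then have C: "norm \<xi> ^ m * norm (derivs w (fourier g) \<xi>) \<le> C w m" for w m \<xi>
    unfolding derivs_fourier[OF g] by (simp add: norm_mult norm_power)
  let ?S = "{v :: 'n list. length v = k}"
  have "(1 + norm \<xi> ^ 2) ^ N * dmax k (fourier g) \<xi> \<le> (\<Sum>w\<in>?S. \<bar>2 ^ N * (C w 0 + C w (2 * N))\<bar>)" for \<xi>
  proof -
    obtain w where w: "length w = k" "dmax k (fourier g) \<xi> = norm (derivs w (fourier g) \<xi>)"
      using dmax_attained by blast
    have "(1 + norm \<xi> ^ 2) ^ N \<le> 2 ^ N * (1 + norm \<xi> ^ (2 * N))"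
      using add_power_le[of 1 "norm \<xi> ^ 2" N] by (simp add: power_mult)
    then have "(1 + norm \<xi> ^ 2) ^ N * dmax k (fourier g) \<xi> \<le> 2 ^ N * (1 + norm \<xi> ^ (2 * N)) * norm (derivs w (fourier g) \<xi>)"
      unfolding w by (intro mult_right_mono) auto
    also have "\<dots> = 2 ^ N * (norm \<xi> ^ 0 * norm (derivs w (fourier g) \<xi>) + norm \<xi> ^ (2 * N) * norm (derivs w (fourier g) \<xi>))"
      by (simp add: algebra_simps)
    also have "\<dots> \<le> 2 ^ N * (C w 0 + C w (2 * N))"
      by (intro mult_left_mono add_mono C) auto
    also have "\<dots> \<le> \<bar>2 ^ N * (C w 0 + C w (2 * N))\<bar>" by simp
    also have "\<dots> \<le> (\<Sum>w\<in>?S. \<bar>2 ^ N * (C w 0 + C w (2 * N))\<bar>)"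
      using w by (intro member_le_sum finite_words) auto
    finally show ?thesis .
  qed
  then show "\<exists>C. \<forall>\<xi>. (1 + norm \<xi> ^ 2) ^ N * dmax k (fourier g) \<xi> \<le> C" by blast
qed

lemma gs_space_weighted_jw:
  fixes f :: "real ^ 'n::finite \<Rightarrow> complex"
  assumes "t > 0" "s > 0" "f \<in> gs_space t s" "h > 0"
  shows "\<exists>C\<ge>0. \<forall>m k y. norm y ^ m * dmax k f y \<le> C * h ^ (m + k) * fact m powr t * fact k powr s * jw y"
proof -
  obtain C where C: "C \<ge> 0" "\<And>m k y. (1 + norm y ^ 2) ^ CARD('n) * (norm y ^ m * dmax k f y) \<le> C * h ^ (m + k) * fact m powr t * fact k powr s"
    using gs_space_weighted[OF assms] by blast
  have "norm y ^ m * dmax k f y \<le> C * h ^ (m + k) * fact m powr t * fact k powr s * jw y" for m k y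
  proof -
    have "(1 + norm y ^ 2) ^ CARD('n) > 0" by (simp add: add_pos_nonneg)
    then show ?thesis using C(2)[of y m k] by (simp add: jw_def field_simps)
  qed
  then show ?thesis using C(1) by blast
qed

text \<open>The Leibniz rule costs a factor \<open>fact k / g ^ (2 * k)\<close> that must be absorbed by
  \<open>fact k powr (s + t)\<close>; for all small g this is possible exactly because s + t > 1.\<close>

lemma gs_space_fourier:
  fixes f :: "real ^ 'n::finite \<Rightarrow> complex"
  assumes t: "t > 0" and s: "s > 0" and st: "s + t > 1" and f: "f \<in> gs_space t s"
  shows "fourier f \<in> gs_space s t"
  unfolding gs_space_iff_gsb[OF s t]
proof (intro allI impI)
  fix h :: real assume h: "h > 0"
  let ?d = "real CARD('n)"
  have d: "?d \<ge> 1" by (simp add: Suc_leI)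
  \<comment> \<open>The factor 2 pays for the binomial coefficients, d for the choice of a dominant
    coordinate in \<open>fourier_moment_le\<close>.\<close>
  define g where "g = h / (2 * ?d)"
  have g: "g > 0" "2 * ?d * g = h" using h by (auto simp: g_def)
  have rf: "rapid f" using gs_space_rapid[OF t s f] .
  obtain C where C: "C \<ge> 0" "\<And>m k y. norm y ^ m * dmax k f y \<le> C * g ^ (m + k) * fact m powr t * fact k powr s * jw y"
    using gs_space_weighted_jw[OF t s f g(1)] by blast
  \<comment> \<open>\<open>power_le_gw\<close> with the positive exponent s + t - 1 bounds g^(-2k)
    by this constant times that power of the factorial.\<close>
  define K where "K = gw (s + t - 1) 1 (1 / g ^ 2)"
  have K: "(1 / g ^ 2) ^ k \<le> fact k powr (s + t - 1) * K" for k
    using power_le_gw[of 1 "s + t - 1" "1 / g ^ 2" k] st g by (simp add: K_def)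
  have K0: "K \<ge> 0" by (simp add: K_def gw_def)
  have key: "fact k * (norm y ^ (n - k) * dmax (m - k) f y) \<le> C * K * g ^ (n + m) * fact n powr t * fact m powr s * jw y"
    if k: "k \<le> n" "k \<le> m" for k n m y
  proof -
    let ?F = "fact k :: real"
    have "?F * (norm y ^ (n - k) * dmax (m - k) f y) \<le>
        ?F * (C * g ^ (n - k + (m - k)) * fact (n - k) powr t * fact (m - k) powr s * jw y)"
      by (intro mult_left_mono C) auto
    also have "g ^ (n - k + (m - k)) = g ^ (n + m) * (1 / g ^ 2) ^ k"
    proof -
      have "n + m = (n - k + (m - k)) + 2 * k" using k by simp
      then have "g ^ (n + m) = g ^ (n - k + (m - k)) * (g ^ 2) ^ k" by (metis power_add power_mult)
      then show ?thesis using g by (simp add: power_divide)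
    qed
    also have "?F * (C * (g ^ (n + m) * (1 / g ^ 2) ^ k) * fact (n - k) powr t * fact (m - k) powr s * jw y) =
        (C * g ^ (n + m) * ?F * fact (n - k) powr t * fact (m - k) powr s * jw y) * (1 / g ^ 2) ^ k" by (simp add: mult_ac)
    also have "\<dots> \<le> (C * g ^ (n + m) * ?F * fact (n - k) powr t * fact (m - k) powr s * jw y) * (fact k powr (s + t - 1) * K)"
      using C(1) g jw_pos[of y] by (intro mult_left_mono K) auto
    also have "\<dots> = C * K * g ^ (n + m) * jw y * ((?F powr 1 * ?F powr (s + t - 1)) * (fact (n - k) powr t * fact (m - k) powr s))"
      by (simp add: mult_ac)
    \<comment> \<open>The Leibniz factorial supplies the missing exponent 1: together the powers are
      t + s, and each share completes one of the remaining factorials by k! (n-k)! \<le> n!.\<close>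
    also have "?F powr 1 * ?F powr (s + t - 1) = ?F powr t * ?F powr s" 
      unfolding powr_add[symmetric] by (simp add: add.commute)
    also have "(?F powr t * ?F powr s) * (fact (n - k) powr t * fact (m - k) powr s) =
        (?F * fact (n - k)) powr t * (?F * fact (m - k)) powr s"
      by (simp add: powr_mult mult_ac)
    also have "C * K * g ^ (n + m) * jw y * \<dots> \<le> C * K * g ^ (n + m) * jw y * (fact n powr t * fact m powr s)"
      using C(1) K0 g jw_pos[of y] t s fact_mult_le[of k "n - k"] fact_mult_le[of k "m - k"] k
      by (intro mult_left_mono mult_mono powr_mono2) auto
    finally show ?thesis by (simp add: mult_ac)
  qed
  have "gsb s t h (C * K * J0 TYPE('n)) (fourier f)"
    unfolding gsb_def
  proof (intro conjI allI smooth_fourier rf)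
    fix m and w :: "'n list" and \<xi> :: "real ^ 'n"
    let ?n = "length w"
    let ?R = "C * K * g ^ (?n + m) * fact ?n powr t * fact m powr s"
    have R: "?R \<ge> 0" using C(1) K0 g by simp
    have B: "norm (derivs v (\<lambda>y. mon w y * f y) y) \<le> (2 ^ m * 2 ^ ?n * ?R) * jw y" if v: "length v = m" for v y
    proof -
      have "norm (derivs v (\<lambda>y. mon w y * f y) y) \<le>
         (\<Sum>k\<le>m. real (m choose k) * ((real (?n choose k) * fact k * norm y ^ (?n - k)) * dmax (m - k) f y))"
        using derivs_mult_bound[OF smooth_mon rapid_smooth[OF rf] norm_derivs_mon_le norm_derivs_le_dmax, of v w y] v by simp
      also have "\<dots> \<le> (\<Sum>k\<le>m. real (m choose k) * (2 ^ ?n * (?R * jw y)))"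
      proof (intro sum_mono mult_left_mono)
        fix k assume k: "k \<in> {..m}"
        show "(real (?n choose k) * fact k * norm y ^ (?n - k)) * dmax (m - k) f y \<le> 2 ^ ?n * (?R * jw y)"
        proof (cases "k \<le> ?n")
          case True
          have "real (?n choose k) \<le> 2 ^ ?n"
            using binomial_le_pow2[of ?n k] by (metis of_nat_le_iff of_nat_numeral of_nat_power)
          then have "real (?n choose k) * (fact k * (norm y ^ (?n - k) * dmax (m - k) f y)) \<le> 2 ^ ?n * (?R * jw y)"
            using k True dmax_nonneg[of "m - k" f y] by (intro mult_mono key) auto
          then show ?thesis by (simp add: mult_ac)
        next
          case False
          then show ?thesis using R jw_pos[of y] by (simp add: binomial_eq_0)
        qed
      qed auto
      also have "\<dots> = real (\<Sum>k\<le>m. m choose k) * (2 ^ ?n * (?R * jw y))" by (simp add: sum_distrib_right)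
      also have "\<dots> = (2 ^ m * 2 ^ ?n * ?R) * jw y" by (simp add: choose_row_sum)
      finally show ?thesis .
    qed
    have "norm \<xi> ^ m * norm (derivs w (fourier f) \<xi>) = norm \<xi> ^ m * norm (fourier (\<lambda>y. mon w y * f y) \<xi>)"
      unfolding derivs_fourier[OF rf] by (simp add: norm_mult norm_power)
    also have "\<dots> \<le> ?d ^ m * ((2 ^ m * 2 ^ ?n * ?R) * J0 TYPE('n))"
      by (rule fourier_moment_le[OF rapid_mon_mult[OF rf] B])
    also have "\<dots> \<le> ?d ^ (m + ?n) * ((2 ^ m * 2 ^ ?n * ?R) * J0 TYPE('n))"
      using d R J0_nonneg[where 'n = 'n] by (intro mult_right_mono power_increasing) auto
    also have "\<dots> = C * K * J0 TYPE('n) * (2 * ?d * g) ^ (m + ?n) * fact m powr s * fact ?n powr t"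
      by (simp add: power_mult_distrib power_add mult_ac)
    finally show "norm \<xi> ^ m * norm (derivs w (fourier f) \<xi>) \<le> C * K * J0 TYPE('n) * h ^ (m + ?n) * fact m powr s * fact ?n powr t"
      by (simp only: g)
  qed
  then show "\<exists>C. gsb s t h C (fourier f)" by blast
qed

section \<open>The Gaussian and Fourier inversion\<close>

lemma gaussian_1d:
  shows "integrable lborel (\<lambda>x :: real. iexp (t * x) * complex_of_real (exp (- (x^2) / 2)))" (is ?A)
    and "(LINT x|lborel. iexp (t * x) * complex_of_real (exp (- (x^2) / 2))) = complex_of_real (sqrt (2 * pi) * exp (- (t^2) / 2))" (is ?B)
proof -
  have e: "exp (- (x^2) / 2) = sqrt (2 * pi) * std_normal_density x" for x :: real
    by (simp add: std_normal_density_def)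
  have i: "integrable lborel std_normal_density" by (rule integrable_normal_density) simp
  have "integrable lborel (\<lambda>x. complex_of_real (exp (- (x^2) / 2)))"
    unfolding e by (intro integrable_of_real integrable_mult_right i)
  then show ?A
    by (rule Bochner_Integration.integrable_bound) (auto simp: norm_mult)
  have "complex_of_real (exp (- (t^2) / 2)) = (LINT x|std_normal_distribution. iexp (t * x))"
    using fun_cong[OF char_std_normal_distribution, of t] by (simp add: char_def)
  also have "\<dots> = (LINT x|lborel. std_normal_density x *\<^sub>R iexp (t * x))"
    by (subst integral_density) auto
  finally have eq: "complex_of_real (exp (- (t^2) / 2)) = (LINT x|lborel. std_normal_density x *\<^sub>R iexp (t * x))" .
  have "(LINT x|lborel. complex_of_real (sqrt (2 * pi)) * (std_normal_density x *\<^sub>R iexp (t * x))) =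
     complex_of_real (sqrt (2 * pi)) * complex_of_real (exp (- (t^2) / 2))"
    unfolding eq by (rule integral_mult_right_zero)
  moreover have "complex_of_real (sqrt (2 * pi)) * (std_normal_density x *\<^sub>R iexp (t * x)) =
      iexp (t * x) * complex_of_real (exp (- (x^2) / 2))" for x
    unfolding e by (simp add: scaleR_conv_of_real)
  ultimately show ?B by (simp only: of_real_mult)
qed

definition gauss :: "real ^ 'n::finite \<Rightarrow> real" where
  "gauss x = exp (- (norm x ^ 2) / 2)"

lemma gauss_measurable [measurable]: "gauss \<in> borel_measurable borel"
  unfolding gauss_def [abs_def] by measurable

lemma
  fixes v :: "real ^ 'n::finite"
  shows integrable_wave_gauss: "integrable lborel (\<lambda>x. wave v x * of_real (gauss x))"
    and integral_wave_gauss: "(LINT x|lborel. wave v x * of_real (gauss x)) = of_real (gauss v / cd TYPE('n))"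
proof -
  let ?f = "\<lambda>(b :: real ^ 'n) r. iexp ((v \<bullet> b) * r) * complex_of_real (exp (- (r^2) / 2))"
  have pg: "(\<Prod>b\<in>Basis. exp (- ((x \<bullet> b)^2) / 2)) = gauss x" for x :: "real ^ 'n"
  proof -
    have "(\<Sum>b\<in>Basis. - ((x \<bullet> b)^2) / 2) = - (norm x ^ 2) / 2"
      unfolding power2_norm_eq_inner euclidean_inner[of x x]
      by (simp add: power2_eq_square sum_negf sum_divide_distrib)
    then show ?thesis unfolding gauss_def exp_sum[OF finite_Basis, symmetric] by simp
  qed
  have eq: "wave v x * of_real (gauss x) = (\<Prod>b\<in>Basis. ?f b (x \<bullet> b))" for x
  proof -
    have "(\<Sum>b\<in>Basis. \<i> * complex_of_real ((v \<bullet> b) * (x \<bullet> b))) = \<i> * complex_of_real (x \<bullet> v)"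
      unfolding euclidean_inner[of x v] by (simp add: sum_distrib_left mult.commute)
    then have "wave v x = (\<Prod>b\<in>Basis. iexp ((v \<bullet> b) * (x \<bullet> b)))"
      unfolding exp_sum[OF finite_Basis, symmetric] by simp
    then show ?thesis by (simp only: prod.distrib of_real_prod[symmetric] pg)
  qed
  show "integrable lborel (\<lambda>x. wave v x * of_real (gauss x))"
    unfolding eq by (rule integrable_lborel_prod) (rule gaussian_1d)
  have "(LINT x|lborel. wave v x * of_real (gauss x)) = (\<Prod>b\<in>Basis. complex_of_real (sqrt (2 * pi) * exp (- ((v \<bullet> b)^2) / 2)))"
    unfolding eq by (subst integral_lborel_prod[OF gaussian_1d(1)]) (simp only: gaussian_1d(2))
  also have "\<dots> = of_real (sqrt (2 * pi) ^ CARD('n) * gauss v)"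
    by (simp only: of_real_prod[symmetric] prod.distrib pg prod_constant) simp
  also have "sqrt (2 * pi) ^ CARD('n) = 1 / cd TYPE('n)"
    by (simp add: cd_def powr_minus_divide powr_half_sqrt[symmetric] powr_realpow[symmetric] powr_powr)
  finally show "(LINT x|lborel. wave v x * of_real (gauss x)) = of_real (gauss v / cd TYPE('n))" by simp
qed

lemma integrable_gauss: "integrable lborel (gauss :: real ^ 'n::finite \<Rightarrow> real)"
proof -
  have "integrable lborel (\<lambda>x :: real ^ 'n. complex_of_real (gauss x))"
    using integrable_wave_gauss[of 0] by simp
  then show ?thesis by (simp only: complex_of_real_integrable_eq)
qed

lemma integral_gauss: "(LINT x|lborel. gauss (x :: real ^ 'n::finite)) = 1 / cd TYPE('n)"
proof -
  have "complex_of_real (LINT x|lborel. gauss (x :: real ^ 'n)) = of_real (1 / cd TYPE('n))"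
    using integral_wave_gauss[of "0 :: real ^ 'n"] by (simp add: gauss_def)
  then show ?thesis by (simp only: of_real_eq_iff)
qed

text \<open>Both sides are the regularization of the inversion integral; e tends to 0 below.\<close>

lemma gaussian_mean_eq:
  fixes g :: "real ^ 'n::finite \<Rightarrow> complex"
  assumes g: "rapid g" and e: "e > 0"
  shows "(LINT \<xi>|lborel. wave y \<xi> * fourier g \<xi> * of_real (gauss (e *\<^sub>R \<xi>))) =
    (LINT v|lborel. g (y + e *\<^sub>R v) * of_real (gauss v))"
proof -
  have [measurable]: "g \<in> borel_measurable borel" using g by (rule rapid_measurable)
  have gi: "integrable lborel g" using g by (rule rapid_integrable)
  have gai: "integrable lborel (\<lambda>\<xi> :: real ^ 'n. gauss (e *\<^sub>R \<xi>))"
    using lborel_integrable_affine[OF integrable_gauss, of e 0] e by simp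
  let ?c = "cd TYPE('n)"
  let ?f = "\<lambda>(\<xi>, x). (wave y \<xi> * of_real (gauss (e *\<^sub>R \<xi>))) * (wave (- \<xi>) x * g x)"
  have "continuous_on UNIV g" using rapid_smooth[OF g] by (rule smooth_continuous_on)
  then have "continuous_on UNIV (\<lambda>p :: (real ^ 'n) \<times> (real ^ 'n). g (snd p))"
    by (rule continuous_on_compose2) (auto intro: continuous_intros)
  then have "continuous_on UNIV ?f"
    unfolding case_prod_beta gauss_def by (intro continuous_intros) simp_all
  then have m: "?f \<in> borel_measurable (lborel \<Otimes>\<^sub>M lborel)"
    unfolding lborel_prod by (simp add: borel_measurable_continuous_onI)
  have int: "integrable (lborel \<Otimes>\<^sub>M lborel) ?f"
  proof (rule lborel_pair.Fubini_integrable[OF m])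
    show "AE \<xi> in lborel. integrable lborel (\<lambda>x. ?f (\<xi>, x))"
      unfolding prod.case by (intro AE_I2 integrable_mult_right rapid_integrable rapid_wave_mult g)
    have "(\<lambda>\<xi>. LINT x|lborel. norm (?f (\<xi>, x))) = (\<lambda>\<xi>. gauss (e *\<^sub>R \<xi>) * (LINT x|lborel. norm (g x)))"
      by (auto simp: norm_mult gauss_def)
    then show "integrable lborel (\<lambda>\<xi>. LINT x|lborel. norm (?f (\<xi>, x)))" using gai by simp
  qed
  \<comment> \<open>After the exchange of integrals the \<xi>-integral is the transform of a dilated
    Gaussian: a Gaussian of width e centred at y.\<close>
  have inner: "(LINT \<xi>|lborel. ?f (\<xi>, x)) = g x * of_real (gauss ((y - x) /\<^sub>R e) / (e ^ CARD('n) * ?c))" for x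
  proof -
    let ?h = "\<lambda>\<zeta>. wave ((y - x) /\<^sub>R e) \<zeta> * of_real (gauss \<zeta>)"
    have "?f (\<xi>, x) = g x * ?h (0 + e *\<^sub>R \<xi>)" for \<xi>
    proof -
      have "wave y \<xi> * wave (- \<xi>) x = wave (y - x) \<xi>"
        by (simp add: inner_diff_right inner_commute exp_diff exp_minus right_diff_distrib divide_inverse)
      also have "\<dots> = wave ((y - x) /\<^sub>R e) (e *\<^sub>R \<xi>)"
      proof -
        have "(e *\<^sub>R \<xi>) \<bullet> ((y - x) /\<^sub>R e) = \<xi> \<bullet> (y - x)" using e by simp
        then show ?thesis by (simp only:)
      qed
      finally show ?thesis by (simp add: mult_ac)
    qed
    then have "(LINT \<xi>|lborel. ?f (\<xi>, x)) = g x * (LINT \<xi>|lborel. ?h (0 + e *\<^sub>R \<xi>))"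
      by (simp only: integral_mult_right_zero)
    also have "(LINT \<xi>|lborel. ?h (0 + e *\<^sub>R \<xi>)) = (LINT \<zeta>|lborel. ?h \<zeta>) /\<^sub>R (e ^ CARD('n))"
      using lborel_integral_affine[OF integrable_wave_gauss, of e "(y - x) /\<^sub>R e" 0] e by simp
    also have "\<dots> = of_real (gauss ((y - x) /\<^sub>R e) / (e ^ CARD('n) * ?c))"
      unfolding integral_wave_gauss by (simp add: scaleR_conv_of_real divide_inverse mult_ac)
    finally show ?thesis .
  qed
  have "(LINT \<xi>|lborel. wave y \<xi> * fourier g \<xi> * of_real (gauss (e *\<^sub>R \<xi>))) =
      (LINT \<xi>|lborel. of_real ?c * (LINT x|lborel. ?f (\<xi>, x)))"
    unfolding prod.case integral_mult_right_zero fourier_eq by (simp only: mult_ac integral_mult_right_zero)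
  also have "\<dots> = of_real ?c * (LINT \<xi>|lborel. LINT x|lborel. ?f (\<xi>, x))" by simp
  also have "(LINT \<xi>|lborel. LINT x|lborel. ?f (\<xi>, x)) = (LINT x|lborel. LINT \<xi>|lborel. ?f (\<xi>, x))"
    using lborel_pair.Fubini_integral[of "\<lambda>\<xi> x. ?f (\<xi>, x)"] int by simp
  also have "\<dots> = (LINT x|lborel. g x * of_real (gauss ((y - x) /\<^sub>R e) / (e ^ CARD('n) * ?c)))"
    by (simp only: inner)
  \<comment> \<open>The substitution x = y + e * v turns the concentrating kernel into a fixed one,
    so that e remains in the argument of g only.\<close>
  also have "\<dots> = (e ^ CARD('n)) *\<^sub>R (LINT v|lborel. g (y + e *\<^sub>R v) * of_real (gauss ((y - (y + e *\<^sub>R v)) /\<^sub>R e) / (e ^ CARD('n) * ?c)))"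
  proof (subst lborel_integral_affine[where c = e and t = y])
    have "integrable lborel (\<lambda>x. norm (g x) * (1 / (e ^ CARD('n) * ?c)))" using gi by simp
    then show "integrable lborel (\<lambda>x. g x * of_real (gauss ((y - x) /\<^sub>R e) / (e ^ CARD('n) * ?c)))"
    proof (rule Bochner_Integration.integrable_bound[OF _ _ AE_I2])
      fix x
      have q: "e ^ CARD('n) * ?c > 0" using e cd_pos[where 'n = 'n] by simp
      have "norm (g x) * (gauss ((y - x) /\<^sub>R e) / (e ^ CARD('n) * ?c)) \<le> norm (g x) * (1 / (e ^ CARD('n) * ?c))"
        using q by (intro mult_left_mono divide_right_mono) (auto simp: gauss_def)
      moreover have "\<bar>gauss ((y - x) /\<^sub>R e) / (e ^ CARD('n) * ?c)\<bar> = gauss ((y - x) /\<^sub>R e) / (e ^ CARD('n) * ?c)"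
        using q by (simp add: gauss_def)
      ultimately show "norm (g x * of_real (gauss ((y - x) /\<^sub>R e) / (e ^ CARD('n) * ?c))) \<le> norm (norm (g x) * (1 / (e ^ CARD('n) * ?c)))"
        unfolding norm_mult norm_of_real real_norm_def
        using abs_of_pos[OF divide_pos_pos[OF zero_less_one q]] by (simp only: abs_norm_cancel)
    qed simp
  qed (use e in auto)
  also have "\<dots> = (e ^ CARD('n)) *\<^sub>R (LINT v|lborel. (g (y + e *\<^sub>R v) * of_real (gauss v)) * of_real (1 / (e ^ CARD('n) * ?c)))"
    using e by (simp add: gauss_def)
  also have "\<dots> = (LINT v|lborel. g (y + e *\<^sub>R v) * of_real (gauss v)) / of_real ?c"
    unfolding integral_mult_left_zero using e by (simp add: scaleR_conv_of_real)
  finally show ?thesis using cd_pos[where 'n = 'n] by simp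
qed

text \<open>Limit e = 1 / (n + 1) to 0 in \<open>gaussian_mean_eq\<close>. The left side is
  dominated by the integrable function norm (fourier g), the right side by a multiple of the
  Gaussian, since g is bounded.\<close>

theorem fourier_inversion:
  fixes g :: "real ^ 'n::finite \<Rightarrow> complex"
  assumes g: "rapid g"
  shows "fourier (fourier g) (- y) = g y"
proof -
  have [measurable]: "g \<in> borel_measurable borel" "fourier g \<in> borel_measurable borel"
    using g by (auto intro: rapid_measurable rapid_fourier)
  let ?e = "\<lambda>n. 1 / real (Suc n)"
  have e0: "?e \<longlonglongrightarrow> 0" by (rule LIMSEQ_Suc[OF lim_1_over_n])
  have cg: "isCont (gauss :: real ^ 'n \<Rightarrow> real) x" for x
    unfolding gauss_def [abs_def] by (intro continuous_intros) auto
  have "(\<lambda>n. LINT \<xi>|lborel. wave y \<xi> * fourier g \<xi> * of_real (gauss (?e n *\<^sub>R \<xi>))) \<longlonglongrightarrow>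
      (LINT \<xi>|lborel. wave y \<xi> * fourier g \<xi>)"
  proof (rule integral_dominated_convergence[where w = "\<lambda>\<xi>. norm (fourier g \<xi>)"])
    show "integrable lborel (\<lambda>\<xi>. norm (fourier g \<xi>))"
      by (intro integrable_norm rapid_integrable rapid_fourier g)
    show "AE \<xi> in lborel. (\<lambda>n. wave y \<xi> * fourier g \<xi> * of_real (gauss (?e n *\<^sub>R \<xi>))) \<longlonglongrightarrow> wave y \<xi> * fourier g \<xi>"
    proof (intro AE_I2)
      fix \<xi> :: "real ^ 'n"
      have "(\<lambda>n. ?e n *\<^sub>R \<xi>) \<longlonglongrightarrow> 0 *\<^sub>R \<xi>" by (intro tendsto_intros e0)
      then have "(\<lambda>n. gauss (?e n *\<^sub>R \<xi>)) \<longlonglongrightarrow> gauss (0 *\<^sub>R \<xi>)" by (intro isCont_tendsto_compose[OF cg])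
      then have "(\<lambda>n. wave y \<xi> * fourier g \<xi> * of_real (gauss (?e n *\<^sub>R \<xi>))) \<longlonglongrightarrow> wave y \<xi> * fourier g \<xi> * of_real (gauss (0 *\<^sub>R \<xi>))"
        by (intro tendsto_intros)
      then show "(\<lambda>n. wave y \<xi> * fourier g \<xi> * of_real (gauss (?e n *\<^sub>R \<xi>))) \<longlonglongrightarrow> wave y \<xi> * fourier g \<xi>"
        by (simp add: gauss_def)
    qed
  qed (auto simp: norm_mult gauss_def intro!: mult_left_le)
  moreover have "(\<lambda>n. LINT v|lborel. g (y + ?e n *\<^sub>R v) * of_real (gauss v)) \<longlonglongrightarrow> (LINT v|lborel. g y * of_real (gauss (v :: real ^ 'n)))"
  proof -
    obtain C where C: "C \<ge> 0" "\<And>x. (1 + norm x ^ 2) ^ 0 * norm (derivs [] g x) \<le> C" using rapid_bound[OF g] by blast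
    show ?thesis
    proof (rule integral_dominated_convergence[where w = "\<lambda>v :: real ^ 'n. C * gauss v"])
      show "integrable lborel (\<lambda>v :: real ^ 'n. C * gauss v)" by (intro integrable_mult_right integrable_gauss)
      have "isCont g y" using smooth_differentiable[OF rapid_smooth[OF g]] differentiable_imp_continuous_within by blast
      moreover have "(\<lambda>n. y + ?e n *\<^sub>R v) \<longlonglongrightarrow> y" for v
      proof -
        have "(\<lambda>n. y + ?e n *\<^sub>R v) \<longlonglongrightarrow> y + 0 *\<^sub>R v" by (intro tendsto_intros e0)
        then show ?thesis by simp
      qed
      ultimately show "AE v in lborel. (\<lambda>n. g (y + ?e n *\<^sub>R v) * of_real (gauss v)) \<longlonglongrightarrow> g y * of_real (gauss v)"
        by (intro AE_I2 tendsto_mult tendsto_const isCont_tendsto_compose[of y g])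
    qed (use C in \<open>auto simp: norm_mult gauss_def intro!: mult_right_mono\<close>)
  qed
  ultimately have "(LINT \<xi>|lborel. wave y \<xi> * fourier g \<xi>) = (LINT v|lborel. g y * of_real (gauss (v :: real ^ 'n)))"
    using gaussian_mean_eq[OF g] LIMSEQ_unique by (auto simp del: of_nat_Suc)
  also have "\<dots> = g y * of_real (1 / cd TYPE('n))"
    using integral_gauss[where 'n = 'n] by (simp del: of_real_divide)
  finally show ?thesis using cd_pos[where 'n = 'n] by (simp add: fourier_eq)
qed

section \<open>The short-time Fourier transform\<close>

text \<open>The short-time Fourier transform of a test function, see \<open>sv_eq\<close> below.\<close>

definition sv :: "(real ^ 'n::finite \<Rightarrow> complex) \<Rightarrow> (real ^ 'n \<Rightarrow> complex) \<Rightarrow> (real ^ 'n) \<times> (real ^ 'n) \<Rightarrow> complex" where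
  "sv \<psi> f z = fourier (\<lambda>y. f y * cnj (translate (fst z) \<psi> y)) (snd z)"

lemma fourier_cmult: "fourier (\<lambda>y. c * f y) \<xi> = c * fourier f \<xi>"
proof -
  have "(LINT x|lborel. wave (- \<xi>) x * (c * f x)) = (LINT x|lborel. c * (wave (- \<xi>) x * f x))"
    by (simp only: mult_ac)
  then show ?thesis unfolding fourier_eq by (simp only: integral_mult_right_zero mult_ac)
qed

lemma slow_const: "slow (\<lambda>y :: real ^ 'n::finite. c)"
  unfolding slow_def
proof (intro conjI allI smooth_const)
  fix k
  have "norm (derivs v (\<lambda>y :: real ^ 'n. c) y) \<le> norm c" for v y
    by (cases v rule: rev_cases) (simp_all add: partial_const derivs_const_0)
  then have "dmax k (\<lambda>y :: real ^ 'n. c) y \<le> norm c * (1 + norm y ^ 2) ^ 0" for y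
    by (intro dmax_le) simp
  then show "\<exists>N C. \<forall>y. dmax k (\<lambda>y :: real ^ 'n. c) y \<le> C * (1 + norm y ^ 2) ^ N" by blast
qed

lemma continuous_on_wt: "t > 0 \<Longrightarrow> s > 0 \<Longrightarrow> continuous_on S (wt t s)"
  unfolding wt_def [abs_def] by (intro continuous_intros continuous_on_powr') auto

lemma wt_measurable: "t > 0 \<Longrightarrow> s > 0 \<Longrightarrow> wt t s \<in> borel_measurable borel"
  by (intro borel_measurable_continuous_onI continuous_on_wt)

text \<open>The choice h = t powr t normalizes the coefficient t * h powr (- 1 / t) to 1.\<close>

lemma gw_special: "t > 0 \<Longrightarrow> gw t (t powr t) x = exp (norm x powr (1 / t))"
  by (simp add: gw_eq powr_powr powr_minus_divide)

lemma one_plus_sq_le_exp: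
  fixes x :: "'a::real_normed_vector"
  assumes t: "t > 0"
  shows "\<exists>C>0. \<forall>x :: 'a. (1 + norm x ^ 2) ^ N \<le> C * exp (norm x powr (1 / t))"
proof -
  define K where "K = (t powr t) ^ (2 * N) * fact (2 * N) powr t"
  have K: "K \<ge> 0" by (simp add: K_def)
  have "(1 + norm x ^ 2) ^ N \<le> 2 ^ N * (1 + K) * exp (norm x powr (1 / t))" for x :: 'a
  proof -
    have "norm x ^ (2 * N) \<le> K * exp (norm x powr (1 / t))"
      using power_le_gw[of "t powr t" t x "2 * N"] t by (simp add: K_def gw_special)
    moreover have "1 \<le> exp (norm x powr (1 / t))" by simp
    ultimately have "1 + norm x ^ (2 * N) \<le> (1 + K) * exp (norm x powr (1 / t))"
      unfolding distrib_right by linarith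
    then have "2 ^ N * (1 + norm x ^ (2 * N)) \<le> 2 ^ N * ((1 + K) * exp (norm x powr (1 / t)))"
      by (rule mult_left_mono) simp
    moreover have "(1 + norm x ^ 2) ^ N \<le> 2 ^ N * (1 + norm x ^ (2 * N))"
      using add_power_le[of 1 "norm x ^ 2" N] by (simp add: power_mult)
    ultimately show ?thesis unfolding mult.assoc by (rule order_trans[rotated])
  qed
  then show ?thesis using K by (intro exI[of _ "2 ^ N * (1 + K)"]) auto
qed

lemma norm_le_exp:
  fixes x :: "'a::real_normed_vector"
  assumes t: "t > 0"
  shows "\<exists>C>0. \<forall>x :: 'a. norm x \<le> C * exp (norm x powr (1 / t))"
proof -
  obtain C where C: "C > 0" "\<And>x :: 'a. (1 + norm x ^ 2) ^ 1 \<le> C * exp (norm x powr (1 / t))"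
    using one_plus_sq_le_exp[OF t, of 1] by blast
  have "norm x \<le> 1 + norm x ^ 2" for x :: 'a
    using sum_squares_bound[of "norm x" 1] norm_ge_zero[of x] unfolding one_power2 by linarith
  then show ?thesis using C by (intro exI[of _ C]) (auto intro: order_trans)
qed

text \<open>Each of the two exponential factors is dominated by a multiple of \<open>jw\<close>, and
  Fubini handles the product.\<close>

lemma integrable_exp_wt:
  assumes t: "t > 0" and s: "s > 0"
  shows "integrable lborel (\<lambda>z :: (real ^ 'n::finite) \<times> (real ^ 'n). exp (- wt t s z))"
proof -
  have e: "\<exists>C>0. \<forall>x :: real ^ 'n. exp (- (norm x powr (1 / r))) \<le> C * jw x" if r: "r > 0" for r
  proof -
    obtain C where C: "C > 0" "\<And>x :: real ^ 'n. (1 + norm x ^ 2) ^ CARD('n) \<le> C * exp (norm x powr (1 / r))"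
      using one_plus_sq_le_exp[OF r] by blast
    have "exp (- (norm x powr (1 / r))) \<le> C * jw x" for x :: "real ^ 'n"
    proof -
      have "(1 + norm x ^ 2) ^ CARD('n) > 0" by (simp add: add_pos_nonneg)
      then show ?thesis using C(2)[of x] by (simp add: jw_def exp_minus field_simps)
    qed
    then show ?thesis using C(1) by blast
  qed
  obtain C1 where C1: "C1 > 0" "\<And>x :: real ^ 'n. exp (- (norm x powr (1 / t))) \<le> C1 * jw x" using e[OF t] by blast
  obtain C2 where C2: "C2 > 0" "\<And>x :: real ^ 'n. exp (- (norm x powr (1 / s))) \<le> C2 * jw x" using e[OF s] by blast
  let ?f = "\<lambda>(x :: real ^ 'n, y :: real ^ 'n). (C1 * jw x) * (C2 * jw y)"
  have m: "?f \<in> borel_measurable (lborel \<Otimes>\<^sub>M lborel)" by measurable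
  have "integrable (lborel \<Otimes>\<^sub>M lborel) ?f"
  proof (rule lborel_pair.Fubini_integrable[OF m])
    show "AE x in lborel. integrable lborel (\<lambda>y. ?f (x, y))"
      unfolding prod.case by (intro AE_I2 integrable_mult_right integrable_jw)
    have "(\<lambda>x. LINT y|lborel. norm (?f (x, y))) = (\<lambda>x. jw x * (C1 * C2 * (LINT y|lborel. jw (y :: real ^ 'n))))"
      using C1(1) C2(1) by (auto simp: abs_mult abs_of_pos jw_pos)
    then show "integrable lborel (\<lambda>x. LINT y|lborel. norm (?f (x, y)))"
      by (simp only:) (intro integrable_mult_left integrable_jw)
  qed
  then have "integrable lborel ?f" by (simp only: lborel_prod)
  then show ?thesis
  proof (rule Bochner_Integration.integrable_bound[OF _ _ AE_I2])
    show "(\<lambda>z :: (real ^ 'n) \<times> (real ^ 'n). exp (- wt t s z)) \<in> borel_measurable lborel"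
      using wt_measurable[OF t s] by measurable
    fix z :: "(real ^ 'n) \<times> (real ^ 'n)"
    have "exp (- wt t s z) = exp (- (norm (fst z) powr (1 / t))) * exp (- (norm (snd z) powr (1 / s)))"
      by (simp add: wt_def exp_diff exp_minus divide_inverse)
    also have "\<dots> \<le> (C1 * jw (fst z)) * (C2 * jw (snd z))"
      using C1 jw_pos[of "fst z"] by (intro mult_mono C1 C2) auto
    finally show "norm (exp (- wt t s z)) \<le> norm (?f z)"
      by (simp add: case_prod_beta)
  qed
qed

lemma gs_space_cnj: "t > 0 \<Longrightarrow> s > 0 \<Longrightarrow> f \<in> gs_space t s \<Longrightarrow> (\<lambda>y. cnj (f y)) \<in> gs_space t s"
  using gs_space_iff_gsb[of t s f] gs_space_iff_gsb[of t s "\<lambda>y. cnj (f y)"] by (blast intro: gsb_cnj)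

lemma modulate_0: "modulate 0 f = f"
  by (rule ext) (simp add: modulate_def)

lemma gs_space_translate: "t > 0 \<Longrightarrow> s > 0 \<Longrightarrow> f \<in> gs_space t s \<Longrightarrow> translate a f \<in> gs_space t s"
  using tfs_in_gs_space[of t s f "(a, 0)"]
  by (simp add: tfs_def modulate_0)

context
  fixes t s :: real and f \<psi> :: "real ^ 'n::finite \<Rightarrow> complex"
  assumes t: "t > 0" and s: "s > 0" and f: "f \<in> gs_space t s" and \<psi>: "\<psi> \<in> gs_space t s"
begin

lemma rapid_sv: "rapid (\<lambda>y. f y * cnj (translate x \<psi> y))"
  by (intro rapid_slow_mult rapid_slow gs_space_rapid[OF t s] f gs_space_cnj gs_space_translate \<psi> t s)

text \<open>Powers of \<xi> become derivatives of the product. Powers of x are shared through norm x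
  \<le> norm y + norm (y - x) between f at y and the window at y - x. The weight \<open>jw\<close>,
  taken from f, makes the integral converge in either case.\<close>

lemma sv_moments:
  assumes h: "h > 0"
  shows "\<exists>C\<ge>0. \<forall>m n z. norm (fst z) ^ m * (norm (snd z) ^ n * norm (sv \<psi> f z)) \<le> C * h ^ (m + n) * fact m powr t * fact n powr s"
proof -
  let ?d = "real CARD('n)"
  have d: "?d \<ge> 1" by (simp add: Suc_leI)
  define g where "g = h / (2 * ?d)"
  have g: "g > 0" "2 * ?d * g = h" using h by (auto simp: g_def)
  obtain C1 where C1: "C1 \<ge> 0" "\<And>m k y. norm y ^ m * dmax k f y \<le> C1 * g ^ (m + k) * fact m powr t * fact k powr s * jw y"
    using gs_space_weighted_jw[OF t s f g(1)] by blast
  obtain C2 where C2: "gsb t s g C2 \<psi>" using \<psi> g unfolding gs_space_iff_gsb[OF t s] by blast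
  have C20: "C2 \<ge> 0" using C2 by (rule gsb_nonneg)
  have "norm (fst z) ^ m * (norm (snd z) ^ n * norm (sv \<psi> f z)) \<le> (2 * C1 * C2 * J0 TYPE('n)) * h ^ (m + n) * fact m powr t * fact n powr s"
    for m n z
  proof -
    obtain x \<xi> where z: "z = (x, \<xi>)" by (cases z)
    let ?F = "\<lambda>y. f y * cnj (translate x \<psi> y)"
    let ?R = "2 ^ m * (2 * C1 * C2 * g ^ (m + n) * fact m powr t * (2 ^ n * fact n powr s))"
    have R: "?R \<ge> 0" using C1 C20 g by simp
    have smf: "smooth f" "smooth \<psi>" using f \<psi> gs_space_smooth by auto
    \<comment> \<open>The moment in x is a constant for the integration and is pulled into the
      integrand, where it can be compared with norm y and norm (y - x).\<close>
    have B: "norm (derivs v (\<lambda>y. complex_of_real (norm x ^ m) * ?F y) y) \<le> ?R * jw y" if v: "length v = n" for v y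
    proof -
      let ?e = "\<lambda>k. dmax k f y" and ?p = "\<lambda>k. dmax k \<psi> (y - x)"
      have p: "norm (derivs v (\<lambda>y. cnj (translate x \<psi> y)) y) \<le> ?p (length v)" for v
        using norm_derivs_le_dmax[of v \<psi> "y - x"]
        by (simp add: derivs_cnj smooth_translate smf derivs_translate) (simp add: translate_def)
      have "norm (derivs v (\<lambda>y. complex_of_real (norm x ^ m) * ?F y) y) = norm x ^ m * norm (derivs v ?F y)"
        using rapid_smooth[OF rapid_sv[of x]] by (simp add: derivs_cmult norm_mult norm_power)
      also have "\<dots> \<le> norm x ^ m * (\<Sum>k\<le>n. real (n choose k) * (?e k * ?p (n - k)))"
        using derivs_mult_bound[of f "\<lambda>y. cnj (translate x \<psi> y)" y ?e ?p v] smf p v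
        by (intro mult_left_mono) (auto simp: norm_derivs_le_dmax smooth_cnj smooth_translate)
      also have "\<dots> = (\<Sum>k\<le>n. real (n choose k) * (norm x ^ m * (?e k * ?p (n - k))))"
        by (simp add: sum_distrib_left mult_ac)
      also have "\<dots> \<le> (\<Sum>k\<le>n. real (n choose k) * ((2 ^ m * (2 * C1 * C2 * g ^ (m + n) * fact m powr t) * jw y) * (fact k powr s * fact (n - k) powr s)))"
      proof (intro sum_mono mult_left_mono)
        fix k assume k: "k \<in> {..n}"
        let ?Q = "C1 * C2 * g ^ (m + n) * fact m powr t * jw y * (fact k powr s * fact (n - k) powr s)"
        have gk: "g ^ (m + n) = g ^ (m + k) * g ^ (n - k)" "g ^ (m + n) = g ^ k * g ^ (m + (n - k))"
          using k by (simp_all flip: power_add)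
        have 1: "(norm y ^ m * ?e k) * ?p (n - k) \<le> ?Q"
        proof -
          have "(norm y ^ m * ?e k) * ?p (n - k) \<le> (C1 * g ^ (m + k) * fact m powr t * fact k powr s * jw y) * (C2 * g ^ (0 + (n - k)) * fact 0 powr t * fact (n - k) powr s)"
            using gsbD_dmax[OF C2, of "y - x" 0 "n - k"] C1(1) g jw_pos[of y]
            by (intro mult_mono C1(2)) (auto intro: dmax_nonneg)
          then show ?thesis unfolding gk(1) by (simp add: mult_ac)
        qed
        have 2: "?e k * (norm (y - x) ^ m * ?p (n - k)) \<le> ?Q"
        proof -
          have "?e k * (norm (y - x) ^ m * ?p (n - k)) \<le> (C1 * g ^ (0 + k) * fact 0 powr t * fact k powr s * jw y) * (C2 * g ^ (m + (n - k)) * fact m powr t * fact (n - k) powr s)"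
            using C1(2)[of y 0 k] C1(1) g jw_pos[of y]
            by (intro mult_mono[OF _ gsbD_dmax[OF C2]]) (auto intro: dmax_nonneg mult_nonneg_nonneg)
          then show ?thesis unfolding gk(2) by (simp add: mult_ac)
        qed
        have "norm x \<le> norm y + norm (y - x)" using norm_triangle_ineq4[of y "y - x"] by simp
        then have "norm x ^ m \<le> (norm y + norm (y - x)) ^ m" by (intro power_mono) auto
        also have "\<dots> \<le> 2 ^ m * (norm y ^ m + norm (y - x) ^ m)" by (rule add_power_le) auto
        finally have "norm x ^ m * (?e k * ?p (n - k)) \<le> 2 ^ m * (norm y ^ m + norm (y - x) ^ m) * (?e k * ?p (n - k))"
          by (intro mult_right_mono mult_nonneg_nonneg dmax_nonneg)
        also have "\<dots> = 2 ^ m * ((norm y ^ m * ?e k) * ?p (n - k) + ?e k * (norm (y - x) ^ m * ?p (n - k)))"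
          by (simp add: algebra_simps)
        also have "\<dots> \<le> 2 ^ m * (?Q + ?Q)" by (intro mult_left_mono add_mono 1 2) auto
        finally show "norm x ^ m * (?e k * ?p (n - k)) \<le> (2 ^ m * (2 * C1 * C2 * g ^ (m + n) * fact m powr t) * jw y) * (fact k powr s * fact (n - k) powr s)"
          by (simp add: mult_ac)
      qed auto
      also have "\<dots> = (2 ^ m * (2 * C1 * C2 * g ^ (m + n) * fact m powr t) * jw y) * (\<Sum>k\<le>n. real (n choose k) * (fact k powr s * fact (n - k) powr s))"
        by (simp only: sum_distrib_left mult_ac)
      also have "\<dots> \<le> (2 ^ m * (2 * C1 * C2 * g ^ (m + n) * fact m powr t) * jw y) * (2 ^ n * fact n powr s)"
        using C1 C20 g jw_pos[of y] s by (intro mult_left_mono sum_binomial_fact_powr_le) auto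
      finally show ?thesis by (simp add: mult_ac)
    qed
    have "norm (fst z) ^ m * (norm (snd z) ^ n * norm (sv \<psi> f z)) = norm \<xi> ^ n * norm (fourier (\<lambda>y. complex_of_real (norm x ^ m) * ?F y) \<xi>)"
      unfolding fourier_cmult by (simp add: z sv_def norm_mult norm_power)
    also have "\<dots> \<le> ?d ^ n * (?R * J0 TYPE('n))"
      by (rule fourier_moment_le[OF rapid_slow_mult[OF slow_const rapid_sv] B])
    also have "\<dots> \<le> ?d ^ (m + n) * (?R * J0 TYPE('n))"
      using d R J0_nonneg[where 'n = 'n] by (intro mult_right_mono power_increasing) auto
    also have "\<dots> = (2 * C1 * C2 * J0 TYPE('n)) * (2 * ?d * g) ^ (m + n) * fact m powr t * fact n powr s"
      by (simp add: power_mult_distrib power_add mult_ac)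
    finally show ?thesis by (simp only: g)
  qed
  then show ?thesis using C1 C20 J0_nonneg[where 'n = 'n] by (intro exI[of _ "2 * C1 * C2 * J0 TYPE('n)"]) auto
qed

text \<open>\<open>moments_imp_decay\<close> is applied in the position variable with the frequency
  moment held fixed, then in the frequency variable. Having the moments for every h gives every rate
  r.\<close>

lemma sv_decay: "\<exists>C\<ge>0. \<forall>z. norm (sv \<psi> f z) \<le> C * exp (- (r * wt t s z))"
proof -
  define q where "q = max r 1"
  have q: "q > 0" "r \<le> q" by (auto simp: q_def)
  \<comment> \<open>Chosen so that the rate p / 2 * h powr (- 1 / p) from
    \<open>moments_imp_decay\<close> is at least q for p = t and for p = s.\<close>
  define h where "h = min ((t / (2 * q)) powr t) ((s / (2 * q)) powr s)"
  have h: "h > 0" using t s q by (simp add: h_def)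
  have hp: "q * a powr (1 / p) \<le> p / 2 * (a / h) powr (1 / p)" if p: "p > 0" "h \<le> (p / (2 * q)) powr p" and a: "a \<ge> 0" for p a
  proof -
    have "h powr (1 / p) \<le> ((p / (2 * q)) powr p) powr (1 / p)" using h p by (intro powr_mono2) auto
    also have "\<dots> = p / (2 * q)" using p q by (simp add: powr_powr)
    finally have "h powr (1 / p) \<le> p / (2 * q)" .
    then have "q \<le> p / 2 / h powr (1 / p)" using q h by (simp add: field_simps)
    then have "q * a powr (1 / p) \<le> p / 2 / h powr (1 / p) * a powr (1 / p)" by (intro mult_right_mono) auto
    then show ?thesis using a h by (simp add: powr_divide)
  qed
  obtain C where C: "C \<ge> 0" "\<And>m n z. norm (fst z) ^ m * (norm (snd z) ^ n * norm (sv \<psi> f z)) \<le> C * h ^ (m + n) * fact m powr t * fact n powr s"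
    using sv_moments[OF h] by blast
  have "norm (sv \<psi> f z) \<le> 2 powr s * (2 powr t * C) * exp (- (r * wt t s z))" for z
  proof -
    let ?a = "exp (- (t / 2 * (norm (fst z) / h) powr (1 / t)))" and ?b = "exp (- (s / 2 * (norm (snd z) / h) powr (1 / s)))"
    have "norm (snd z) ^ n * norm (sv \<psi> f z) \<le> 2 powr t * (C * h ^ n * fact n powr s) * ?a" for n
    proof (rule moments_imp_decay[OF h t])
      show "norm (fst z) ^ m * (norm (snd z) ^ n * norm (sv \<psi> f z)) \<le> C * h ^ n * fact n powr s * h ^ m * fact m powr t" for m
        using C(2)[of z m n] by (simp add: power_add mult_ac)
    qed auto
    then have "norm (sv \<psi> f z) \<le> 2 powr s * (2 powr t * C * ?a) * ?b"
      by (intro moments_imp_decay[OF h s]) (auto simp: mult_ac)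
    also have "\<dots> = 2 powr s * (2 powr t * C) * (?a * ?b)" by (simp add: mult_ac)
    also have "\<dots> \<le> 2 powr s * (2 powr t * C) * exp (- (r * wt t s z))"
    proof (intro mult_left_mono)
      have "r * wt t s z \<le> q * wt t s z" using q wt_nonneg[of t s z] by (intro mult_right_mono)
      also have "\<dots> = q * norm (fst z) powr (1 / t) + q * norm (snd z) powr (1 / s)" by (simp add: wt_def distrib_left)
      also have "\<dots> \<le> t / 2 * (norm (fst z) / h) powr (1 / t) + s / 2 * (norm (snd z) / h) powr (1 / s)"
        using t s by (intro add_mono hp) (auto simp: h_def)
      finally show "?a * ?b \<le> exp (- (r * wt t s z))" by (simp flip: exp_add)
    qed (use C in auto)
    finally show ?thesis .
  qed
  then show ?thesis using C(1) by (intro exI[of _ "2 powr s * (2 powr t * C)"]) auto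
qed

end

text \<open>The exponential factor is locally bounded because \<open>wt\<close> is continuous.
  Values of u, derivatives of shifts and \<open>sv\<close> all get such a bound from
  \<open>tfs_diff_bound\<close>.\<close>

lemma continuous_on_of_wt_lipschitz:
  fixes F :: "(real ^ 'n::finite) \<times> (real ^ 'n) \<Rightarrow> complex"
  assumes t: "t > 0" and s: "s > 0"
    and F: "\<And>z z'. norm (F z - F z') \<le> C * (norm (fst z - fst z') + norm (snd z - snd z')) * exp (r * (wt t s z + wt t s z'))"
  shows "continuous_on UNIV F"
  unfolding continuous_on_def
proof
  fix z :: "(real ^ 'n) \<times> (real ^ 'n)"
  have w: "(wt t s \<longlongrightarrow> wt t s z) (at z)"
    using continuous_on_wt[OF t s, of UNIV] unfolding continuous_on_def by blast
  have "((\<lambda>z'. C * (norm (fst z' - fst z) + norm (snd z' - snd z)) * exp (r * (wt t s z' + wt t s z))) \<longlongrightarrow>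
     C * (norm (fst z - fst z) + norm (snd z - snd z)) * exp (r * (wt t s z + wt t s z))) (at z)"
    by (intro tendsto_intros w)
  then have "((\<lambda>z'. C * (norm (fst z' - fst z) + norm (snd z' - snd z)) * exp (r * (wt t s z' + wt t s z))) \<longlongrightarrow> 0) (at z)"
    by simp
  then have "((\<lambda>z'. F z' - F z) \<longlongrightarrow> 0) (at z)"
    by (rule Lim_null_comparison[rotated]) (use F in auto)
  then show "(F \<longlongrightarrow> F z) (at z within UNIV)" by (simp add: LIM_zero_iff)
qed

lemma tfs_apply: "tfs z f y = wave (snd z) y * f (y - fst z)"
  by (simp add: tfs_def modulate_def translate_def)

text \<open>Stated for a general g, because it serves both for derivatives of shifted windows and
  for values of u on them.\<close>

lemma simple_function_integral_sum:
  fixes F :: "'a \<Rightarrow> complex"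
  assumes F: "integrable M F" and a: "simple_function M a" and sp: "space M = UNIV"
  shows "(LINT z|M. F z * g (a z)) = (\<Sum>k\<in>range a. (LINT z|M. indicator {z. a z = k} z *\<^sub>R F z) * g k)"
    and "integrable M (\<lambda>z. F z * g (a z))"
proof -
  have fin: "finite (range a)" using a sp by (simp add: simple_function_def)
  have set: "{z. a z = k} \<in> sets M" for k
  proof (cases "k \<in> range a")
    case True
    then show ?thesis using a sp by (auto simp: simple_function_def vimage_def)
  next
    case False
    then have "{z. a z = k} = {}" by auto
    then show ?thesis by simp
  qed
  have int: "integrable M (\<lambda>z. indicator {z. a z = k} z *\<^sub>R F z)" for k
    using F set by (rule integrable_mult_indicator[rotated])
  have int': "integrable M (\<lambda>z. (indicator {z. a z = k} z *\<^sub>R F z) * g k)" for k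
    by (intro integrable_mult_left int)
  have eq: "F z * g (a z) = (\<Sum>k\<in>range a. (indicator {z. a z = k} z *\<^sub>R F z) * g k)" for z
  proof -
    have "(\<Sum>k\<in>range a. (indicator {z. a z = k} z *\<^sub>R F z) * g k) = (\<Sum>k\<in>range a. if k = a z then F z * g k else 0)"
      by (intro sum.cong) auto
    then show ?thesis using fin by simp
  qed
  show "(LINT z|M. F z * g (a z)) = (\<Sum>k\<in>range a. (LINT z|M. indicator {z. a z = k} z *\<^sub>R F z) * g k)"
    unfolding eq by (simp only: Bochner_Integration.integral_sum[OF int'] integral_mult_left_zero)
  show "integrable M (\<lambda>z. F z * g (a z))" unfolding eq by (intro Bochner_Integration.integrable_sum int')
qed

section \<open>Evaluating \<open>u\<close> on time-frequency shifts\<close>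

locale gs_pairing =
  fixes t s :: real and u :: "(real ^ 'n::finite \<Rightarrow> complex) \<Rightarrow> complex"
  assumes t: "t > 0" and s: "s > 0" and u: "u \<in> gs_dual t s"
begin

lemma u_add: "f \<in> gs_space t s \<Longrightarrow> g \<in> gs_space t s \<Longrightarrow> u (\<lambda>x. f x + g x) = u f + u g"
  and u_cmult: "f \<in> gs_space t s \<Longrightarrow> u (\<lambda>x. c * f x) = cnj c * u f"
  using u by (auto simp: gs_dual_def)

lemma u_zero: "u (\<lambda>x. 0) = 0"
  using u_cmult[OF gs_space_0[OF t s], of 0] by simp

lemma u_diff: "f \<in> gs_space t s \<Longrightarrow> g \<in> gs_space t s \<Longrightarrow> u (\<lambda>x. f x - g x) = u f - u g"
  using u_add[of f "\<lambda>x. (-1) * g x"] u_cmult[of g "-1"] gs_space_cmult[OF t s, of g "-1"] by simp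

lemma u_sum:
  "finite K \<Longrightarrow> (\<And>k. k \<in> K \<Longrightarrow> f k \<in> gs_space t s) \<Longrightarrow> u (\<lambda>x. \<Sum>k\<in>K. c k * f k x) = (\<Sum>k\<in>K. cnj (c k) * u (f k))"
proof (induction K rule: finite_induct)
  case (insert k K)
  have "u (\<lambda>x. c k * f k x + (\<Sum>k\<in>K. c k * f k x)) = u (\<lambda>x. c k * f k x) + u (\<lambda>x. \<Sum>k\<in>K. c k * f k x)"
    using insert by (intro u_add gs_space_cmult gs_space_sum t s) auto
  then show ?case using insert by (simp add: u_cmult)
qed (simp add: u_zero)

text \<open>Extends \<open>gs_dual_bounded\<close> to the bound C = 0, by replacing C with C +
  \<delta>. The constants inserted later are distances and integrals that may vanish.\<close>

lemma u_bound:
  obtains h B where "h > 0" "B \<ge> 0" "\<And>f C. f \<in> gs_space t s \<Longrightarrow> gsb t s h C f \<Longrightarrow> norm (u f) \<le> B * C"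
proof -
  obtain h B where hB: "h > 0" "B \<ge> 0" "\<And>f C. f \<in> gs_space t s \<and> C > 0 \<and> gsb t s h C f \<Longrightarrow> norm (u f) \<le> B * C"
    using gs_dual_bounded[OF t s u] by blast
  have "norm (u f) \<le> B * C" if f: "f \<in> gs_space t s" "gsb t s h C f" for f C
  proof (rule field_le_epsilon)
    fix e :: real assume e: "e > 0"
    define \<delta> where "\<delta> = e / (B + 1)"
    have \<delta>: "\<delta> > 0" using e hB by (simp add: \<delta>_def)
    have C: "C \<ge> 0" using f by (auto intro: gsb_nonneg)
    have "norm (u f) \<le> B * (C + \<delta>)"
      using f hB \<delta> C gsb_mono[OF f(2), of h "C + \<delta>"] by (intro hB) auto
    also have "B * \<delta> \<le> e" using e hB by (simp add: \<delta>_def field_simps)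
    then have "B * (C + \<delta>) \<le> B * C + e" by (simp add: distrib_left)
    finally show "norm (u f) \<le> B * C + e" .
  qed
  with hB(1,2) that show thesis by blast
qed

text \<open>The bound on u involves one fixed h, so \<open>tfs_bound\<close> yields one fixed rate.
  It is enlarged to a nonnegative one so that larger weights give weaker bounds.\<close>

lemma u_tfs_growth:
  assumes "f \<in> gs_space t s"
  shows "\<exists>C r. C \<ge> 0 \<and> r \<ge> 0 \<and> (\<forall>z. norm (u (tfs z f)) \<le> C * exp (r * wt t s z))"
proof -
  obtain h B where hB: "h > 0" "B \<ge> 0" "\<And>f C. f \<in> gs_space t s \<Longrightarrow> gsb t s h C f \<Longrightarrow> norm (u f) \<le> B * C"
    using u_bound by blast
  obtain C r where C: "\<And>z. gsb t s h (C * exp (r * wt t s z)) (tfs z f)"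
    using tfs_bound[OF t s assms hB(1)] by blast
  have C0: "C \<ge> 0" using gsb_nonneg[OF C[of 0]] by (simp add: zero_le_mult_iff)
  have "norm (u (tfs z f)) \<le> (B * C) * exp (max r 0 * wt t s z)" for z
  proof -
    have "norm (u (tfs z f)) \<le> B * (C * exp (r * wt t s z))"
      by (intro hB tfs_in_gs_space t s assms C)
    also have "\<dots> \<le> B * (C * exp (max r 0 * wt t s z))"
      using hB C0 wt_nonneg[of t s z] by (intro mult_left_mono) (auto intro: mult_right_mono)
    finally show ?thesis by simp
  qed
  then show ?thesis using hB C0 by (intro exI[of _ "B * C"] exI[of _ "max r 0"]) auto
qed

lemma continuous_on_u_tfs:
  assumes "f \<in> gs_space t s"
  shows "continuous_on UNIV (\<lambda>z. u (tfs z f))"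
proof -
  obtain h B where hB: "h > 0" "B \<ge> 0" "\<And>f C. f \<in> gs_space t s \<Longrightarrow> gsb t s h C f \<Longrightarrow> norm (u f) \<le> B * C"
    using u_bound by blast
  obtain C r where C: "\<And>z z'. gsb t s h (C * (norm (fst z - fst z') + norm (snd z - snd z')) *
     exp (r * (wt t s z + wt t s z'))) (\<lambda>y. tfs z f y - tfs z' f y)"
    using tfs_diff_bound[OF t s assms hB(1)] by blast
  have "norm (u (tfs z f) - u (tfs z' f)) \<le> (B * C) * (norm (fst z - fst z') + norm (snd z - snd z')) *
     exp (r * (wt t s z + wt t s z'))" for z z'
    using hB(3)[OF gs_space_diff[OF t s tfs_in_gs_space[OF t s assms] tfs_in_gs_space[OF t s assms]] C, of z z']
    by (simp add: u_diff[OF tfs_in_gs_space[OF t s assms] tfs_in_gs_space[OF t s assms]] mult.assoc)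
  then show ?thesis by (rule continuous_on_of_wt_lipschitz[OF t s])
qed

end

section \<open>Reconstruction of a test function from its short-time Fourier transform\<close>

context
  fixes t s :: real and \<psi> :: "real ^ 'n::finite \<Rightarrow> complex"
  assumes t: "t > 0" and s: "s > 0" and \<psi>: "\<psi> \<in> gs_space t s"
begin

lemma continuous_on_derivs_tfs: "continuous_on UNIV (\<lambda>z. derivs w (tfs z \<psi>) y)"
proof -
  obtain C r where C: "\<And>z z'. gsb t s 1 (C * (norm (fst z - fst z') + norm (snd z - snd z')) *
     exp (r * (wt t s z + wt t s z'))) (\<lambda>y. tfs z \<psi> y - tfs z' \<psi> y)"
    using tfs_diff_bound[OF t s \<psi> zero_less_one] by blast
  have "norm (derivs w (tfs z \<psi>) y - derivs w (tfs z' \<psi>) y) \<le> (C * fact (length w) powr s) * (norm (fst z - fst z') + norm (snd z - snd z')) *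
     exp (r * (wt t s z + wt t s z'))" for z z'
    using gsbD[OF C, of y 0 w z z']
    by (simp add: derivs_diff gs_space_smooth[OF tfs_in_gs_space[OF t s \<psi>]] mult_ac)
  then show ?thesis by (rule continuous_on_of_wt_lipschitz[OF t s])
qed

lemma sv_eq: "sv \<psi> f z = of_real (cd TYPE('n)) * (LINT y|lborel. f y * cnj (tfs z \<psi> y))"
proof -
  have "wave (- snd z) y * (f y * cnj (translate (fst z) \<psi> y)) = f y * cnj (tfs z \<psi> y)" for y
    by (simp add: tfs_apply translate_def exp_cnj mult_ac)
  then show ?thesis unfolding sv_def fourier_eq by presburger
qed

lemma continuous_on_sv:
  assumes f: "f \<in> gs_space t s"
  shows "continuous_on UNIV (sv \<psi> f)"
proof -
  obtain C r where C: "\<And>z z'. gsb t s 1 (C * (norm (fst z - fst z') + norm (snd z - snd z')) *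
     exp (r * (wt t s z + wt t s z'))) (\<lambda>y. tfs z \<psi> y - tfs z' \<psi> y)"
    using tfs_diff_bound[OF t s \<psi> zero_less_one] by blast
  let ?c = "cd TYPE('n)"
  have rf: "rapid f" by (rule gs_space_rapid[OF t s f])
  have int: "integrable lborel (\<lambda>y. f y * cnj (tfs z \<psi> y))" for z
    by (intro rapid_integrable rapid_slow_mult rapid_slow gs_space_rapid[OF t s] gs_space_cnj tfs_in_gs_space f \<psi> t s)
  have "norm (sv \<psi> f z - sv \<psi> f z') \<le> (?c * C * (LINT y|lborel. norm (f y))) * (norm (fst z - fst z') + norm (snd z - snd z')) *
     exp (r * (wt t s z + wt t s z'))" for z z'
  proof -
    let ?Q = "C * (norm (fst z - fst z') + norm (snd z - snd z')) * exp (r * (wt t s z + wt t s z'))"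
    have "sv \<psi> f z - sv \<psi> f z' = of_real ?c * (LINT y|lborel. f y * cnj (tfs z \<psi> y) - f y * cnj (tfs z' \<psi> y))"
      unfolding sv_eq by (subst Bochner_Integration.integral_diff[OF int int]) (simp add: right_diff_distrib)
    also have "norm \<dots> = ?c * norm (LINT y|lborel. f y * cnj (tfs z \<psi> y) - f y * cnj (tfs z' \<psi> y))"
      using cd_pos[where 'n = 'n] by (simp add: norm_mult)
    also have "\<dots> \<le> ?c * (LINT y|lborel. norm (f y) * ?Q)"
    proof (intro mult_left_mono order_trans[OF integral_norm_bound] integral_mono)
      show "integrable lborel (\<lambda>y. norm (f y * cnj (tfs z \<psi> y) - f y * cnj (tfs z' \<psi> y)))"
        by (intro integrable_norm Bochner_Integration.integrable_diff int)
      show "integrable lborel (\<lambda>y. norm (f y) * ?Q)"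
        by (intro integrable_mult_left integrable_norm rapid_integrable rf)
      fix y
      have "norm (f y * cnj (tfs z \<psi> y) - f y * cnj (tfs z' \<psi> y)) = norm (f y) * norm (tfs z \<psi> y - tfs z' \<psi> y)"
        by (metis complex_cnj_diff complex_mod_cnj norm_mult right_diff_distrib)
      also have "\<dots> \<le> norm (f y) * ?Q"
        using gsbD[OF C, of y 0 "[]" z z'] by (intro mult_left_mono) auto
      finally show "norm (f y * cnj (tfs z \<psi> y) - f y * cnj (tfs z' \<psi> y)) \<le> norm (f y) * ?Q" .
    qed (use cd_pos[where 'n = 'n] in auto)
    finally show ?thesis by (simp add: mult_ac)
  qed
  then show ?thesis by (rule continuous_on_of_wt_lipschitz[OF t s])
qed

lemma tfs_derivs_bound: "\<exists>C r. C \<ge> 0 \<and> r \<ge> 0 \<and> (\<forall>z y. norm (derivs w (tfs z \<psi>) y) \<le> C * exp (r * wt t s z))"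
proof -
  obtain C r where C: "\<And>z. gsb t s 1 (C * exp (r * wt t s z)) (tfs z \<psi>)"
    using tfs_bound[OF t s \<psi> zero_less_one] by blast
  have C0: "C \<ge> 0" using gsb_nonneg[OF C[of 0]] by (simp add: zero_le_mult_iff)
  have "norm (derivs w (tfs z \<psi>) y) \<le> (C * fact (length w) powr s) * exp (max r 0 * wt t s z)" for z y
  proof -
    have "norm (derivs w (tfs z \<psi>) y) \<le> (C * fact (length w) powr s) * exp (r * wt t s z)"
      using gsbD[OF C, of y 0 w z] by (simp add: mult_ac)
    also have "\<dots> \<le> (C * fact (length w) powr s) * exp (max r 0 * wt t s z)"
      using C0 wt_nonneg[of t s z] by (intro mult_left_mono) (auto intro: mult_right_mono)
    finally show ?thesis .
  qed
  then show ?thesis using C0 by (intro exI[of _ "C * fact (length w) powr s"] exI[of _ "max r 0"]) auto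
qed

lemma sv_derivs_tfs_bound:
  assumes f: "f \<in> gs_space t s"
  shows "\<exists>C\<ge>0. \<forall>z y. norm (sv \<psi> f z * derivs w (tfs z \<psi>) y) \<le> C * exp (- wt t s z)"
proof -
  obtain C r where C: "C \<ge> 0" "\<And>z y. norm (derivs w (tfs z \<psi>) y) \<le> C * exp (r * wt t s z)"
    using tfs_derivs_bound by blast
  \<comment> \<open>One unit of decay more than the growth r leaves the integrable factor exp (-
    wt).\<close>
  obtain C' where C': "C' \<ge> 0" "\<And>z. norm (sv \<psi> f z) \<le> C' * exp (- ((r + 1) * wt t s z))"
    using sv_decay[OF t s f \<psi>] by blast
  have "norm (sv \<psi> f z * derivs w (tfs z \<psi>) y) \<le> (C' * C) * exp (- wt t s z)" for z y
  proof -
    have "norm (sv \<psi> f z * derivs w (tfs z \<psi>) y) \<le> (C' * exp (- ((r + 1) * wt t s z))) * (C * exp (r * wt t s z))"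
      unfolding norm_mult using C' by (intro mult_mono C C') auto
    also have "\<dots> = (C' * C) * (exp (- ((r + 1) * wt t s z)) * exp (r * wt t s z))" by (simp only: mult_ac)
    also have "exp (- ((r + 1) * wt t s z)) * exp (r * wt t s z) = exp (- wt t s z)"
      unfolding exp_add[symmetric] by (simp add: algebra_simps)
    finally show ?thesis .
  qed
  then show ?thesis using C C' by (intro exI[of _ "C' * C"]) auto
qed

text \<open>For fixed position x the frequency integral is Fourier inversion for f times the
  conjugate translated window, giving f y * norm (\<psi> (y - x))^2 up to the constant; integrating
  over x then gives the squared norm of \<psi>.\<close>

lemma stft_reconstruction_0:
  assumes f: "f \<in> gs_space t s"
  shows "(LINT z|lborel. sv \<psi> f z * tfs z \<psi> y) = f y * of_real ((LINT x|lborel. norm (\<psi> x) ^ 2) / cd TYPE('n))"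
proof -
  let ?f = "\<lambda>z. sv \<psi> f z * tfs z \<psi> y"
  let ?c = "complex_of_real (cd TYPE('n))"
  obtain C where C: "C \<ge> 0" "\<And>z y. norm (sv \<psi> f z * derivs [] (tfs z \<psi>) y) \<le> C * exp (- wt t s z)"
    using sv_derivs_tfs_bound[OF f] by blast
  have [measurable]: "sv \<psi> f \<in> borel_measurable borel" "(\<lambda>z. tfs z \<psi> y) \<in> borel_measurable borel"
    using continuous_on_sv[OF f] continuous_on_derivs_tfs[of "[]" y] by (auto intro: borel_measurable_continuous_onI)
  have int: "integrable lborel ?f"
  proof (rule Bochner_Integration.integrable_bound[OF _ _ AE_I2])
    show "integrable lborel (\<lambda>z :: (real ^ 'n) \<times> (real ^ 'n). C * exp (- wt t s z))"
      by (intro integrable_mult_right integrable_exp_wt t s)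
    show "norm (?f z) \<le> norm (C * exp (- wt t s z))" for z
      using C(2)[of z y] by (simp add: C(1))
  qed measurable
  have rp: "rapid \<psi>" by (rule gs_space_rapid[OF t s \<psi>])
  let ?N = "\<lambda>x. complex_of_real (norm (\<psi> x) ^ 2)"
  have N: "?N = (\<lambda>x. cnj (\<psi> x) * \<psi> x)"
    by (rule ext) (simp only: complex_norm_square mult.commute)
  have iN: "integrable lborel ?N"
    unfolding N by (intro rapid_integrable rapid_slow_mult rapid_slow gs_space_rapid[OF t s] gs_space_cnj t s \<psi>)
  have inner: "(LINT \<xi>|lborel. ?f (x, \<xi>)) = f y * ?N (y - x) / ?c" for x
  proof -
    let ?F = "\<lambda>y. f y * cnj (translate x \<psi> y)"
    have "(LINT \<xi>|lborel. ?f (x, \<xi>)) = (LINT \<xi>|lborel. \<psi> (y - x) * (wave y \<xi> * fourier ?F \<xi>))"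
      by (simp add: sv_def tfs_apply inner_commute mult_ac)
    also have "\<dots> = \<psi> (y - x) * (LINT \<xi>|lborel. wave y \<xi> * fourier ?F \<xi>)" by (rule integral_mult_right_zero)
    also have "(LINT \<xi>|lborel. wave y \<xi> * fourier ?F \<xi>) = fourier (fourier ?F) (- y) / ?c"
      using cd_pos[where 'n = 'n] by (simp add: fourier_eq[of "fourier ?F"])
    also have "fourier (fourier ?F) (- y) = ?F y"
      by (rule fourier_inversion[OF rapid_sv[OF t s f \<psi>]])
    finally show ?thesis
      unfolding complex_norm_square[of "\<psi> (y - x)"] by (simp add: translate_def mult_ac)
  qed
  have "(LINT z|lborel. ?f z) = (LINT z|(lborel \<Otimes>\<^sub>M lborel). ?f z)" by (simp only: lborel_prod)
  also have "\<dots> = (LINT x|lborel. (LINT \<xi>|lborel. ?f (x, \<xi>)))"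
    using lborel_pair.integral_fst'[of ?f] int by (simp only: lborel_prod)
  also have "\<dots> = (LINT x|lborel. (f y / ?c) * ?N (y - x))" unfolding inner by simp
  also have "\<dots> = (f y / ?c) * (LINT x|lborel. ?N (y - x))" by (rule integral_mult_right_zero)
  also have "(LINT x|lborel. ?N (y - x)) = (LINT x|lborel. ?N x)"
    using lborel_integral_affine[OF iN, of "-1" y] by simp
  also have "\<dots> = of_real (LINT x|lborel. norm (\<psi> x) ^ 2)" by (rule integral_complex_of_real)
  finally show ?thesis by simp
qed

text \<open>The seminorm bounding u sees all derivatives, so the reconstruction is needed for each
  of them; they pass under the integral by \<open>derivs_integral\<close>.\<close>

lemma stft_reconstruction:
  assumes f: "f \<in> gs_space t s"
  shows "(LINT z|lborel. sv \<psi> f z * derivs w (tfs z \<psi>) y) = derivs w f y * of_real ((LINT x|lborel. norm (\<psi> x) ^ 2) / cd TYPE('n))"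
proof -
  let ?G = "\<lambda>z y. sv \<psi> f z * tfs z \<psi> y"
  let ?k = "complex_of_real ((LINT x|lborel. norm (\<psi> x) ^ 2) / cd TYPE('n))"
  have sm: "smooth (tfs z \<psi>)" for z using gs_space_smooth[OF tfs_in_gs_space[OF t s \<psi>]] .
  have dG: "derivs w (?G z) y = sv \<psi> f z * derivs w (tfs z \<psi>) y" for w z y
    by (simp add: derivs_cmult sm)
  have meas: "(\<lambda>z. derivs w (?G z) y) \<in> borel_measurable lborel" for w y
    unfolding dG using continuous_on_sv[OF f] continuous_on_derivs_tfs[of w y]
    by (auto intro: borel_measurable_continuous_onI continuous_on_mult)
  have bnd: "\<exists>K. integrable lborel K \<and> (\<forall>z. \<forall>x\<in>ball y 1. norm (derivs w (?G z) x) \<le> K z)" for w and y :: "real ^ 'n"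
  proof -
    obtain C where C: "C \<ge> 0" "\<And>z y. norm (sv \<psi> f z * derivs w (tfs z \<psi>) y) \<le> C * exp (- wt t s z)"
      using sv_derivs_tfs_bound[OF f] by blast
    have "integrable lborel (\<lambda>z :: (real ^ 'n) \<times> (real ^ 'n). C * exp (- wt t s z))"
      by (intro integrable_mult_right integrable_exp_wt t s)
    then show ?thesis unfolding dG using C by blast
  qed
  have smG: "smooth (?G z)" for z by (intro smooth_cmult sm)
  have "(\<lambda>y. (LINT z|lborel. ?G z y)) = (\<lambda>y. ?k * f y)"
    using stft_reconstruction_0[OF f] by (simp add: mult.commute)
  then have "derivs w (\<lambda>y. ?k * f y) y = (LINT z|lborel. derivs w (?G z) y)"
    using derivs_integral[OF smG meas bnd] by metis
  then show ?thesis unfolding dG derivs_cmult[OF gs_space_smooth[OF f]] by (simp add: mult.commute)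
qed

end

text \<open>The functional u commutes with the integral: replace z by simple functions of z, for which the
  integral is a finite sum, and use that z \<open>\<mapsto>\<close> \<open>tfs z \<psi>\<close> is locally Lipschitz in the seminorm that
  bounds u. The two components of z are approximated separately since \<open>wt\<close> weighs them differently.\<close>

lemma (in gs_pairing) u_integral:
  fixes F :: "(real ^ 'n) \<times> (real ^ 'n) \<Rightarrow> complex"
  assumes \<psi>: "\<psi> \<in> gs_space t s" and f: "f \<in> gs_space t s"
    and F [measurable]: "F \<in> borel_measurable borel"
    and decay: "\<And>r. \<exists>C\<ge>0. \<forall>z. norm (F z) \<le> C * exp (- (r * wt t s z))"
    and rec: "\<And>w y. derivs w f y = (LINT z|lborel. F z * derivs w (tfs z \<psi>) y)"
  shows "u f = (LINT z|lborel. cnj (F z) * u (tfs z \<psi>))"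
proof -
  let ?M = "lborel :: ((real ^ 'n) \<times> (real ^ 'n)) measure"
  note tg = tfs_in_gs_space[OF t s \<psi>]
  have [measurable]: "wt t s \<in> borel_measurable (borel :: ((real ^ 'n) \<times> (real ^ 'n)) measure)" using wt_measurable[OF t s] .
  have [measurable]: "(\<lambda>z. u (tfs z \<psi>)) \<in> borel_measurable borel"
    by (intro borel_measurable_continuous_onI continuous_on_u_tfs \<psi>)
  have smf: "smooth f" "smooth (tfs z \<psi>)" for z using gs_space_smooth[OF f] gs_space_smooth[OF tg] by auto
  obtain h B where hB: "h > 0" "B \<ge> 0" "\<And>f C. f \<in> gs_space t s \<Longrightarrow> gsb t s h C f \<Longrightarrow> norm (u f) \<le> B * C"
    using u_bound by blast
  obtain C r where C: "\<And>z z'. gsb t s h (C * (norm (fst z - fst z') + norm (snd z - snd z')) *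
     exp (r * (wt t s z + wt t s z'))) (\<lambda>y. tfs z \<psi> y - tfs z' \<psi> y)"
    using tfs_diff_bound[OF t s \<psi> hB(1)] by blast
  define Q where "Q = (\<lambda>z z'. C * (norm (fst z - fst z') + norm (snd z - snd z' :: real ^ 'n)) * exp (r * (wt t s z + wt t s z')))"
  have Qb: "gsb t s h (Q z z') (\<lambda>y. tfs z \<psi> y - tfs z' \<psi> y)" for z z' using C by (simp add: Q_def)
  have Q0: "Q z z' \<ge> 0" for z z' using Qb by (rule gsb_nonneg)
  \<comment> \<open>\<open>tfs_diff_bound\<close> gives no sign for its constant; two distinct
    shifts determine it.\<close>
  have C0: "C \<ge> 0"
  proof -
    obtain b :: "real ^ 'n" where "b \<noteq> 0" using nonzero_Basis SOME_Basis by blast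
    then show ?thesis using Q0[of "(b, 0)" 0] by (simp add: Q_def zero_le_mult_iff)
  qed
  have uQ: "norm (u (tfs z \<psi>) - u (tfs z' \<psi>)) \<le> B * Q z z'" for z z'
    using hB(3)[OF gs_space_diff[OF t s tg tg] Qb] by (simp add: u_diff[OF tg tg])
  have "fst \<in> borel_measurable ?M" "snd \<in> borel_measurable ?M"
    by (auto intro!: borel_measurable_continuous_onI continuous_intros)
  \<comment> \<open>The approximation comes with norm (a i z) \<le> 2 * norm (fst z), which keeps
    the weight of the approximating point comparable to that of z.\<close>
  obtain a where a: "\<And>i. simple_function ?M (a i)" "\<And>x. (\<lambda>i. a i x) \<longlonglongrightarrow> fst x" "\<And>i x. dist (a i x) 0 \<le> 2 * dist (fst x) 0"
    using borel_measurable_implies_sequence_metric[OF \<open>fst \<in> borel_measurable ?M\<close>, of 0, unfolded space_lborel space_borel] by blast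
  obtain b where b: "\<And>i. simple_function ?M (b i)" "\<And>x. (\<lambda>i. b i x) \<longlonglongrightarrow> snd x" "\<And>i x. dist (b i x) 0 \<le> 2 * dist (snd x) 0"
    using borel_measurable_implies_sequence_metric[OF \<open>snd \<in> borel_measurable ?M\<close>, of 0, unfolded space_lborel space_borel] by blast
  define S where "S = (\<lambda>i z. (a i z, b i z))"
  have Ssf: "simple_function ?M (S i)" for i
    unfolding S_def by (intro simple_function_Pair a b)
  have [measurable]: "a i \<in> borel_measurable borel" "b i \<in> borel_measurable borel" for i
    using borel_measurable_simple_function[OF a(1)] borel_measurable_simple_function[OF b(1)] by auto
  have SQ [measurable]: "(\<lambda>z. Q z (S i z)) \<in> borel_measurable borel" for i
  proof -
    have [measurable]: "(\<lambda>z. wt t s (a i z, b i z)) \<in> borel_measurable borel"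
      unfolding wt_def by simp
    have [measurable]: "(\<lambda>z. norm (fst z - a i z) + norm (snd z - b i z)) \<in> borel_measurable borel"
      using \<open>fst \<in> borel_measurable ?M\<close> \<open>snd \<in> borel_measurable ?M\<close> by simp
    show ?thesis unfolding Q_def S_def fst_conv snd_conv by measurable
  qed
  \<comment> \<open>Effect on \<open>wt\<close> of doubling both components.\<close>
  define \<kappa> where "\<kappa> = max (2 powr (1 / t)) (2 powr (1 / s))"
  have wS: "wt t s (S i z) \<le> \<kappa> * wt t s z" for i z
  proof -
    have "norm (a i z) powr (1 / t) \<le> (2 * norm (fst z)) powr (1 / t)"
      using a(3)[of i z] t by (intro powr_mono2) auto
    also have "\<dots> \<le> \<kappa> * norm (fst z) powr (1 / t)"
      by (simp add: powr_mult \<kappa>_def mult_right_mono)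
    finally have 1: "norm (a i z) powr (1 / t) \<le> \<kappa> * norm (fst z) powr (1 / t)" .
    have "norm (b i z) powr (1 / s) \<le> (2 * norm (snd z)) powr (1 / s)"
      using b(3)[of i z] s by (intro powr_mono2) auto
    also have "\<dots> \<le> \<kappa> * norm (snd z) powr (1 / s)"
      by (simp add: powr_mult \<kappa>_def mult_right_mono)
    finally show ?thesis using 1 by (simp add: wt_def S_def distrib_left)
  qed
  obtain C1 where C1: "C1 > 0" "\<And>x :: real ^ 'n. norm x \<le> C1 * exp (norm x powr (1 / t))" using norm_le_exp[OF t] by blast
  obtain C2 where C2: "C2 > 0" "\<And>x :: real ^ 'n. norm x \<le> C2 * exp (norm x powr (1 / s))" using norm_le_exp[OF s] by blast
  \<comment> \<open>The summand 1 pays for the norms in \<open>Q\<close>, which are below a multiple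
    of exp (wt); the rest pays for its exponential.\<close>
  define \<rho> where "\<rho> = 1 + max r 0 * (1 + \<kappa>)"
  have QS: "Q z (S i z) \<le> (C * (3 * (C1 + C2))) * exp (\<rho> * wt t s z)" for i z
  proof -
    have "norm (fst z - a i z) \<le> 3 * norm (fst z)" "norm (snd z - b i z) \<le> 3 * norm (snd z)"
      using a(3)[of i z] b(3)[of i z] norm_triangle_ineq4[of "fst z" "a i z"] norm_triangle_ineq4[of "snd z" "b i z"] by auto
    moreover have "norm (fst z) \<le> C1 * exp (wt t s z)"
      by (rule order_trans[OF C1(2)]) (use C1 in \<open>simp add: wt_def\<close>)
    moreover have "norm (snd z) \<le> C2 * exp (wt t s z)"
      by (rule order_trans[OF C2(2)]) (use C2 in \<open>simp add: wt_def\<close>)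
    ultimately have 1: "norm (fst z - fst (S i z)) + norm (snd z - snd (S i z)) \<le> 3 * (C1 + C2) * exp (wt t s z)"
      by (simp add: S_def distrib_left distrib_right)
    have "r * (wt t s z + wt t s (S i z)) \<le> max r 0 * (wt t s z + wt t s (S i z))"
      using wt_nonneg[of t s z] wt_nonneg[of t s "S i z"] by (intro mult_right_mono) auto
    also have "\<dots> \<le> max r 0 * (wt t s z + \<kappa> * wt t s z)" by (intro mult_left_mono add_left_mono wS) auto
    finally have 2: "exp (r * (wt t s z + wt t s (S i z))) \<le> exp (max r 0 * (1 + \<kappa>) * wt t s z)"
      by (simp add: algebra_simps)
    have "Q z (S i z) \<le> C * (3 * (C1 + C2) * exp (wt t s z)) * exp (max r 0 * (1 + \<kappa>) * wt t s z)"
      unfolding Q_def using C0 C1(1) C2(1) by (intro mult_mono mult_left_mono 1 2) auto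
    also have "\<dots> = (C * (3 * (C1 + C2))) * (exp (wt t s z) * exp (max r 0 * (1 + \<kappa>) * wt t s z))" by simp
    also have "exp (wt t s z) * exp (max r 0 * (1 + \<kappa>) * wt t s z) = exp (\<rho> * wt t s z)"
      unfolding exp_add[symmetric] \<rho>_def by (simp add: distrib_right)
    finally show ?thesis .
  qed
  obtain CF where CF: "CF \<ge> 0" "\<And>z. norm (F z) \<le> CF * exp (- ((\<rho> + 1) * wt t s z))" using decay by blast
  define D where "D = CF * (C * (3 * (C1 + C2)))"
  have D: "norm (F z) * Q z (S i z) \<le> D * exp (- wt t s z)" for i z
  proof -
    have "norm (F z) * Q z (S i z) \<le> (CF * exp (- ((\<rho> + 1) * wt t s z))) * ((C * (3 * (C1 + C2))) * exp (\<rho> * wt t s z))"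
      using CF Q0 by (intro mult_mono QS CF) auto
    also have "\<dots> = D * (exp (- ((\<rho> + 1) * wt t s z)) * exp (\<rho> * wt t s z))" by (simp only: D_def mult_ac)
    also have "exp (- ((\<rho> + 1) * wt t s z)) * exp (\<rho> * wt t s z) = exp (- wt t s z)"
      unfolding exp_add[symmetric] by (simp add: algebra_simps)
    finally show ?thesis .
  qed
  have iD: "integrable ?M (\<lambda>z. c * exp (- wt t s z))" for c :: real
    by (intro integrable_mult_right integrable_exp_wt t s)
  \<comment> \<open>One number per approximation, valid for every weight and derivative at once;
    this is what makes the convergence one in the seminorm that bounds u.\<close>
  define I where "I = (\<lambda>i. LINT z|?M. norm (F z) * Q z (S i z))"
  have iI: "integrable ?M (\<lambda>z. norm (F z) * Q z (S i z))" for i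
  proof (rule Bochner_Integration.integrable_bound[OF iD[of D] _ AE_I2])
    show "norm (norm (F z) * Q z (S i z)) \<le> norm (D * exp (- wt t s z))" for z
      using order_trans[OF D[of z i] abs_ge_self]
      by (simp only: real_norm_def abs_of_nonneg[OF mult_nonneg_nonneg[OF norm_ge_zero Q0]])
  qed measurable
  have I0: "I \<longlonglongrightarrow> 0"
  proof -
    have "I \<longlonglongrightarrow> (LINT z|?M. 0)"
      unfolding I_def
    proof (rule integral_dominated_convergence[OF _ _ iD[of D]])
      show "AE z in ?M. (\<lambda>i. norm (F z) * Q z (S i z)) \<longlonglongrightarrow> 0"
      proof (intro AE_I2)
        fix z
        have 1: "(\<lambda>i. fst (S i z)) \<longlonglongrightarrow> fst z" "(\<lambda>i. snd (S i z)) \<longlonglongrightarrow> snd z"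
          using a(2) b(2) by (auto simp: S_def)
        have 2: "(\<lambda>i. wt t s (S i z)) \<longlonglongrightarrow> wt t s z"
          unfolding wt_def using t s by (intro tendsto_intros tendsto_powr' 1) auto
        have "(\<lambda>i. norm (F z) * Q z (S i z)) \<longlonglongrightarrow> norm (F z) * Q z z"
          unfolding Q_def by (intro tendsto_intros 1 2)
        then show "(\<lambda>i. norm (F z) * Q z (S i z)) \<longlonglongrightarrow> 0" by (simp add: Q_def)
      qed
      show "AE z in ?M. norm (norm (F z) * Q z (S i z)) \<le> D * exp (- wt t s z)" for i
        using D Q0 by (intro AE_I2) (simp add: abs_mult)
    qed measurable
    then show ?thesis by simp
  qed
  have iF: "integrable ?M F"
  proof -
    obtain c where c: "c \<ge> 0" "\<And>z. norm (F z) \<le> c * exp (- (1 * wt t s z))" using decay by blast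
    show ?thesis
      by (rule Bochner_Integration.integrable_bound[OF iD[of c] _ AE_I2]) (use c in auto)
  qed
  have iFg: "integrable ?M (\<lambda>z. F z * G z)"
    if G: "G \<in> borel_measurable borel" "\<And>z. norm (G z) \<le> c * exp (q * wt t s z)" for G c q
  proof -
    obtain c' where c': "c' \<ge> 0" "\<And>z. norm (F z) \<le> c' * exp (- ((q + 1) * wt t s z))" using decay by blast
    have "norm (F z * G z) \<le> norm ((c' * c) * exp (- wt t s z))" for z
    proof -
      have "norm (F z * G z) \<le> (c' * exp (- ((q + 1) * wt t s z))) * (c * exp (q * wt t s z))"
        unfolding norm_mult using c' by (intro mult_mono c' G) auto
      also have "\<dots> = (c' * c) * (exp (- ((q + 1) * wt t s z)) * exp (q * wt t s z))" by (simp only: mult_ac)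
      also have "exp (- ((q + 1) * wt t s z)) * exp (q * wt t s z) = exp (- wt t s z)"
        unfolding exp_add[symmetric] by (simp add: algebra_simps)
      finally show ?thesis by (rule order_trans) simp
    qed
    with G(1) show ?thesis
      by (intro Bochner_Integration.integrable_bound[OF iD[of "c' * c"] _ AE_I2]) auto
  qed
  define c where "c = (\<lambda>i k. LINT z|?M. indicator {z. S i z = k} z *\<^sub>R F z)"
  define f' where "f' = (\<lambda>i y. \<Sum>k\<in>range (S i). c i k * tfs k \<psi> y)"
  have fin: "finite (range (S i))" for i using Ssf[of i] by (simp add: simple_function_def)
  have f'gs: "f' i \<in> gs_space t s" for i
    unfolding f'_def by (intro gs_space_sum gs_space_cmult t s tg)
  \<comment> \<open>The approximating function is a finite sum, so here u and derivatives commute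
    with the integral by linearity.\<close>
  have derf': "derivs w (f' i) y = (LINT z|?M. F z * derivs w (tfs (S i z) \<psi>) y)" for w i y
    unfolding f'_def simple_function_integral_sum(1)[OF iF Ssf[of i], of "\<lambda>k. derivs w (tfs k \<psi>) y", simplified] c_def
    by (simp add: derivs_sum derivs_cmult fin smf smooth_cmult)
  have est: "gsb t s h (I i) (\<lambda>y. f y - f' i y)" for i
    unfolding gsb_def
  proof (intro conjI allI)
    show "smooth (\<lambda>y. f y - f' i y)" by (intro smooth_diff smf gs_space_smooth[OF f'gs])
    fix m and w :: "'n list" and y
    let ?P = "h ^ (m + length w) * fact m powr t * fact (length w) powr s"
    obtain cc q where cc: "\<And>z y. norm (derivs w (tfs z \<psi>) y) \<le> cc * exp (q * wt t s z)" using tfs_derivs_bound[OF t s \<psi>] by blast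
    have i1: "integrable ?M (\<lambda>z. F z * derivs w (tfs z \<psi>) y)"
      by (rule iFg[OF borel_measurable_continuous_onI[OF continuous_on_derivs_tfs[OF t s \<psi>]] cc])
    have i2: "integrable ?M (\<lambda>z. F z * derivs w (tfs (S i z) \<psi>) y)"
      using simple_function_integral_sum(2)[OF iF Ssf[of i], of "\<lambda>k. derivs w (tfs k \<psi>) y"] by simp
    have "derivs w (\<lambda>y. f y - f' i y) y = (LINT z|?M. F z * derivs w (tfs z \<psi>) y - F z * derivs w (tfs (S i z) \<psi>) y)"
      unfolding Bochner_Integration.integral_diff[OF i1 i2] rec[symmetric] derf'[symmetric]
      by (simp add: derivs_diff smf gs_space_smooth[OF f'gs])
    then have "norm y ^ m * norm (derivs w (\<lambda>y. f y - f' i y) y) \<le>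
        norm y ^ m * (LINT z|?M. norm (F z * derivs w (tfs z \<psi>) y - F z * derivs w (tfs (S i z) \<psi>) y))"
      by (simp add: mult_left_mono integral_norm_bound)
    also have "\<dots> = (LINT z|?M. norm y ^ m * norm (F z * derivs w (tfs z \<psi>) y - F z * derivs w (tfs (S i z) \<psi>) y))"
      by (rule integral_mult_right_zero[symmetric])
    also have "\<dots> \<le> (LINT z|?M. (norm (F z) * Q z (S i z)) * ?P)"
    proof (intro integral_mono integrable_mult_right integrable_norm Bochner_Integration.integrable_diff i1 i2 integrable_mult_left iI)
      fix z
      have "norm y ^ m * norm (derivs w (tfs z \<psi>) y - derivs w (tfs (S i z) \<psi>) y) \<le> Q z (S i z) * ?P"
        using gsbD[OF Qb[of z "S i z"], of y m w] by (simp add: derivs_diff smf mult_ac)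
      then have "norm (F z) * (norm y ^ m * norm (derivs w (tfs z \<psi>) y - derivs w (tfs (S i z) \<psi>) y)) \<le> norm (F z) * (Q z (S i z) * ?P)"
        by (rule mult_left_mono) simp
      then show "norm y ^ m * norm (F z * derivs w (tfs z \<psi>) y - F z * derivs w (tfs (S i z) \<psi>) y) \<le> (norm (F z) * Q z (S i z)) * ?P"
        by (simp add: norm_mult mult_ac flip: right_diff_distrib)
    qed
    also have "\<dots> = I i * ?P" unfolding I_def by (rule integral_mult_left_zero)
    finally show "norm y ^ m * norm (derivs w (\<lambda>y. f y - f' i y) y) \<le> I i * h ^ (m + length w) * fact m powr t * fact (length w) powr s"
      by (simp add: mult_ac)
  qed
  let ?U = "LINT z|?M. cnj (F z) * u (tfs z \<psi>)"
  obtain cu q where cu: "\<And>z. norm (u (tfs z \<psi>)) \<le> cu * exp (q * wt t s z)" using u_tfs_growth[OF \<psi>] by blast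
  have iU: "integrable ?M (\<lambda>z. cnj (F z) * u (tfs z \<psi>))"
  proof -
    have "integrable ?M (\<lambda>z. F z * cnj (u (tfs z \<psi>)))" 
      by (rule iFg[OF borel_measurable_continuous_onI[OF continuous_on_cnj[OF continuous_on_u_tfs[OF \<psi>]]], of cu q])
         (simp only: complex_mod_cnj cu)
    then have "integrable ?M (\<lambda>z. cnj (F z * cnj (u (tfs z \<psi>))))" by (simp only: complex_integrable_cnj)
    then show ?thesis by simp
  qed
  have icF: "integrable ?M (\<lambda>z. cnj (F z))" using iF by (simp only: complex_integrable_cnj)
  have iUS: "integrable ?M (\<lambda>z. cnj (F z) * u (tfs (S i z) \<psi>))" for i
    using simple_function_integral_sum(2)[OF icF Ssf[of i], of "\<lambda>k. u (tfs k \<psi>)"] by simp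
  have uf': "u (f' i) = (LINT z|?M. cnj (F z) * u (tfs (S i z) \<psi>))" for i
  proof -
    have "cnj (c i k) = (LINT z|?M. indicator {z. S i z = k} z *\<^sub>R cnj (F z))" for k
    proof -
      have "(\<lambda>z. indicator {z. S i z = k} z *\<^sub>R cnj (F z)) = (\<lambda>z. cnj (indicator {z. S i z = k} z *\<^sub>R F z))" by simp
      then show ?thesis unfolding c_def by (simp only: Bochner_Integration.integral_cnj)
    qed
    then show ?thesis
      unfolding f'_def u_sum[OF fin tg] using simple_function_integral_sum(1)[OF icF Ssf[of i], of "\<lambda>k. u (tfs k \<psi>)"] by simp
  qed
  \<comment> \<open>u of the approximation is compared with both sides; each comparison costs B * I
    i, once through the seminorm of f - f' i and once through the Lipschitz bound of u on
    shifts.\<close>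
  have "norm (u f - ?U) \<le> 2 * B * I i" for i
  proof -
    have 1: "norm (u f - u (f' i)) \<le> B * I i"
      using hB(3)[OF gs_space_diff[OF t s f f'gs] est, of i] by (simp add: u_diff[OF f f'gs])
    have "norm (?U - u (f' i)) \<le> (LINT z|?M. norm (cnj (F z) * u (tfs z \<psi>) - cnj (F z) * u (tfs (S i z) \<psi>)))"
      unfolding uf' Bochner_Integration.integral_diff[OF iU iUS, symmetric] by (rule integral_norm_bound)
    also have "\<dots> \<le> (LINT z|?M. B * (norm (F z) * Q z (S i z)))"
    proof (intro integral_mono integrable_norm Bochner_Integration.integrable_diff iU iUS integrable_mult_right iI)
      fix z
      show "norm (cnj (F z) * u (tfs z \<psi>) - cnj (F z) * u (tfs (S i z) \<psi>)) \<le> B * (norm (F z) * Q z (S i z))"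
        using mult_left_mono[OF uQ[of z "S i z"], of "norm (F z)"]
        by (simp add: norm_mult mult_ac flip: right_diff_distrib)
    qed
    also have "\<dots> = B * I i" unfolding I_def by (rule integral_mult_right_zero)
    finally have 2: "norm (?U - u (f' i)) \<le> B * I i" .
    show ?thesis using norm_triangle_le_diff[OF add_mono[OF 1 2]] by simp
  qed
  moreover have "(\<lambda>i. 2 * B * I i) \<longlonglongrightarrow> 2 * B * 0" by (intro tendsto_intros I0)
  ultimately have "norm (u f - ?U) \<le> 2 * B * 0" by (intro LIMSEQ_le_const) auto
  then show ?thesis by simp
qed

lemma L2_norm_pos:
  fixes \<psi> :: "real ^ 'n::finite \<Rightarrow> complex"
  assumes "rapid \<psi>" "\<psi> \<noteq> (\<lambda>_. 0)"
  shows "(LINT x|lborel. norm (\<psi> x) ^ 2) > 0"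
proof -
  obtain a where a: "\<psi> a \<noteq> 0" using assms(2) by auto
  have cont: "continuous_on UNIV \<psi>" using rapid_smooth[OF assms(1)] by (rule smooth_continuous_on)
  obtain C where C: "C \<ge> 0" "\<And>y. (1 + norm y ^ 2) ^ 0 * norm (derivs [] \<psi> y) \<le> C" using rapid_bound[OF assms(1)] by blast
  have int: "integrable lborel (\<lambda>x. norm (\<psi> x) ^ 2)"
  proof (rule Bochner_Integration.integrable_bound[OF _ _ AE_I2])
    show "integrable lborel (\<lambda>x. C * norm (\<psi> x))"
      by (intro integrable_mult_right integrable_norm rapid_integrable assms)
    show "(\<lambda>x. norm (\<psi> x) ^ 2) \<in> borel_measurable lborel"
      using rapid_measurable[OF assms(1)] by simp
    show "norm (norm (\<psi> x) ^ 2) \<le> norm (C * norm (\<psi> x))" for x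
      using C by (auto simp: power2_eq_square abs_mult intro!: mult_right_mono)
  qed
  let ?U = "\<psi> -` (- {0})"
  have op: "open ?U" using continuous_on_open_vimage[of UNIV \<psi>] cont by auto
  show ?thesis
  proof (rule ccontr)
    assume "\<not> ?thesis"
    moreover have "(LINT x|lborel. norm (\<psi> x) ^ 2) \<ge> 0" by (rule Bochner_Integration.integral_nonneg) simp
    ultimately have "(LINT x|lborel. norm (\<psi> x) ^ 2) = 0" by linarith
    then have "AE x in lborel. norm (\<psi> x) ^ 2 = 0"
      using integral_nonneg_eq_0_iff_AE[OF int] by simp
    then have "AE x in lborel. x \<notin> ?U" by (rule AE_mp) (auto intro!: AE_I2)
    then have "emeasure lborel ?U = 0" using op by (subst (asm) AE_iff_measurable[of ?U]) auto
    moreover have "a \<in> ?U" using a by simp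
    then obtain e where e: "e > 0" "ball a e \<subseteq> ?U" using op open_contains_ball by meson
    ultimately have "emeasure lborel (ball a e) = 0"
      using emeasure_mono[OF e(2), of lborel] op by simp
    then have "measure lborel (ball a e) = 0" by (simp add: measure_def)
    then show False using e(1) by simp
  qed
qed

text \<open>Covariance: substituting y + fst p merges the shifts up to a phase, which the norm
  removes.\<close>

lemma norm_sv_tfs:
  fixes \<psi> f :: "real ^ 'n::finite \<Rightarrow> complex"
  assumes t: "t > 0" and s: "s > 0" and f: "f \<in> gs_space t s" and \<psi>: "\<psi> \<in> gs_space t s"
  shows "norm (sv \<psi> (tfs p f) z) = norm (sv \<psi> f (z - p))"
proof -
  let ?g = "\<lambda>y. tfs p f y * cnj (tfs z \<psi> y)"
  have int: "integrable lborel ?g"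
    by (intro rapid_integrable rapid_slow_mult rapid_slow gs_space_rapid[OF t s] gs_space_cnj tfs_in_gs_space f \<psi> t s)
  have wave_shift: "wave a (x + y) * cnj (wave b (x + y)) = wave (a - b) x * cnj (wave (b - a) y)" for a b x y :: "real ^ 'n"
    by (simp add: exp_cnj inner_add_left inner_diff_right exp_add[symmetric] algebra_simps)
  have "?g (fst p + 1 *\<^sub>R y) = exp (\<i> * of_real (fst p \<bullet> (snd p - snd z))) * (f y * cnj (tfs (z - p) \<psi> y))" for y
  proof -
    have "?g (fst p + 1 *\<^sub>R y) = (wave (snd p) (fst p + y) * cnj (wave (snd z) (fst p + y))) * (f y * cnj (\<psi> (y - (fst z - fst p))))"
      by (simp add: tfs_apply algebra_simps)
    then show ?thesis unfolding wave_shift by (simp add: tfs_apply mult_ac)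
  qed
  then have "(LINT y|lborel. ?g y) = exp (\<i> * of_real (fst p \<bullet> (snd p - snd z))) * (LINT y|lborel. f y * cnj (tfs (z - p) \<psi> y))"
    using lborel_integral_affine[OF int, of 1 "fst p"] by (simp only: abs_one power_one scaleR_one integral_mult_right_zero one_neq_zero not_False_eq_True simp_thms)
  then show ?thesis
    unfolding sv_eq[OF t s \<psi>] by (simp add: norm_mult)
qed

section \<open>Wave front sets\<close>

definition dil :: "real \<Rightarrow> real \<Rightarrow> real \<Rightarrow> (real ^ 'n::finite) \<times> (real ^ 'n) \<Rightarrow> (real ^ 'n) \<times> (real ^ 'n)" where
  "dil t s l p = (l powr t *\<^sub>R fst p, l powr s *\<^sub>R snd p)"

lemma stft_eq: "stft \<psi> u x \<xi> = of_real (cd TYPE('n)) * u (tfs (x, \<xi>) \<psi>)"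
  for \<psi> :: "real ^ 'n::finite \<Rightarrow> complex"
  by (simp add: stft_def cd_def tfs_def)

text \<open>Phrased for a function \<open>V\<close> on phase space, so that linear changes of
  variables can be treated without reference to u or the window.\<close>

definition WF_regular :: "real \<Rightarrow> real \<Rightarrow> ((real ^ 'n::finite) \<times> (real ^ 'n) \<Rightarrow> complex) \<Rightarrow> (real ^ 'n) \<times> (real ^ 'n) \<Rightarrow> bool" where
  "WF_regular t s V p \<longleftrightarrow> (\<exists>U. open U \<and> U \<subseteq> - {0} \<and> p \<in> U \<and>
     (\<forall>r>0. \<exists>C. \<forall>l>0. \<forall>q\<in>U. exp (r * l) * norm (V (dil t s l q)) \<le> C))"

lemma WF_iff: "p \<in> WF t s \<psi> u \<longleftrightarrow> p \<noteq> 0 \<and> \<not> WF_regular t s (\<lambda>z. u (tfs z \<psi>)) p"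
  for \<psi> :: "real ^ 'n::finite \<Rightarrow> complex"
proof -
  let ?c = "cd TYPE('n)"
  have c: "?c > 0" by (rule cd_pos)
  have "bdd_above {exp (r * l) * norm (stft \<psi> u (l powr t *\<^sub>R x) (l powr s *\<^sub>R \<xi>)) | l x \<xi>. l > 0 \<and> (x, \<xi>) \<in> U} \<longleftrightarrow>
      (\<exists>C. \<forall>l>0. \<forall>q\<in>U. exp (r * l) * norm (u (tfs (dil t s l q) \<psi>)) \<le> C)" (is "?L \<longleftrightarrow> ?R") for r and U :: "((real ^ 'n) \<times> (real ^ 'n)) set"
  proof -
    have e: "exp (r * l) * norm (stft \<psi> u (l powr t *\<^sub>R x) (l powr s *\<^sub>R \<xi>)) = ?c * (exp (r * l) * norm (u (tfs (dil t s l (x, \<xi>)) \<psi>)))" for l x \<xi>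
      using c by (simp add: stft_eq norm_mult dil_def)
    have "?L \<longleftrightarrow> (\<exists>C. \<forall>l x \<xi>. l > 0 \<and> (x, \<xi>) \<in> U \<longrightarrow> ?c * (exp (r * l) * norm (u (tfs (dil t s l (x, \<xi>)) \<psi>))) \<le> C)"
      unfolding e bdd_above_def by blast
    also have "\<dots> \<longleftrightarrow> (\<exists>C. \<forall>l>0. \<forall>q\<in>U. ?c * (exp (r * l) * norm (u (tfs (dil t s l q) \<psi>))) \<le> C)"
      unfolding Ball_def split_paired_All by blast
    also have "\<dots> \<longleftrightarrow> ?R"
    proof
      assume "\<exists>C. \<forall>l>0. \<forall>q\<in>U. ?c * (exp (r * l) * norm (u (tfs (dil t s l q) \<psi>))) \<le> C"
      then obtain C where "\<forall>l>0. \<forall>q\<in>U. ?c * (exp (r * l) * norm (u (tfs (dil t s l q) \<psi>))) \<le> C" by blast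
      then have "\<forall>l>0. \<forall>q\<in>U. exp (r * l) * norm (u (tfs (dil t s l q) \<psi>)) \<le> C / ?c"
        using c by (simp add: pos_le_divide_eq mult.commute)
      then show ?R by blast
    next
      assume ?R
      then obtain C where "\<forall>l>0. \<forall>q\<in>U. exp (r * l) * norm (u (tfs (dil t s l q) \<psi>)) \<le> C" by blast
      then have "\<forall>l>0. \<forall>q\<in>U. ?c * (exp (r * l) * norm (u (tfs (dil t s l q) \<psi>))) \<le> ?c * C"
        using c by (simp add: mult_left_mono)
      then show "\<exists>C. \<forall>l>0. \<forall>q\<in>U. ?c * (exp (r * l) * norm (u (tfs (dil t s l q) \<psi>))) \<le> C" by blast
    qed
    finally show ?thesis .
  qed
  then show ?thesis unfolding WF_def WF_regular_def by (simp only: mem_Collect_eq)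
qed

text \<open>The neighbourhood is pulled back along L; since L maps 0 to 0, the preimage again avoids
  0.\<close>

lemma WF_regular_image:
  fixes L :: "(real ^ 'n::finite) \<times> (real ^ 'n) \<Rightarrow> (real ^ 'n) \<times> (real ^ 'n)"
  assumes reg: "WF_regular t s V (L p)"
    and L: "linear L" "inj L"
    and dil: "\<And>l q. L (dil t' s' l q) = dil t s l (L q)"
    and V: "\<And>z. norm (V' z) = c * norm (V (L z))" and c: "c \<ge> 0"
  shows "WF_regular t' s' V' p"
proof -
  obtain U where U: "open U" "U \<subseteq> - {0}" "L p \<in> U"
    and bd: "\<forall>r>0. \<exists>C. \<forall>l>0. \<forall>q\<in>U. exp (r * l) * norm (V (dil t s l q)) \<le> C"
    using reg unfolding WF_regular_def by blast
  show ?thesis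
    unfolding WF_regular_def
  proof (intro exI[of _ "L -` U"] conjI allI impI)
    show "open (L -` U)"
      using L(1) U(1) linear_continuous_on[OF linear_conv_bounded_linear[THEN iffD1, OF L(1)], of UNIV] by (simp add: open_vimage)
    show "L -` U \<subseteq> - {0}" using U(2) linear_0[OF L(1)] by auto
    show "p \<in> L -` U" using U(3) by simp
    fix r :: real assume "r > 0"
    then obtain C where C: "\<forall>l>0. \<forall>q\<in>U. exp (r * l) * norm (V (dil t s l q)) \<le> C" using bd by blast
    have "exp (r * l) * norm (V' (dil t' s' l q)) \<le> c * C" if "l > 0" "q \<in> L -` U" for l q
    proof -
      have "c * (exp (r * l) * norm (V (dil t s l (L q)))) \<le> c * C" using C that c by (intro mult_left_mono) auto
      then show ?thesis by (simp add: V dil mult_ac)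
    qed
    then show "\<exists>C. \<forall>l>0. \<forall>q\<in>L -` U. exp (r * l) * norm (V' (dil t' s' l q)) \<le> C" by blast
  qed
qed

context gs_pairing
begin

text \<open>The shifted new window is reconstructed from \<psi> and u is applied under the integral.
  By \<open>norm_sv_tfs\<close> the coefficients depend on z - p only in modulus, and translating
  the integration variable gives a convolution with K independent of p.\<close>

lemma stft_change_window:
  assumes \<psi>: "\<psi> \<in> gs_space t s" "\<psi> \<noteq> (\<lambda>_. 0)" and \<eta>: "\<eta> \<in> gs_space t s"
  shows "\<exists>K\<ge>0. \<forall>p. norm (u (tfs p \<eta>)) \<le> K * (LINT z|lborel. norm (sv \<psi> \<eta> z) * norm (u (tfs (p + z) \<psi>)))"
proof -
  define N where "N = (LINT x|lborel. norm (\<psi> x) ^ 2) / cd TYPE('n)"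
  have N: "N > 0" unfolding N_def
    using L2_norm_pos[OF gs_space_rapid[OF t s \<psi>(1)] \<psi>(2)] cd_pos[where 'n = 'n] by simp
  have "norm (u (tfs p \<eta>)) \<le> (1 / N) * (LINT z|lborel. norm (sv \<psi> \<eta> z) * norm (u (tfs (p + z) \<psi>)))" for p
  proof -
    let ?f = "tfs p \<eta>"
    have f: "?f \<in> gs_space t s" by (rule tfs_in_gs_space[OF t s \<eta>])
    let ?F = "\<lambda>z. sv \<psi> ?f z / of_real N"
    have cF: "continuous_on UNIV ?F" using N by (intro continuous_intros continuous_on_sv[OF t s \<psi>(1) f]) auto
    have "u ?f = (LINT z|lborel. cnj (?F z) * u (tfs z \<psi>))"
    proof (rule u_integral[OF \<psi>(1) f])
      show "?F \<in> borel_measurable borel" by (rule borel_measurable_continuous_onI[OF cF])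
      show "\<exists>C\<ge>0. \<forall>z. norm (?F z) \<le> C * exp (- (r * wt t s z))" for r
      proof -
        obtain C where C: "C \<ge> 0" "\<And>z. norm (sv \<psi> ?f z) \<le> C * exp (- (r * wt t s z))"
          using sv_decay[OF t s f \<psi>(1)] by blast
        have "norm (?F z) \<le> (C / N) * exp (- (r * wt t s z))" for z
          using C(2)[of z] N by (simp add: norm_divide divide_right_mono)
        then show ?thesis using C(1) N by (intro exI[of _ "C / N"]) auto
      qed
      show "derivs w ?f y = (LINT z|lborel. ?F z * derivs w (tfs z \<psi>) y)" for w y
      proof -
        have "(LINT z|lborel. ?F z * derivs w (tfs z \<psi>) y) = (LINT z|lborel. (sv \<psi> ?f z * derivs w (tfs z \<psi>) y) / of_real N)"
          by simp
        also have "\<dots> = (LINT z|lborel. sv \<psi> ?f z * derivs w (tfs z \<psi>) y) / of_real N"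
          by (rule integral_divide_zero)
        also have "\<dots> = derivs w ?f y"
          unfolding stft_reconstruction[OF t s \<psi>(1) f] N_def[symmetric] using N by simp
        finally show ?thesis ..
      qed
    qed
    then have "norm (u ?f) \<le> (LINT z|lborel. norm (cnj (?F z) * u (tfs z \<psi>)))"
      by (simp only: integral_norm_bound)
    also have "(\<lambda>z. norm (cnj (?F z) * u (tfs z \<psi>))) = (\<lambda>z. (1 / N) * (norm (sv \<psi> \<eta> (z - p)) * norm (u (tfs z \<psi>))))"
      using N by (simp add: fun_eq_iff norm_mult norm_divide norm_sv_tfs[OF t s \<eta> \<psi>(1)])
    also have "(LINT z|lborel. (1 / N) * (norm (sv \<psi> \<eta> (z - p)) * norm (u (tfs z \<psi>)))) =
        (1 / N) * (LINT z|lborel. norm (sv \<psi> \<eta> (z - p)) * norm (u (tfs z \<psi>)))" by (rule integral_mult_right_zero)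
    also have "(LINT z|lborel. norm (sv \<psi> \<eta> (z - p)) * norm (u (tfs z \<psi>))) =
        (LINT z|lborel. norm (sv \<psi> \<eta> z) * norm (u (tfs (p + z) \<psi>)))"
    proof -
      have m: "(\<lambda>z. norm (sv \<psi> \<eta> (z - p)) * norm (u (tfs z \<psi>))) \<in> borel_measurable borel"
        by (intro borel_measurable_continuous_onI continuous_intros continuous_on_u_tfs \<psi>
            continuous_on_compose2[OF continuous_on_sv[OF t s \<psi>(1) \<eta>]]) auto
      have "(LINT z|lborel. norm (sv \<psi> \<eta> (z - p)) * norm (u (tfs z \<psi>))) =
          (LINT z|distr lborel borel ((+) p). norm (sv \<psi> \<eta> (z - p)) * norm (u (tfs z \<psi>)))"
        by (simp only: lborel_distr_plus)
      also have "\<dots> = (LINT z|lborel. norm (sv \<psi> \<eta> ((p + z) - p)) * norm (u (tfs (p + z) \<psi>)))"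
        by (rule integral_distr[OF _ m]) simp
      finally show ?thesis by simp
    qed
    finally show ?thesis .
  qed
  then show ?thesis using N by (intro exI[of _ "1 / N"]) auto
qed

text \<open>In the convolution bound, a shift z that is small compared with the dilation parameter l keeps the
  argument in the regular neighbourhood; otherwise l is bounded by a multiple of \<open>wt t s z\<close> and the decay
  of \<open>sv \<psi> \<eta>\<close> beats the growth of u.\<close>

lemma WF_regular_change_window:
  assumes \<psi>: "\<psi> \<in> gs_space t s" "\<psi> \<noteq> (\<lambda>_. 0)" and \<eta>: "\<eta> \<in> gs_space t s"
    and reg: "WF_regular t s (\<lambda>z. u (tfs z \<psi>)) p"
  shows "WF_regular t s (\<lambda>z. u (tfs z \<eta>)) p"
proof -
  obtain U where U: "open U" "U \<subseteq> - {0}" "p \<in> U"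
    and bd: "\<forall>r>0. \<exists>C. \<forall>l>0. \<forall>q\<in>U. exp (r * l) * norm (u (tfs (dil t s l q) \<psi>)) \<le> C"
    using reg unfolding WF_regular_def by blast
  obtain e where e: "e > 0" "ball p e \<subseteq> U" using U open_contains_ball by meson
  obtain K where K: "K \<ge> 0" "\<And>p. norm (u (tfs p \<eta>)) \<le> K * (LINT z|lborel. norm (sv \<psi> \<eta> z) * norm (u (tfs (p + z) \<psi>)))"
    using stft_change_window[OF \<psi> \<eta>] by blast
  obtain C0 r0 where C0: "C0 \<ge> 0" "r0 \<ge> 0" "\<And>z. norm (u (tfs z \<psi>)) \<le> C0 * exp (r0 * wt t s z)"
    using u_tfs_growth[OF \<psi>(1)] by blast
  \<comment> \<open>A rescaled shift with components below \<delta> has norm below e / 2 and so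
    keeps points of the half ball inside \<open>ball p e\<close>.\<close>
  define \<delta> where "\<delta> = e / 4"
  have \<delta>: "\<delta> > 0" using e by (simp add: \<delta>_def)
  \<comment> \<open>If norm x is at least \<delta> * l powr t, then l is at most \<delta> powr (- 1
    / t) * norm x powr (1 / t); the same holds with s.\<close>
  define \<kappa> where "\<kappa> = max (\<delta> powr (- 1 / t)) (\<delta> powr (- 1 / s))"
  define \<kappa>2 where "\<kappa>2 = max (2 powr (1 / t)) (2 powr (1 / s) :: real)"
  define R where "R = (norm p + e) powr (1 / t) + (norm p + e) powr (1 / s)"
  have pos: "\<kappa> \<ge> 0" "\<kappa>2 \<ge> 0" "R \<ge> 0" by (auto simp: \<kappa>_def \<kappa>2_def R_def le_max_iff_disj)
  have wt_dil: "wt t s (dil t s l q) = l * wt t s q" if "l > 0" for l and q :: "(real ^ 'n) \<times> (real ^ 'n)"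
    using that t s by (simp add: wt_def dil_def powr_mult powr_powr distrib_left)
  have wt_add: "wt t s (v + z) \<le> \<kappa>2 * (wt t s v + wt t s z)" for v z :: "(real ^ 'n) \<times> (real ^ 'n)"
  proof -
    have *: "norm (x + y) powr (1 / a) \<le> \<kappa>2 * (norm x powr (1 / a) + norm y powr (1 / a))"
      if "a > 0" "2 powr (1 / a) \<le> \<kappa>2" for a and x y :: "real ^ 'n"
    proof -
      have "norm (x + y) powr (1 / a) \<le> (2 * max (norm x) (norm y)) powr (1 / a)"
        using norm_triangle_ineq[of x y] that by (intro powr_mono2) auto
      also have "\<dots> = 2 powr (1 / a) * max (norm x) (norm y) powr (1 / a)" by (simp add: powr_mult)
      also have "\<dots> \<le> \<kappa>2 * (norm x powr (1 / a) + norm y powr (1 / a))"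
        using that pos by (intro mult_mono) (auto simp: max_def)
      finally show ?thesis .
    qed
    show ?thesis
      using *[OF t, of "fst v" "fst z"] *[OF s, of "snd v" "snd z"] by (simp add: wt_def \<kappa>2_def distrib_left)
  qed
  have wtR: "wt t s q \<le> R" if "q \<in> ball p (e / 2)" for q :: "(real ^ 'n) \<times> (real ^ 'n)"
  proof -
    have "norm q \<le> norm p + e" using that norm_triangle_ineq[of p "q - p"] e by (simp add: dist_norm norm_minus_commute)
    then have "norm (fst q) \<le> norm p + e" "norm (snd q) \<le> norm p + e"
      using norm_fst_le[of "fst q" "snd q"] norm_snd_le[of "snd q" "fst q"] by auto
    then show ?thesis unfolding wt_def R_def using t s by (intro add_mono powr_mono2) auto
  qed
  show ?thesis
    unfolding WF_regular_def
  proof (intro exI[of _ "ball p (e / 2)"] conjI allI impI)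
    have "ball p (e / 2) \<subseteq> ball p e" using e by (intro subset_ball) simp
    then show "ball p (e / 2) \<subseteq> - {0}" using U(2) e(2) by blast
    fix r :: real assume r: "r > 0"
    then obtain C1 where C1: "\<And>l q. l > 0 \<Longrightarrow> q \<in> U \<Longrightarrow> exp (r * l) * norm (u (tfs (dil t s l q) \<psi>)) \<le> C1"
      using bd by blast
    \<comment> \<open>Rate needed for large shifts: r * \<kappa> for exp (r * l), the rest for the
      growth of u at the shifted point, after l is replaced by \<kappa> * wt z.\<close>
    define \<rho> where "\<rho> = r * \<kappa> + r0 * (\<kappa>2 * (\<kappa> * R + 1))"
    have \<rho>: "\<rho> \<ge> 0" using r C0 pos by (simp add: \<rho>_def)
    have pt: "exp (r * l) * norm (u (tfs (dil t s l q + z) \<psi>)) \<le> (\<bar>C1\<bar> + C0) * exp (\<rho> * wt t s z)"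
      if l: "l > 0" and q: "q \<in> ball p (e / 2)" for l q z
    proof (cases "norm (fst z) < \<delta> * l powr t \<and> norm (snd z) < \<delta> * l powr s")
      case True
      \<comment> \<open>Undoing the dilation on z moves the shift inside the argument, so regularity
        on U applies at q + z' with the same l.\<close>
      define z' where "z' = (fst z /\<^sub>R l powr t, snd z /\<^sub>R l powr s)"
      have z': "dil t s l q + z = dil t s l (q + z')"
        using l by (simp add: dil_def z'_def prod_eq_iff scaleR_add_right)
      have "norm z' \<le> norm (fst z') + norm (snd z')" using norm_Pair_le[of "fst z'" "snd z'"] by simp
      also have "\<dots> < \<delta> + \<delta>"
        using True l by (intro add_strict_mono) (auto simp: z'_def field_simps)
      finally have "q + z' \<in> ball p e"
        using q norm_triangle_ineq[of "q - p" z'] by (simp add: \<delta>_def dist_norm norm_minus_commute algebra_simps)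
      then have "exp (r * l) * norm (u (tfs (dil t s l q + z) \<psi>)) \<le> C1"
        unfolding z' using C1 l e by blast
      also have "\<dots> \<le> (\<bar>C1\<bar> + C0) * 1" using C0 by simp
      also have "\<dots> \<le> (\<bar>C1\<bar> + C0) * exp (\<rho> * wt t s z)"
        using C0 \<rho> wt_nonneg[of t s z] by (intro mult_left_mono) auto
      finally show ?thesis .
    next
      case False
      have lw: "l \<le> \<kappa> * wt t s z"
      proof -
        have *: "l \<le> \<kappa> * a powr (1 / k)" if "\<delta> * l powr k \<le> a" "k > 0" "\<delta> powr (- 1 / k) \<le> \<kappa>" for a k
        proof -
          have "(\<delta> * l powr k) powr (1 / k) \<le> a powr (1 / k)" using that \<delta> l by (intro powr_mono2) auto
          then have "\<delta> powr (1 / k) * l \<le> a powr (1 / k)" using that l by (simp add: powr_mult powr_powr)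
          then have "\<delta> powr (- 1 / k) * (\<delta> powr (1 / k) * l) \<le> \<delta> powr (- 1 / k) * a powr (1 / k)" by (intro mult_left_mono) auto
          moreover have "\<delta> powr (- 1 / k) * (\<delta> powr (1 / k) * l) = l" using \<delta> by (simp add: powr_minus)
          moreover have "\<delta> powr (- 1 / k) * a powr (1 / k) \<le> \<kappa> * a powr (1 / k)" using that by (intro mult_right_mono) auto
          ultimately show ?thesis by linarith
        qed
        have "l \<le> \<kappa> * norm (fst z) powr (1 / t) \<or> l \<le> \<kappa> * norm (snd z) powr (1 / s)"
          using False *[of t "norm (fst z)"] *[of s "norm (snd z)"] t s by (auto simp: \<kappa>_def not_less)
        moreover have "\<kappa> * norm (fst z) powr (1 / t) \<ge> 0" "\<kappa> * norm (snd z) powr (1 / s) \<ge> 0" using pos by auto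
        ultimately show ?thesis unfolding wt_def distrib_left by linarith
      qed
      have "wt t s (dil t s l q + z) \<le> \<kappa>2 * (l * wt t s q + wt t s z)" using wt_add[of "dil t s l q" z] wt_dil[OF l] by simp
      also have "\<dots> \<le> \<kappa>2 * (\<kappa> * wt t s z * R + wt t s z)"
        using lw wtR[OF q] pos l wt_nonneg[of t s q] wt_nonneg[of t s z]
        by (intro mult_left_mono add_right_mono mult_mono) auto
      also have "\<dots> = (\<kappa>2 * (\<kappa> * R + 1)) * wt t s z" by (simp add: algebra_simps)
      finally have w: "wt t s (dil t s l q + z) \<le> (\<kappa>2 * (\<kappa> * R + 1)) * wt t s z" .
      have "exp (r * l) * norm (u (tfs (dil t s l q + z) \<psi>)) \<le> exp (r * l) * (C0 * exp (r0 * wt t s (dil t s l q + z)))"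
        by (intro mult_left_mono C0) auto
      also have "\<dots> = C0 * exp (r * l + r0 * wt t s (dil t s l q + z))" by (simp add: exp_add)
      also have "\<dots> \<le> C0 * exp (\<rho> * wt t s z)"
      proof (intro mult_left_mono C0)
        have "r * l + r0 * wt t s (dil t s l q + z) \<le> r * (\<kappa> * wt t s z) + r0 * ((\<kappa>2 * (\<kappa> * R + 1)) * wt t s z)"
          using r C0 by (intro add_mono mult_left_mono lw w) auto
        then show "exp (r * l + r0 * wt t s (dil t s l q + z)) \<le> exp (\<rho> * wt t s z)"
          by (simp add: \<rho>_def algebra_simps)
      qed
      also have "\<dots> \<le> (\<bar>C1\<bar> + C0) * exp (\<rho> * wt t s z)" by (intro mult_right_mono) auto
      finally show ?thesis .
    qed
    obtain C3 where C3: "C3 \<ge> 0" "\<And>z. norm (sv \<psi> \<eta> z) \<le> C3 * exp (- ((\<rho> + 1) * wt t s z))"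
      using sv_decay[OF t s \<eta> \<psi>(1)] by blast
    let ?C = "C3 * (\<bar>C1\<bar> + C0)"
    have "exp (r * l) * norm (u (tfs (dil t s l q) \<eta>)) \<le> K * (LINT z|lborel. ?C * exp (- wt t s (z :: (real ^ 'n) \<times> (real ^ 'n))))"
      if l: "l > 0" and q: "q \<in> ball p (e / 2)" for l q
    proof -
      let ?g = "\<lambda>z. norm (sv \<psi> \<eta> z) * norm (u (tfs (dil t s l q + z) \<psi>))"
      have "exp (r * l) * norm (u (tfs (dil t s l q) \<eta>)) \<le> exp (r * l) * (K * (LINT z|lborel. ?g z))"
        by (intro mult_left_mono K) auto
      also have "\<dots> = K * (exp (r * l) * (LINT z|lborel. ?g z))" by (simp only: mult_ac)
      also have "exp (r * l) * (LINT z|lborel. ?g z) = (LINT z|lborel. exp (r * l) * ?g z)"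
        by (rule integral_mult_right_zero[symmetric])
      also have "\<dots> \<le> (LINT z|lborel. ?C * exp (- wt t s (z :: (real ^ 'n) \<times> (real ^ 'n))))"
      proof (rule integral_mono')
        show "integrable lborel (\<lambda>z :: (real ^ 'n) \<times> (real ^ 'n). ?C * exp (- wt t s z))"
          by (intro integrable_mult_right integrable_exp_wt t s)
        show "0 \<le> ?C * exp (- wt t s z)" for z :: "(real ^ 'n) \<times> (real ^ 'n)" using C3 C0 by simp
        fix z
        have "exp (r * l) * ?g z = norm (sv \<psi> \<eta> z) * (exp (r * l) * norm (u (tfs (dil t s l q + z) \<psi>)))" by (simp only: mult_ac)
        also have "\<dots> \<le> (C3 * exp (- ((\<rho> + 1) * wt t s z))) * ((\<bar>C1\<bar> + C0) * exp (\<rho> * wt t s z))"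
          using C3 by (intro mult_mono C3 pt l q) auto
        also have "\<dots> = ?C * (exp (- ((\<rho> + 1) * wt t s z)) * exp (\<rho> * wt t s z))" by (simp only: mult_ac)
        also have "exp (- ((\<rho> + 1) * wt t s z)) * exp (\<rho> * wt t s z) = exp (- wt t s z)"
          unfolding exp_add[symmetric] by (simp add: algebra_simps)
        finally show "exp (r * l) * ?g z \<le> ?C * exp (- wt t s z)" .
      qed
      finally show ?thesis using K(1) by (simp add: mult_left_mono)
    qed
    then show "\<exists>C. \<forall>l>0. \<forall>q\<in>ball p (e / 2). exp (r * l) * norm (u (tfs (dil t s l q) \<eta>)) \<le> C" by blast
  qed (use e in auto)
qed

theorem WF_window_independent:
  assumes "\<psi> \<in> gs_space t s - {\<lambda>_. 0}" "\<eta> \<in> gs_space t s - {\<lambda>_. 0}"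
  shows "WF t s \<psi> u = WF t s \<eta> u"
  using assms WF_regular_change_window[of \<psi> \<eta>] WF_regular_change_window[of \<eta> \<psi>]
  by (auto simp: WF_iff)

end

text \<open>Regularity is pulled back along L and, for the converse, along its inverse M; the
  dilation rule and the modulus identity transfer to M by inverting them.\<close>

lemma WF_transport:
  fixes L M :: "(real ^ 'n::finite) \<times> (real ^ 'n) \<Rightarrow> (real ^ 'n) \<times> (real ^ 'n)"
  assumes L: "linear L" and M: "linear M" and L_M: "\<And>p. L (M p) = p" and M_L: "\<And>p. M (L p) = p"
    and dil: "\<And>l q. L (dil t' s' l q) = dil t s l (L q)"
    and V: "\<And>z. norm (v (tfs z \<eta>)) = c * norm (u (tfs (L z) \<phi>))" and c: "c > 0"
  shows "WF t' s' \<eta> v = M ` WF t s \<phi> u"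
proof -
  have inj: "inj L" "inj M" using L_M M_L by (metis injI)+
  have dilM: "M (dil t s l q) = dil t' s' l (M q)" for l q
    using dil[of l "M q"] L_M M_L by metis
  have VM: "norm (u (tfs z \<phi>)) = (1 / c) * norm (v (tfs (M z) \<eta>))" for z
    using V[of "M z"] c by (simp add: L_M)
  have reg: "WF_regular t' s' (\<lambda>z. v (tfs z \<eta>)) p \<longleftrightarrow> WF_regular t s (\<lambda>z. u (tfs z \<phi>)) (L p)" for p
  proof
    assume "WF_regular t s (\<lambda>z. u (tfs z \<phi>)) (L p)"
    then show "WF_regular t' s' (\<lambda>z. v (tfs z \<eta>)) p"
      by (rule WF_regular_image[where L = L and c = c and t = t and s = s and V = "\<lambda>z. u (tfs z \<phi>)"])
         (use L inj dil V c in auto)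
  next
    assume "WF_regular t' s' (\<lambda>z. v (tfs z \<eta>)) p"
    then have "WF_regular t' s' (\<lambda>z. v (tfs z \<eta>)) (M (L p))" by (simp only: M_L)
    then show "WF_regular t s (\<lambda>z. u (tfs z \<phi>)) (L p)"
      by (rule WF_regular_image[where L = M and c = "1 / c" and t = t' and s = s' and V = "\<lambda>z. v (tfs z \<eta>)"])
         (use M inj dilM VM c in auto)
  qed
  have z: "L p = 0 \<longleftrightarrow> p = 0" for p using linear_0[OF L] linear_0[OF M] M_L by metis
  have iff: "p \<in> WF t' s' \<eta> v \<longleftrightarrow> L p \<in> WF t s \<phi> u" for p unfolding WF_iff reg z ..
  show ?thesis
  proof (intro equalityI subsetI)
    fix p assume "p \<in> WF t' s' \<eta> v"
    then show "p \<in> M ` WF t s \<phi> u" using iff[of p] M_L[of p] by (metis imageI)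
  next
    fix p assume "p \<in> M ` WF t s \<phi> u"
    then show "p \<in> WF t' s' \<eta> v" using iff L_M by auto
  qed
qed

section \<open>The Fourier transform between test spaces, and the two identities\<close>

lemma fourier_inj_on:
  assumes "t > 0" "s > 0"
  shows "inj_on fourier (gs_space t s)"
proof (rule inj_onI)
  fix f g :: "real ^ 'n::finite \<Rightarrow> complex"
  assume fg: "f \<in> gs_space t s" "g \<in> gs_space t s" "fourier f = fourier g"
  have "f y = g y" for y
    using fourier_inversion[OF gs_space_rapid[OF assms fg(1)], of y] fourier_inversion[OF gs_space_rapid[OF assms fg(2)], of y] fg(3) by simp
  then show "f = g" by auto
qed

lemma minus_matrix_vector: "(- A) *v x = - (A *v x)" for A :: "real ^ 'n ^ 'm"
  by (simp add: vec_eq_iff matrix_vector_mult_def sum_negf)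

text \<open>The preimage is the reflected Fourier transform of \<eta>, by inversion. It lies in the
  right space by \<open>gs_space_fourier\<close> with the roles of s and t exchanged, the reflection
  being a linear substitution.\<close>

lemma fourier_surj:
  fixes \<eta> :: "real ^ 'n::finite \<Rightarrow> complex"
  assumes t: "t > 0" and s: "s > 0" and st: "s + t > 1" and \<eta>: "\<eta> \<in> gs_space s t"
  shows "\<exists>\<phi>\<in>gs_space t s. fourier \<phi> = \<eta>"
proof -
  let ?\<phi> = "\<lambda>y. fourier \<eta> (- y)"
  have re: "rapid \<eta>" by (rule gs_space_rapid[OF s t \<eta>])
  have g: "fourier \<eta> \<in> gs_space t s" using gs_space_fourier[OF s t _ \<eta>] st by simp
  have "(\<lambda>y. fourier \<eta> ((- mat 1 :: real ^ 'n ^ 'n) *v y)) \<in> gs_space t s"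
    by (rule gs_space_matrix[OF t s g, of "- mat 1"]) (simp add: matrix_eq minus_matrix_vector vec.neg flip: matrix_vector_mul_assoc)
  then have \<phi>: "?\<phi> \<in> gs_space t s" by (simp add: minus_matrix_vector)
  have "fourier ?\<phi> \<xi> = \<eta> \<xi>" for \<xi>
  proof -
    have "integrable lborel (\<lambda>x. wave (- \<xi>) x * ?\<phi> x)"
      by (intro rapid_integrable rapid_wave_mult gs_space_rapid[OF t s \<phi>])
    from lborel_integral_affine[OF this, of "-1" 0]
    have "fourier ?\<phi> \<xi> = of_real (cd TYPE('n)) * (LINT x|lborel. wave \<xi> x * fourier \<eta> x)"
      by (simp add: fourier_eq)
    also have "\<dots> = fourier (fourier \<eta>) (- \<xi>)" by (simp add: fourier_eq[of "fourier \<eta>"])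
    also have "\<dots> = \<eta> \<xi>" by (rule fourier_inversion[OF re])
    finally show ?thesis .
  qed
  then show ?thesis using \<phi> by blast
qed

text \<open>The Fourier transform turns translations into modulations and modulations into
  translations of opposite sign; the phase comes from restoring their order. It is kept inside the
  transform so that the preimage of the shifted window is explicit.\<close>

lemma fourier_tfs:
  fixes \<phi> :: "real ^ 'n::finite \<Rightarrow> complex"
  assumes "rapid \<phi>" "rapid (tfs (- \<xi>, x) \<phi>)"
  shows "fourier (\<lambda>y. exp (\<i> * of_real (x \<bullet> \<xi>)) * tfs (- \<xi>, x) \<phi> y) = tfs (x, \<xi>) (fourier \<phi>)"
proof
  fix \<zeta>
  let ?h = "\<lambda>y. wave (- \<zeta>) y * tfs (- \<xi>, x) \<phi> y"
  have int: "integrable lborel ?h" by (intro rapid_integrable rapid_wave_mult assms)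
  have ph: "wave (- \<zeta>) (y - \<xi>) * wave x (y - \<xi>) = exp (\<i> * of_real (\<xi> \<bullet> \<zeta> - x \<bullet> \<xi>)) * wave (- (\<zeta> - x)) y" for y
    by (simp add: exp_add[symmetric] inner_diff_left inner_diff_right inner_commute algebra_simps)
  have "?h (- \<xi> + 1 *\<^sub>R y) = exp (\<i> * of_real (\<xi> \<bullet> \<zeta> - x \<bullet> \<xi>)) * (wave (- (\<zeta> - x)) y * \<phi> y)" for y
    using ph[of y] by (simp add: tfs_apply)
  then have "(LINT y|lborel. ?h y) = exp (\<i> * of_real (\<xi> \<bullet> \<zeta> - x \<bullet> \<xi>)) * (LINT y|lborel. wave (- (\<zeta> - x)) y * \<phi> y)"
    using lborel_integral_affine[OF int, of 1 "- \<xi>"]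
    by (simp only: abs_one power_one scaleR_one integral_mult_right_zero one_neq_zero not_False_eq_True simp_thms)
  then have "fourier (tfs (- \<xi>, x) \<phi>) \<zeta> = exp (\<i> * of_real (\<xi> \<bullet> \<zeta> - x \<bullet> \<xi>)) * fourier \<phi> (\<zeta> - x)"
    unfolding fourier_eq by (simp only: mult_ac)
  then have "fourier (\<lambda>y. exp (\<i> * of_real (x \<bullet> \<xi>)) * tfs (- \<xi>, x) \<phi> y) \<zeta> =
      (exp (\<i> * of_real (x \<bullet> \<xi>)) * exp (\<i> * of_real (\<xi> \<bullet> \<zeta> - x \<bullet> \<xi>))) * fourier \<phi> (\<zeta> - x)"
    unfolding fourier_cmult by (simp only: mult.assoc)
  also have "exp (\<i> * of_real (x \<bullet> \<xi>)) * exp (\<i> * of_real (\<xi> \<bullet> \<zeta> - x \<bullet> \<xi>)) = wave \<xi> \<zeta>"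
    by (simp add: exp_add[symmetric] inner_commute algebra_simps)
  finally show "fourier (\<lambda>y. exp (\<i> * of_real (x \<bullet> \<xi>)) * tfs (- \<xi>, x) \<phi> y) \<zeta> = tfs (x, \<xi>) (fourier \<phi>) \<zeta>"
    by (simp add: tfs_apply)
qed

lemma J_map_apply: "J_map p = (snd p, - fst p)"
  by (cases p) (simp add: J_map_def block_apply_def minus_matrix_vector)

text \<open>The window is an argument of \<open>WF\<close>, so both identities are asserted for all
  nonzero windows; in the first one the two sides use unrelated windows from different
  spaces.\<close>

theorem proposition3p6:
  fixes s t :: real and u :: "(real ^ 'n::finite \<Rightarrow> complex) \<Rightarrow> complex"
  assumes "s > 0" and "t > 0" and "s + t > 1" and "u \<in> gs_dual t s"
  shows "(\<forall>\<psi> \<in> gs_space t s - {\<lambda>_. 0}. \<forall>\<eta> \<in> gs_space s t - {\<lambda>_. 0}.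
            WF s t \<eta> (fourier_dual t s u) = J_map ` WF t s \<psi> u) \<and>
         (\<forall>\<psi> \<in> gs_space t s - {\<lambda>_. 0}. \<forall>A :: real ^ 'n ^ 'n. invertible A \<longrightarrow>
            WF t s \<psi> (metaplectic_dual A u) =
              block_apply (matrix_inv A) 0 0 (transpose A) ` WF t s \<psi> u)"
proof (intro conjI ballI allI impI)
  interpret gs_pairing t s u using assms by unfold_locales
  fix \<psi> :: "real ^ 'n \<Rightarrow> complex" assume \<psi>: "\<psi> \<in> gs_space t s - {\<lambda>_. 0}"
  {
    fix \<eta> :: "real ^ 'n \<Rightarrow> complex" assume \<eta>: "\<eta> \<in> gs_space s t - {\<lambda>_. 0}"
    obtain \<phi> where \<phi>: "\<phi> \<in> gs_space t s" "fourier \<phi> = \<eta>"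
      using fourier_surj[OF t s assms(3), of \<eta>] \<eta> by auto
    have "fourier (\<lambda>_ :: real ^ 'n. 0) = (\<lambda>_. 0)" by (simp add: fun_eq_iff fourier_eq)
    then have \<phi>0: "\<phi> \<in> gs_space t s - {\<lambda>_. 0}" using \<phi> \<eta> by auto
    \<comment> \<open>Inverse of \<open>J_map\<close>; it exchanges the components and therefore the
      dilation exponents.\<close>
    define L :: "(real ^ 'n) \<times> (real ^ 'n) \<Rightarrow> (real ^ 'n) \<times> (real ^ 'n)" where "L = (\<lambda>p. (- snd p, fst p))"
    have "WF s t \<eta> (fourier_dual t s u) = J_map ` WF t s \<phi> u"
    proof (rule WF_transport[where L = L and c = 1])
      show "linear L" "linear J_map" unfolding J_map_apply [abs_def] L_def by (auto intro!: linearI)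
      show "norm (fourier_dual t s u (tfs z \<eta>)) = 1 * norm (u (tfs (L z) \<phi>))" for z
      proof -
        obtain x \<xi> where z: "z = (x, \<xi>)" by (cases z)
        let ?c = "exp (\<i> * complex_of_real (x \<bullet> \<xi>))"
        have g: "tfs (- \<xi>, x) \<phi> \<in> gs_space t s" using tfs_in_gs_space[OF t s \<phi>(1)] .
        have "tfs z \<eta> = fourier (\<lambda>y. ?c * tfs (- \<xi>, x) \<phi> y)"
          using fourier_tfs[OF gs_space_rapid[OF t s \<phi>(1)] gs_space_rapid[OF t s g]] by (simp add: z \<phi>(2))
        then have "fourier_dual t s u (tfs z \<eta>) = u (\<lambda>y. ?c * tfs (- \<xi>, x) \<phi> y)"
          \<comment> \<open>Injectivity identifies the preimage chosen by \<open>inv_into\<close>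
            with the explicit one; its phase then leaves u as a factor of modulus 1.\<close>
          unfolding fourier_dual_def
          by (simp only: inv_into_f_f[OF fourier_inj_on[OF t s] gs_space_cmult[OF t s g]])
        also have "\<dots> = cnj ?c * u (tfs (- \<xi>, x) \<phi>)" by (rule u_cmult[OF g])
        finally show ?thesis by (simp add: norm_mult z L_def)
      qed
    qed (auto simp: L_def J_map_apply dil_def)
    also have "WF t s \<phi> u = WF t s \<psi> u" using \<phi>0 \<psi> by (rule WF_window_independent)
    finally show "WF s t \<eta> (fourier_dual t s u) = J_map ` WF t s \<psi> u" .
  next
    fix A :: "real ^ 'n ^ 'n" assume A: "invertible A"
    let ?B = "matrix_inv A"
    have AB: "A ** ?B = mat 1" "?B ** A = mat 1" 
      \<comment> \<open>\<open>matrix_inv\<close> is a choice; its defining property gives both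
        one-sided inverses.\<close>
      using someI_ex[OF A[unfolded invertible_def]] by (simp_all add: matrix_inv_def)
    have tAB: "transpose ?B ** transpose A = mat 1" "transpose A ** transpose ?B = mat 1"
      using AB by (simp_all flip: matrix_transpose_mul add: transpose_mat)
    let ?\<phi> = "\<lambda>y. \<psi> (?B *v y)"
    have \<phi>: "?\<phi> \<in> gs_space t s" using gs_space_matrix[OF t s _ AB(1)] \<psi> by blast
    obtain a where a: "\<psi> a \<noteq> 0" using \<psi> by auto
    have "?\<phi> (A *v a) \<noteq> 0" using a AB by (simp add: matrix_vector_mul_assoc)
    then have \<phi>0: "?\<phi> \<in> gs_space t s - {\<lambda>_. 0}" using \<phi> by (auto dest: fun_cong)
    define L :: "(real ^ 'n) \<times> (real ^ 'n) \<Rightarrow> (real ^ 'n) \<times> (real ^ 'n)" where "L = (\<lambda>p. (A *v fst p, transpose ?B *v snd p))"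
    define M where "M = block_apply ?B 0 0 (transpose A)"
    have M: "M p = (?B *v fst p, transpose A *v snd p)" for p
      by (cases p) (simp add: M_def block_apply_def)
    let ?k = "norm (csqrt (complex_of_real (det A))) * (1 / \<bar>det A\<bar>)"
    have det: "det A \<noteq> 0" using A invertible_det_nz by blast
    have "WF t s \<psi> (metaplectic_dual A u) = M ` WF t s ?\<phi> u"
    proof (rule WF_transport[where L = L and c = ?k])
      show "linear L" "linear M" unfolding M [abs_def] L_def
        by (auto intro!: linearI simp: matrix_vector_right_distrib matrix_vector_mult_scaleR simp del: transpose_matrix_vector)
      show "L (M p) = p" "M (L p) = p" for p
        unfolding M L_def by (simp_all add: matrix_vector_mul_assoc AB tAB del: transpose_matrix_vector)
      show "L (dil t s l q) = dil t s l (L q)" for l q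
        by (simp add: L_def dil_def matrix_vector_mult_scaleR del: transpose_matrix_vector)
      show "norm (metaplectic_dual A u (tfs z \<psi>)) = ?k * norm (u (tfs (L z) ?\<phi>))" for z
      proof -
        \<comment> \<open>Composition with the inverse matrix moves the frequency by its transpose
          and the position by A, so the substituted shift is a shift of the substituted
          window.\<close>
        have "(?B *v y) \<bullet> snd z = y \<bullet> (transpose ?B *v snd z)" for y
          by (metis dot_lmul_matrix inner_commute transpose_matrix_vector)
        moreover have "?B *v (y - A *v fst z) = ?B *v y - fst z" for y
          by (simp add: matrix_vector_mult_diff_distrib matrix_vector_mul_assoc AB)
        ultimately have "(\<lambda>y. tfs z \<psi> (?B *v y)) = tfs (L z) ?\<phi>"
          by (simp add: tfs_apply L_def fun_eq_iff)
        then show ?thesis by (simp add: metaplectic_dual_def compose_dual_def norm_mult norm_divide)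
      qed
      show "?k > 0" using det by simp
    qed
    also have "WF t s ?\<phi> u = WF t s \<psi> u" using \<phi>0 \<psi> by (rule WF_window_independent)
    finally show "WF t s \<psi> (metaplectic_dual A u) = block_apply ?B 0 0 (transpose A) ` WF t s \<psi> u"
      by (simp add: M_def)
  }
qed

end
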